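(* Let $(M,g)$ be a 6-dimensional rigid $h$-space of nonconstant curvature. Suppose $(M,g)$ admits a nonhomothetic projective Lie algebra $P_r$ of dimension $r$, i.e. an $r$-dimensional Lie algebra of infinitesimal projective transformations of $(M,g)$ that contains at least one element which is not an infinitesimal homothety. Then $P_r$ contains a subalgebra $H_{r-1}$ of dimension $r-1$ consisting of infinitesimal homotheties.
   Context: $(M,g)$ is a connected smooth pseudo-Riemannian manifold of dimension $n=6$ and signature $[++----]$ (two plus signs, four minus signs); a comma denotes covariant differentiation with respect to the Levi-Civita connection of $g$. Eisenhart equation: for a symmetric $(0,2)$-tensor field $h$ and a function $\varphi$, $$h_{ij,k}=2g_{ij}\varphi_{,k}+g_{ik}\varphi_{,j}+g_{jk}\varphi_{,i}.$$ Infinitesimal projective transformation: a smooth vector field $X$ on $M$ whose local flow preserves unparametrized geodesics; equivalently, $L_Xg$ satisfies the Eisenhart equation with $\varphi=\frac{1}{n+1}\operatorname{div}X$. Infinitesimal homothety: a vector field $X$ with $L_Xg=cg$ for a constant $c$. $h$-space: a pseudo-Riemannian manifold $(M,g)$ together with a solution $h$ of the Eisenhart equation (for some function $\varphi$) with $h\neq cg$ for every constant $c$. Its type is the Segre characteristic of the $\lambda$-matrix $(h-\lambda g)$, i.e. the list of sizes of the Jordan blocks of the endomorphism $g^{-1}h$, assumed the same at all points of $M$. Rigid $h$-space: an $h$-space for which the bases of the elementary divisors (prime divisors) of $(h-\lambda g)$ are pairwise distinct at every point, i.e. distinct Jordan blocks of $g^{-1}h$ have distinct eigenvalues. In the present dimension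 and signature these are the $h$-spaces of types $[111111]$, $[21111]$, $[2211]$, $[3111]$, $[321]$, $[33]$, $[411]$, $[51]$. Constant curvature means $R^i_{\ jkl}=K(\delta^i_k g_{jl}-\delta^i_l g_{jk})$ on $M$ for some constant $K$ ($K=0$ allowed); nonconstant curvature means that this fails for every constant $K$. *)

theory Defs
  imports
    "HOL-Analysis.Analysis"
    "HOL-Library.Function_Algebras"
    "Jordan_Normal_Form.Jordan_Normal_Form"
begin

no_notation Matrix.vec_index (infixl \<open>$\<close> 100)

definition pd :: "'n::finite \<Rightarrow> (real^'n \<Rightarrow> 'b::real_normed_vector) \<Rightarrow> real^'n \<Rightarrow> 'b" where
  "pd i f x = frechet_derivative f (at x) (axis i 1)"

text \<open>Only meaningful for open \<^term>\<open>S\<close>.\<close>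

fun Ck_on :: "nat \<Rightarrow> (real^'n::finite) set \<Rightarrow> (real^'n \<Rightarrow> 'b::real_normed_vector) \<Rightarrow> bool" where
  "Ck_on 0 S f \<longleftrightarrow> continuous_on S f"
| "Ck_on (Suc k) S f \<longleftrightarrow> (\<forall>x\<in>S. f differentiable (at x)) \<and> (\<forall>i. Ck_on k S (pd i f))"

definition smooth_on :: "(real^'n::finite) set \<Rightarrow> (real^'n \<Rightarrow> 'b::real_normed_vector) \<Rightarrow> bool" where
  "smooth_on S f \<longleftrightarrow> (\<forall>k. Ck_on k S f)"

text \<open>A manifold is a whole type \<^typ>\<open>'a\<close> (Hausdorff and second countable by its type classes)
  together with a smooth atlas. A chart is a pair of a domain and a coordinate map; the values of the
  coordinate map off the domain are irrelevant.\<close>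

type_synonym ('a, 'n) chart = "'a set \<times> ('a \<Rightarrow> real^'n)"

definition cdom :: "('a, 'n::finite) chart \<Rightarrow> 'a set" where "cdom c = fst c"
definition cmap :: "('a, 'n::finite) chart \<Rightarrow> 'a \<Rightarrow> real^'n" where "cmap c = snd c"
definition cimg :: "('a, 'n::finite) chart \<Rightarrow> (real^'n) set" where "cimg c = cmap c ` cdom c"
definition cinv :: "('a, 'n::finite) chart \<Rightarrow> real^'n \<Rightarrow> 'a" where "cinv c = inv_into (cdom c) (cmap c)"

definition transition :: "('a, 'n::finite) chart \<Rightarrow> ('a, 'n) chart \<Rightarrow> real^'n \<Rightarrow> real^'n" where
  "transition c d = cmap d \<circ> cinv c"

definition smooth_atlas :: "('a::{t2_space, second_countable_topology}, 'n::finite) chart set \<Rightarrow> bool" where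
  "smooth_atlas C \<longleftrightarrow>
     (\<forall>c\<in>C. open (cdom c) \<and> open (cimg c) \<and> homeomorphism (cdom c) (cimg c) (cmap c) (cinv c)) \<and>
     (\<Union>c\<in>C. cdom c) = UNIV \<and>
     (\<forall>c\<in>C. \<forall>d\<in>C. smooth_on (cmap c ` (cdom c \<inter> cdom d)) (transition c d))"

text \<open>The Jacobian matrix \<open>\<partial>y\<^sup>a/\<partial>x\<^sup>i\<close> (row \<open>a\<close>, column \<open>i\<close>) of the change from
  the coordinates \<open>x\<close> of \<open>c\<close> to the coordinates \<open>y\<close> of \<open>d\<close>.\<close>

definition jacobian :: "('a, 'n::finite) chart \<Rightarrow> ('a, 'n) chart \<Rightarrow> real^'n \<Rightarrow> real^'n^'n" where
  "jacobian c d x = matrix (frechet_derivative (transition c d) (at x))"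

text \<open>A field is the family of its coordinate expressions: to a chart \<open>c\<close> and a coordinate
  vector \<open>x\<close> in \<^term>\<open>cimg c\<close> it assigns the components at the point with coordinates \<open>x\<close>,
  subject to the usual transformation law.\<close>

type_synonym ('a, 'n) scalars = "('a, 'n) chart \<Rightarrow> real^'n \<Rightarrow> real"
type_synonym ('a, 'n) vectors = "('a, 'n) chart \<Rightarrow> real^'n \<Rightarrow> real^'n"
type_synonym ('a, 'n) bilinears = "('a, 'n) chart \<Rightarrow> real^'n \<Rightarrow> real^'n^'n"

definition scalar_field :: "('a, 'n::finite) chart set \<Rightarrow> ('a, 'n) scalars \<Rightarrow> bool" where
  "scalar_field C \<phi> \<longleftrightarrow>
     (\<forall>c\<in>C. smooth_on (cimg c) (\<phi> c)) \<and>
     (\<forall>c\<in>C. \<forall>d\<in>C. \<forall>p\<in>cdom c \<inter> cdom d. \<phi> d (cmap d p) = \<phi> c (cmap c p))"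

text \<open>The last clause makes the representation of a vector field unique, so that linear
  independence of fields is linear independence of their representations.\<close>

definition vector_field :: "('a, 'n::finite) chart set \<Rightarrow> ('a, 'n) vectors \<Rightarrow> bool" where
  "vector_field C X \<longleftrightarrow>
     (\<forall>c\<in>C. smooth_on (cimg c) (X c)) \<and>
     (\<forall>c\<in>C. \<forall>d\<in>C. \<forall>p\<in>cdom c \<inter> cdom d.
        X d (cmap d p) = jacobian c d (cmap c p) *v X c (cmap c p)) \<and>
     (\<forall>c x. c \<notin> C \<or> x \<notin> cimg c \<longrightarrow> X c x = 0)"

definition symmetric_tensor_field :: "('a, 'n::finite) chart set \<Rightarrow> ('a, 'n) bilinears \<Rightarrow> bool" where
  "symmetric_tensor_field C h \<longleftrightarrow>
     (\<forall>c\<in>C. smooth_on (cimg c) (h c)) \<and>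
     (\<forall>c\<in>C. \<forall>x\<in>cimg c. transpose (h c x) = h c x) \<and>
     (\<forall>c\<in>C. \<forall>d\<in>C. \<forall>p\<in>cdom c \<inter> cdom d.
        h c (cmap c p) =
          transpose (jacobian c d (cmap c p)) ** h d (cmap d p) ** jacobian c d (cmap c p))"

definition has_signature :: "real^'n^'n::finite \<Rightarrow> nat \<Rightarrow> nat \<Rightarrow> bool" where
  "has_signature A p q \<longleftrightarrow>
     (\<exists>(P :: real^'n^'n) \<epsilon>. invertible P \<and> transpose P ** A ** P = (\<chi> i j. if i = j then \<epsilon> i else 0) \<and>
        range \<epsilon> \<subseteq> {1, -1} \<and> card {i. \<epsilon> i = 1} = p \<and> card {i. \<epsilon> i = -1} = q)"

definition pseudo_riemannian :: "('a, 'n::finite) chart set \<Rightarrow> nat \<Rightarrow> nat \<Rightarrow> ('a, 'n) bilinears \<Rightarrow> bool" where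
  "pseudo_riemannian C p q g \<longleftrightarrow>
     symmetric_tensor_field C g \<and> (\<forall>c\<in>C. \<forall>x\<in>cimg c. has_signature (g c x) p q)"

text \<open>From here to \<open>bracket\<close>, the arguments \<open>G\<close> (the metric), \<open>H\<close>, \<open>V\<close>, \<open>W\<close>
  are components in one fixed chart.
  \<open>christoffel G x k i j\<close> is \<open>\<Gamma>\<^sup>k\<^sub>i\<^sub>j\<close>.\<close>

definition christoffel :: "(real^'n \<Rightarrow> real^'n^'n) \<Rightarrow> real^'n \<Rightarrow> 'n::finite \<Rightarrow> 'n \<Rightarrow> 'n \<Rightarrow> real" where
  "christoffel G x k i j =
     (\<Sum>l\<in>UNIV. matrix_inv (G x) $ k $ l *
        (pd i (\<lambda>y. G y $ j $ l) x + pd j (\<lambda>y. G y $ i $ l) x - pd l (\<lambda>y. G y $ i $ j) x)) / 2"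

text \<open>\<open>cov_deriv G H x i j k\<close> is \<open>H\<^sub>i\<^sub>j\<^sub>,\<^sub>k\<close>: the last index is the direction of differentiation.\<close>

definition cov_deriv ::
    "(real^'n \<Rightarrow> real^'n^'n) \<Rightarrow> (real^'n \<Rightarrow> real^'n^'n) \<Rightarrow> real^'n \<Rightarrow> 'n::finite \<Rightarrow> 'n \<Rightarrow> 'n \<Rightarrow> real" where
  "cov_deriv G H x i j k =
     pd k (\<lambda>y. H y $ i $ j) x
     - (\<Sum>l\<in>UNIV. christoffel G x l i k * H x $ l $ j)
     - (\<Sum>l\<in>UNIV. christoffel G x l j k * H x $ i $ l)"

text \<open>\<open>R\<^sup>i\<^sub>j\<^sub>k\<^sub>l\<close>, the \<open>i\<close>-th component of \<open>R(\<partial>\<^sub>k, \<partial>\<^sub>l)\<partial>\<^sub>j\<close>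
  with \<open>R(X, Y) = [\<nabla>\<^sub>X, \<nabla>\<^sub>Y] - \<nabla>\<^bsub>[X, Y]\<^esub>\<close>.\<close>

definition riemann ::
    "(real^'n \<Rightarrow> real^'n^'n) \<Rightarrow> real^'n \<Rightarrow> 'n::finite \<Rightarrow> 'n \<Rightarrow> 'n \<Rightarrow> 'n \<Rightarrow> real" where
  "riemann G x i j k l =
     pd k (\<lambda>y. christoffel G y i l j) x - pd l (\<lambda>y. christoffel G y i k j) x
     + (\<Sum>m\<in>UNIV. christoffel G x i k m * christoffel G x m l j
                 - christoffel G x i l m * christoffel G x m k j)"

definition lie_deriv ::
    "(real^'n \<Rightarrow> real^'n) \<Rightarrow> (real^'n \<Rightarrow> real^'n^'n) \<Rightarrow> real^'n \<Rightarrow> real^'n^'n::finite" where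
  "lie_deriv V H x =
     (\<chi> i j. \<Sum>k\<in>UNIV. V x $ k * pd k (\<lambda>y. H y $ i $ j) x
        + H x $ k $ j * pd i (\<lambda>y. V y $ k) x + H x $ i $ k * pd j (\<lambda>y. V y $ k) x)"

definition divergence :: "(real^'n \<Rightarrow> real^'n^'n) \<Rightarrow> (real^'n \<Rightarrow> real^'n) \<Rightarrow> real^'n::finite \<Rightarrow> real" where
  "divergence G V x =
     (\<Sum>i\<in>UNIV. pd i (\<lambda>y. V y $ i) x + (\<Sum>k\<in>UNIV. christoffel G x i i k * V x $ k))"

definition bracket :: "(real^'n \<Rightarrow> real^'n) \<Rightarrow> (real^'n \<Rightarrow> real^'n) \<Rightarrow> real^'n \<Rightarrow> real^'n::finite" where
  "bracket V W x =
     (\<chi> i. \<Sum>k\<in>UNIV. V x $ k * pd k (\<lambda>y. W y $ i) x - W x $ k * pd k (\<lambda>y. V y $ i) x)"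

definition constant_curvature :: "('a, 'n::finite) chart set \<Rightarrow> ('a, 'n) bilinears \<Rightarrow> bool" where
  "constant_curvature C g \<longleftrightarrow>
     (\<exists>K. \<forall>c\<in>C. \<forall>x\<in>cimg c. \<forall>i j k l.
        riemann (g c) x i j k l =
          K * ((if i = k then 1 else 0) * g c x $ j $ l - (if i = l then 1 else 0) * g c x $ j $ k))"

definition eisenhart ::
    "('a, 'n::finite) chart set \<Rightarrow> ('a, 'n) bilinears \<Rightarrow> ('a, 'n) bilinears \<Rightarrow> ('a, 'n) scalars \<Rightarrow> bool" where
  "eisenhart C g h \<phi> \<longleftrightarrow>
     (\<forall>c\<in>C. \<forall>x\<in>cimg c. \<forall>i j k.
        cov_deriv (g c) (h c) x i j k =
          2 * g c x $ i $ j * pd k (\<phi> c) x + g c x $ i $ k * pd j (\<phi> c) x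
          + g c x $ j $ k * pd i (\<phi> c) x)"

text \<open>The matrix over the complex numbers, its rows and columns enumerated by \<open>0, \<dots>, n - 1\<close>,
  in some order, since \<^const>\<open>jordan_nf\<close> lives on matrices indexed by natural numbers.
  Reordering is a similarity, so the Jordan blocks do not depend on the enumeration.\<close>

definition complex_mat :: "real^'n^'n::finite \<Rightarrow> complex mat" where
  "complex_mat A = Matrix.mat CARD('n) CARD('n)
     (\<lambda>(i, j). complex_of_real (A $ from_nat_into UNIV i $ from_nat_into UNIV j))"

text \<open>Since \<open>G\<close> is nondegenerate, the elementary divisors of the pencil \<open>H - \<lambda>G\<close> over the complex
  numbers are the \<open>(\<lambda> - a)\<^sup>k\<close>, one for each Jordan block of size \<open>k\<close> and eigenvalue \<open>a\<close> of
  \<open>G\<^sup>-\<^sup>1H\<close>. Complex conjugate pairs of eigenvalues are allowed.\<close>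

definition segre :: "real^'n^'n::finite \<Rightarrow> nat multiset \<Rightarrow> bool" where
  "segre A S \<longleftrightarrow> (\<exists>n_as. jordan_nf (complex_mat A) n_as \<and> mset (map fst n_as) = S)"

definition distinct_bases :: "real^'n^'n::finite \<Rightarrow> bool" where
  "distinct_bases A \<longleftrightarrow> (\<exists>n_as. jordan_nf (complex_mat A) n_as \<and> distinct (map snd n_as))"

definition h_space ::
    "('a, 'n::finite) chart set \<Rightarrow> ('a, 'n) bilinears \<Rightarrow> ('a, 'n) bilinears \<Rightarrow> bool" where
  "h_space C g h \<longleftrightarrow>
     symmetric_tensor_field C h \<and>
     (\<exists>\<phi>. scalar_field C \<phi> \<and> eisenhart C g h \<phi>) \<and>
     (\<forall>a. \<exists>c\<in>C. \<exists>x\<in>cimg c. h c x \<noteq> a *\<^sub>R g c x) \<and>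
     (\<exists>S. \<forall>c\<in>C. \<forall>x\<in>cimg c. segre (matrix_inv (g c x) ** h c x) S)"

definition rigid_h_space ::
    "('a, 'n::finite) chart set \<Rightarrow> ('a, 'n) bilinears \<Rightarrow> ('a, 'n) bilinears \<Rightarrow> bool" where
  "rigid_h_space C g h \<longleftrightarrow>
     h_space C g h \<and> (\<forall>c\<in>C. \<forall>x\<in>cimg c. distinct_bases (matrix_inv (g c x) ** h c x))"

instantiation "fun" :: (type, real_vector) real_vector
begin

definition scaleR_fun :: "real \<Rightarrow> ('a \<Rightarrow> 'b) \<Rightarrow> 'a \<Rightarrow> 'b" where
  "scaleR_fun r f = (\<lambda>x. r *\<^sub>R f x)"

instance
  by standard (auto simp: scaleR_fun_def fun_eq_iff algebra_simps)

end

definition has_dim :: "'v::real_vector set \<Rightarrow> nat \<Rightarrow> bool" where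
  "has_dim V r \<longleftrightarrow> (\<exists>B. finite B \<and> independent B \<and> span B = V \<and> card B = r)"

definition lie_algebra :: "('a, 'n::finite) chart set \<Rightarrow> ('a, 'n) vectors set \<Rightarrow> bool" where
  "lie_algebra C P \<longleftrightarrow>
     subspace P \<and> (\<forall>X\<in>P. vector_field C X) \<and>
     (\<forall>X\<in>P. \<forall>Y\<in>P. (\<lambda>c. bracket (X c) (Y c)) \<in> P)"

text \<open>Infinitesimal projective transformations, given by the Eisenhart equation for \<open>L\<^sub>Xg\<close>; taking its
  trace shows that the potential can only be \<open>div X / (n + 1)\<close> up to a constant.\<close>

definition inf_projective ::
    "('a, 'n::finite) chart set \<Rightarrow> ('a, 'n) bilinears \<Rightarrow> ('a, 'n) vectors \<Rightarrow> bool" where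
  "inf_projective C g X \<longleftrightarrow>
     vector_field C X \<and>
     eisenhart C g (\<lambda>c. lie_deriv (X c) (g c))
       (\<lambda>c x. divergence (g c) (X c) x / (real CARD('n) + 1))"

definition inf_homothety ::
    "('a, 'n::finite) chart set \<Rightarrow> ('a, 'n) bilinears \<Rightarrow> ('a, 'n) vectors \<Rightarrow> bool" where
  "inf_homothety C g X \<longleftrightarrow>
     vector_field C X \<and> (\<exists>a. \<forall>c\<in>C. \<forall>x\<in>cimg c. lie_deriv (X c) (g c) x = a *\<^sub>R g c x)"

end

theory Submission
  imports Defs "HOL-Computational_Algebra.Field_as_Ring"
begin

text \<open>Let \<open>A = g\<^sup>-\<^sup>1h\<close> and let \<open>\<Lambda>\<close> be the Hessian of the potential of \<open>h\<close>. The Ricci identity turns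
  the Eisenhart equation into \<open>[R(X, Y), A] = [\<Lambda>, X \<and> Y]\<close>, up to sign. If \<open>h' = L\<^sub>Xg\<close> is a second
  solution, with \<open>A'\<close> and \<open>\<Lambda>'\<close>, then computing \<open>g(R(A'X, X)Z, AZ)\<close> in two ways by pair symmetry gives
  \<open>\<Lambda>(X, Z) h'(X, Z) - \<Lambda>'(X, Z) h(X, Z) = g(X, Z) (\<dots>)\<close>, so that for every \<open>X\<close> the vector \<open>\<Lambda>X\<close> or \<open>A'X\<close>
  lies in the span of \<open>X\<close> and \<open>AX\<close>. Rigidity means that \<open>A\<close> has a cyclic vector, and so at each point
  either \<open>\<Lambda>\<close> is a combination of \<open>h\<close> and \<open>g\<close>, in which case the curvature at the point is that of a
  space form, or \<open>h'\<close> is a combination of \<open>h\<close> and \<open>g\<close>.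

  The first case cannot hold at every point: the sectional curvature would be locally constant as in
  Schur's lemma, and hence constant. So some ball consists of points of the second case. There the two
  coefficients are constant, because a combination of \<open>A\<close> and the identity of rank at most two vanishes.
  Hence the coefficient of \<open>h\<close> is a linear functional on \<open>P\<^sub>r\<close>. A field in its kernel is a
  homothety on the ball, and everywhere by unique continuation, since the Eisenhart equation prolongs
  to a closed linear system of first order for \<open>h\<close>, \<open>d\<phi>\<close> and \<open>\<Delta>\<phi>\<close>.\<close>

subsection \<open>Smooth functions and directional derivatives\<close>

text \<open>The metric is indefinite and \<open>A\<close> may have nilpotent or complex blocks, so
  there is no real eigenbasis to compute in. A cyclic vector replaces it: rigidity says exactly that
  \<open>A\<close> is nonderogatory, so the Krylov vectors of a suitable real \<open>e\<close> form
  a basis whatever the Segre type, and one argument serves all types. The alternative at a point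
  comes from a product of two linear forms: if such a product vanishes on a vector space, then one
  factor does.

  The two cases may occur at different points. Constant type is a closed condition, so its failure
  spreads to a neighbourhood, and a neighbourhood is enough because a homothety is continued along
  segments by a linear ODE. The usual proof of Schur's lemma differentiates the curvature; here the
  Hessian equation \<open>\<nabla>p = m G - k H\<close> is differentiated instead. The same equation
  compares \<open>k\<close> in two charts, which replaces a proof that the curvature is a tensor.

  Computations use arbitrary direction vectors; index formulas are translated in one separate
  part.\<close>

definition dd :: "'a::real_normed_vector \<Rightarrow> ('a \<Rightarrow> 'b::real_normed_vector) \<Rightarrow> 'a \<Rightarrow> 'b" where
  "dd v f x = frechet_derivative f (at x) v"

lemma pd_eq_dd: "pd i = dd (axis i 1)"
  by (auto simp: fun_eq_iff pd_def dd_def)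

lemma dd_eqI: "(f has_derivative D) (at x) \<Longrightarrow> dd v f x = D v"
  by (simp add: dd_def frechet_derivative_at[symmetric])

lemma has_derivative_dd: "f differentiable (at x) \<Longrightarrow> (f has_derivative (\<lambda>v. dd v f x)) (at x)"
  by (simp add: dd_def frechet_derivative_works)

lemma linear_dd: "f differentiable (at x) \<Longrightarrow> linear (\<lambda>v. dd v f x)"
  using has_derivative_dd has_derivative_linear by blast

lemma dd_direction_simps:
  "f differentiable (at x) \<Longrightarrow> dd (v + w) f x = dd v f x + dd w f x"
  "f differentiable (at x) \<Longrightarrow> dd (c *\<^sub>R v) f x = c *\<^sub>R dd v f x"
  by (simp_all add: linear_add[OF linear_dd] linear_cmul[OF linear_dd])

lemma DERIV_along_line:
  fixes f :: "'a::real_normed_vector \<Rightarrow> real"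
  assumes "f differentiable (at (x + t *\<^sub>R d))"
  shows "((\<lambda>t. f (x + t *\<^sub>R d)) has_real_derivative dd d f (x + t *\<^sub>R d)) (at t)"
proof -
  have 1: "((\<lambda>t. x + t *\<^sub>R d) has_derivative (\<lambda>r. r *\<^sub>R d)) (at t)"
    by (auto intro!: derivative_eq_intros)
  have "((\<lambda>t. f (x + t *\<^sub>R d)) has_derivative (\<lambda>r. dd (r *\<^sub>R d) f (x + t *\<^sub>R d))) (at t)"
    using has_derivative_compose[OF 1 has_derivative_dd[OF assms]] by (simp add: o_def)
  moreover have "dd (r *\<^sub>R d) f (x + t *\<^sub>R d) = r * dd d f (x + t *\<^sub>R d)" for r
    using dd_direction_simps(2)[OF assms, of r d] by simp
  ultimately show ?thesis by (simp add: has_field_derivative_def mult_commute_abs)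
qed

lemma dd_const [simp]: "dd v (\<lambda>_. c) x = 0"
  by (rule dd_eqI) (auto intro!: derivative_eq_intros)

lemma dd_add: "\<lbrakk>f differentiable (at x); g differentiable (at x)\<rbrakk> \<Longrightarrow> dd v (\<lambda>y. f y + g y) x = dd v f x + dd v g x"
  by (rule dd_eqI) (auto intro!: derivative_eq_intros has_derivative_dd)

lemma dd_diff: "\<lbrakk>f differentiable (at x); g differentiable (at x)\<rbrakk> \<Longrightarrow> dd v (\<lambda>y. f y - g y) x = dd v f x - dd v g x"
  by (rule dd_eqI) (auto intro!: derivative_eq_intros has_derivative_dd)

lemma dd_sum: "(\<And>i. i \<in> I \<Longrightarrow> f i differentiable (at x)) \<Longrightarrow> dd v (\<lambda>y. \<Sum>i\<in>I. f i y) x = (\<Sum>i\<in>I. dd v (f i) x)"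
  by (rule dd_eqI) (auto intro!: derivative_eq_intros has_derivative_dd)

lemma dd_bounded_linear: "\<lbrakk>bounded_linear L; f differentiable (at x)\<rbrakk> \<Longrightarrow> dd v (\<lambda>y. L (f y)) x = L (dd v f x)"
  by (rule dd_eqI) (auto intro: bounded_linear.has_derivative has_derivative_dd)

lemma dd_bounded_bilinear:
  "\<lbrakk>bounded_bilinear B; f differentiable (at x); g differentiable (at x)\<rbrakk>
    \<Longrightarrow> dd v (\<lambda>y. B (f y) (g y)) x = B (f x) (dd v g x) + B (dd v f x) (g x)"
  by (rule dd_eqI) (auto intro: bounded_bilinear.FDERIV has_derivative_dd)

text \<open>\<open>frechet_derivative\<close> is a choice among the derivatives at the point, so it
  suffices that both functions have the same ones, whether or not any exist.\<close>

lemma dd_cong: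
  assumes "open S" "x \<in> S" "\<And>y. y \<in> S \<Longrightarrow> f y = g y"
  shows "dd v f x = dd v g x"
proof -
  have "(f has_derivative D) (at x) \<longleftrightarrow> (g has_derivative D) (at x)" for D
    using has_derivative_transform_within_open[of f D x UNIV S g]
      has_derivative_transform_within_open[of g D x UNIV S f] assms by auto
  then show ?thesis by (simp add: dd_def frechet_derivative_def)
qed

lemma differentiable_cong_open:
  assumes "open S" "x \<in> S" "\<And>y. y \<in> S \<Longrightarrow> f y = g y" "f differentiable (at x)"
  shows "g differentiable (at x)"
  using assms has_derivative_transform_within_open[of f _ x UNIV S g] by (auto simp: differentiable_def)

lemma differentiable_bounded_bilinear:
  "\<lbrakk>bounded_bilinear B; f differentiable (at x); g differentiable (at x)\<rbrakk> \<Longrightarrow> (\<lambda>y. B (f y) (g y)) differentiable (at x)"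
  using bounded_bilinear.FDERIV unfolding differentiable_def by blast

lemma differentiable_bounded_linear:
  "\<lbrakk>bounded_linear L; f differentiable (at x)\<rbrakk> \<Longrightarrow> (\<lambda>y. L (f y)) differentiable (at x)"
  using bounded_linear.has_derivative unfolding differentiable_def by blast

lemma dd_eq_sum_pd:
  fixes f :: "real^'n::finite \<Rightarrow> 'b::real_normed_vector"
  assumes "f differentiable (at x)"
  shows "dd v f x = (\<Sum>i\<in>UNIV. v $ i *\<^sub>R pd i f x)"
proof -
  have "v = (\<Sum>i\<in>UNIV. v $ i *\<^sub>R axis i 1)"
    by (simp add: basis_expansion scalar_mult_eq_scaleR[symmetric])
  then have "dd v f x = dd (\<Sum>i\<in>UNIV. v $ i *\<^sub>R axis i 1) f x" by simp
  also have "\<dots> = (\<Sum>i\<in>UNIV. v $ i *\<^sub>R pd i f x)"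
    by (simp add: linear_sum[OF linear_dd[OF assms]] linear_cmul[OF linear_dd[OF assms]] pd_eq_dd)
  finally show ?thesis .
qed

section \<open>Closure properties of smooth functions\<close>

lemma Ck_on_cong:
  assumes "open S"
  shows "(\<And>x. x \<in> S \<Longrightarrow> f x = g x) \<Longrightarrow> Ck_on k S f \<Longrightarrow> Ck_on k S g"
proof (induction k arbitrary: f g)
  case 0
  then show ?case by (simp cong: continuous_on_cong)
next
  case (Suc k)
  have "Ck_on k S (pd i g)" for i
  proof (rule Suc.IH)
    show "pd i f x = pd i g x" if "x \<in> S" for x
      using dd_cong[OF assms that, of f g] Suc.prems(1) by (auto simp: pd_eq_dd)
    show "Ck_on k S (pd i f)" using Suc.prems by simp
  qed
  moreover have "g differentiable (at x)" if "x \<in> S" for x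
    using differentiable_cong_open[OF assms that] Suc.prems that by auto
  ultimately show ?case by simp
qed

lemma Ck_on_Suc_D: "Ck_on (Suc k) S f \<Longrightarrow> Ck_on k S f"
proof (induction k arbitrary: f)
  case 0
  then show ?case
    by (auto intro!: continuous_at_imp_continuous_on differentiable_imp_continuous_within)
qed auto

lemma Ck_on_const: "Ck_on k S (\<lambda>_. c)"
proof (induction k arbitrary: c)
  case (Suc k)
  have "pd i (\<lambda>_. c) = (\<lambda>_. 0)" for i :: 'a
    by (simp add: fun_eq_iff pd_eq_dd)
  then show ?case using Suc by simp
qed simp

lemma Ck_on_add:
  assumes S: "open S"
  shows "Ck_on k S f \<Longrightarrow> Ck_on k S g \<Longrightarrow> Ck_on k S (\<lambda>x. f x + g x)"
proof (induction k arbitrary: f g)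
  case 0
  then show ?case by (auto intro: continuous_intros)
next
  case (Suc k)
  have "Ck_on k S (pd i (\<lambda>x. f x + g x))" for i
    by (rule Ck_on_cong[OF S _ Suc.IH[of "pd i f" "pd i g"]])
      (use Suc.prems in \<open>auto simp: pd_eq_dd dd_add\<close>)
  then show ?case using Suc.prems by auto
qed

text \<open>One Leibniz induction covers scalar multiples, products, inner products and
  matrix-vector products.\<close>

lemma Ck_on_bounded_bilinear:
  assumes S: "open S" and B: "bounded_bilinear B"
  shows "Ck_on k S f \<Longrightarrow> Ck_on k S g \<Longrightarrow> Ck_on k S (\<lambda>x. B (f x) (g x))"
proof (induction k arbitrary: f g)
  case 0
  then show ?case by (auto intro: bounded_bilinear.continuous_on[OF B])
next
  case (Suc k)
  have "Ck_on k S (pd i (\<lambda>x. B (f x) (g x)))" for i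
  proof (rule Ck_on_cong[OF S _ Ck_on_add[OF S]])
    show "Ck_on k S (\<lambda>x. B (f x) (pd i g x))" "Ck_on k S (\<lambda>x. B (pd i f x) (g x))"
      using Suc.prems by (auto intro!: Suc.IH intro: Ck_on_Suc_D)
  qed (use Suc.prems in \<open>auto simp: pd_eq_dd dd_bounded_bilinear[OF B]\<close>)
  then show ?case using Suc.prems by (auto intro: differentiable_bounded_bilinear[OF B])
qed

lemma smooth_on_cong: "open S \<Longrightarrow> smooth_on S f \<Longrightarrow> (\<And>x. x \<in> S \<Longrightarrow> f x = g x) \<Longrightarrow> smooth_on S g"
  unfolding smooth_on_def using Ck_on_cong by blast

lemma Ck_on_subset: "T \<subseteq> S \<Longrightarrow> Ck_on k S f \<Longrightarrow> Ck_on k T f"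
  by (induction k arbitrary: f) (auto intro: continuous_on_subset)

lemma smooth_on_subset: "smooth_on S f \<Longrightarrow> T \<subseteq> S \<Longrightarrow> smooth_on T f"
  unfolding smooth_on_def using Ck_on_subset by blast

lemma smooth_on_const: "smooth_on S (\<lambda>_. c)"
  by (simp add: smooth_on_def Ck_on_const)

lemma smooth_on_add: "open S \<Longrightarrow> smooth_on S f \<Longrightarrow> smooth_on S g \<Longrightarrow> smooth_on S (\<lambda>x. f x + g x)"
  by (simp add: smooth_on_def Ck_on_add)

lemma smooth_on_bounded_bilinear:
  "bounded_bilinear B \<Longrightarrow> open S \<Longrightarrow> smooth_on S f \<Longrightarrow> smooth_on S g \<Longrightarrow> smooth_on S (\<lambda>x. B (f x) (g x))"
  by (simp add: smooth_on_def Ck_on_bounded_bilinear)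

lemma smooth_on_bounded_linear:
  assumes "bounded_linear L" "open S" "smooth_on S f"
  shows "smooth_on S (\<lambda>x. L (f x))"
proof -
  \<comment> \<open>A linear map is a bilinear one whose scalar factor is frozen at the constant 1,
    so no separate induction is made.\<close>
  have "bounded_bilinear (\<lambda>(c::real) y. c *\<^sub>R L y)"
    using bounded_bilinear.comp[OF bounded_bilinear_scaleR bounded_linear_ident assms(1)] by simp
  from smooth_on_bounded_bilinear[OF this assms(2) smooth_on_const assms(3), of 1] show ?thesis by simp
qed

lemma smooth_on_minus: "open S \<Longrightarrow> smooth_on S f \<Longrightarrow> smooth_on S (\<lambda>x. - f x)"
  by (rule smooth_on_bounded_linear) (auto intro: bounded_linear_minus bounded_linear_ident)

lemma smooth_on_diff: "open S \<Longrightarrow> smooth_on S f \<Longrightarrow> smooth_on S g \<Longrightarrow> smooth_on S (\<lambda>x. f x - g x)"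
  using smooth_on_add[of S f "\<lambda>x. - g x"] smooth_on_minus by auto

lemma smooth_on_sum:
  "open S \<Longrightarrow> (\<And>i. i \<in> I \<Longrightarrow> smooth_on S (f i)) \<Longrightarrow> smooth_on S (\<lambda>x. \<Sum>i\<in>I. f i x)"
  by (induction I rule: infinite_finite_induct) (auto intro: smooth_on_const smooth_on_add)

lemma smooth_on_mult:
  fixes f g :: "real^'n::finite \<Rightarrow> 'b::real_normed_algebra"
  shows "open S \<Longrightarrow> smooth_on S f \<Longrightarrow> smooth_on S g \<Longrightarrow> smooth_on S (\<lambda>x. f x * g x)"
  by (rule smooth_on_bounded_bilinear[OF bounded_bilinear_mult])

lemma smooth_on_prod:
  fixes f :: "'i \<Rightarrow> real^'n::finite \<Rightarrow> real"
  shows "open S \<Longrightarrow> (\<And>i. i \<in> I \<Longrightarrow> smooth_on S (f i)) \<Longrightarrow> smooth_on S (\<lambda>x. \<Prod>i\<in>I. f i x)"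
  by (induction I rule: infinite_finite_induct) (auto intro: smooth_on_const smooth_on_mult)

lemma smooth_on_vec_nth: "open S \<Longrightarrow> smooth_on S f \<Longrightarrow> smooth_on S (\<lambda>x. f x $ i)"
  by (rule smooth_on_bounded_linear[OF bounded_linear_vec_nth])

lemma smooth_on_scaleR: "open S \<Longrightarrow> smooth_on S f \<Longrightarrow> smooth_on S g \<Longrightarrow> smooth_on S (\<lambda>x. f x *\<^sub>R g x)"
  by (rule smooth_on_bounded_bilinear[OF bounded_bilinear_scaleR])

lemma smooth_on_differentiable: "smooth_on S f \<Longrightarrow> x \<in> S \<Longrightarrow> f differentiable (at x)"
  unfolding smooth_on_def using Ck_on.simps(2)[of 0] by blast

lemma smooth_on_imp_continuous_on: "smooth_on S f \<Longrightarrow> continuous_on S f"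
  unfolding smooth_on_def using Ck_on.simps(1) by blast

lemma smooth_on_pd: "smooth_on S f \<Longrightarrow> smooth_on S (pd i f)"
  unfolding smooth_on_def using Ck_on.simps(2) by blast

lemma smooth_on_dd: "open S \<Longrightarrow> smooth_on S f \<Longrightarrow> smooth_on S (dd v f)"
  by (rule smooth_on_cong[where f="\<lambda>x. \<Sum>i\<in>UNIV. v $ i *\<^sub>R pd i f x"])
    (auto simp: dd_eq_sum_pd smooth_on_differentiable
      intro!: smooth_on_sum smooth_on_scaleR smooth_on_const smooth_on_pd)

lemma smooth_on_vecI:
  fixes f :: "real^'n::finite \<Rightarrow> 'b::euclidean_space^'m::finite"
  assumes S: "open S" and "\<And>i. smooth_on S (\<lambda>x. f x $ i)"
  shows "smooth_on S f"
proof (rule smooth_on_cong[OF S smooth_on_sum[OF S]])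
  have B: "bounded_linear (axis i :: 'b \<Rightarrow> 'b^'m)" for i
    unfolding linear_conv_bounded_linear[symmetric] by (rule linearI) (auto simp: Finite_Cartesian_Product.vec_eq_iff axis_def)
  show "smooth_on S (\<lambda>x. axis i (f x $ i))" for i
    by (rule smooth_on_bounded_linear[OF B S assms(2)])
  show "(\<Sum>i\<in>UNIV. axis i (f x $ i)) = f x" for x
  proof -
    have "(\<Sum>i\<in>UNIV. axis i (f x $ i)) $ j = f x $ j" for j
      by (simp only: sum_component) (simp add: axis_def)
    then show ?thesis by (simp add: Finite_Cartesian_Product.vec_eq_iff)
  qed
qed

section \<open>Smoothness of reciprocals and of the inverse matrix\<close>

lemma Ck_on_inverse:
  fixes f :: "real^'n::finite \<Rightarrow> real"
  assumes S: "open S" and nz: "\<And>x. x \<in> S \<Longrightarrow> f x \<noteq> 0"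
  shows "Ck_on k S f \<Longrightarrow> Ck_on k S (\<lambda>x. inverse (f x))"
proof (induction k)
  case 0
  then show ?case using nz by (auto intro: continuous_intros)
next
  case (Suc k)
  have *: "((\<lambda>x. inverse (f x)) has_derivative (\<lambda>v. - (inverse (f x) * dd v f x * inverse (f x)))) (at x)" if "x \<in> S" for x
    by (rule Deriv.has_derivative_inverse) (use Suc.prems nz that in \<open>auto intro: has_derivative_dd\<close>)
  have "Ck_on k S (pd i (\<lambda>x. inverse (f x)))" for i
  proof (rule Ck_on_cong[OF S])
    have 1: "Ck_on k S (\<lambda>x. inverse (f x))" using Suc Ck_on_Suc_D by blast
    have 2: "Ck_on k S (\<lambda>x. (- 1) * inverse (f x))"
      by (intro Ck_on_bounded_bilinear[OF S bounded_bilinear_mult] Ck_on_const 1)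
    show "Ck_on k S (\<lambda>x. (- 1) * inverse (f x) * (pd i f x * inverse (f x)))"
      using Suc.prems by (intro Ck_on_bounded_bilinear[OF S bounded_bilinear_mult] 1 2) auto
    show "(- 1) * inverse (f x) * (pd i f x * inverse (f x)) = pd i (\<lambda>x. inverse (f x)) x" if "x \<in> S" for x
      using dd_eqI[OF *[OF that]] by (simp add: pd_eq_dd)
  qed
  then show ?case using * by (auto simp: differentiable_def)
qed

lemma smooth_on_inverse:
  fixes f :: "real^'n::finite \<Rightarrow> real"
  shows "open S \<Longrightarrow> smooth_on S f \<Longrightarrow> (\<And>x. x \<in> S \<Longrightarrow> f x \<noteq> 0) \<Longrightarrow> smooth_on S (\<lambda>x. inverse (f x))"
  by (simp add: smooth_on_def Ck_on_inverse)

lemma smooth_on_divide: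
  fixes f :: "real^'n::finite \<Rightarrow> real"
  shows "open S \<Longrightarrow> smooth_on S f \<Longrightarrow> smooth_on S g \<Longrightarrow> (\<And>x. x \<in> S \<Longrightarrow> g x \<noteq> 0) \<Longrightarrow> smooth_on S (\<lambda>x. f x / g x)"
  unfolding divide_inverse by (intro smooth_on_mult smooth_on_inverse)

lemma smooth_on_det:
  fixes M :: "real^'n::finite \<Rightarrow> real^'m^'m::finite"
  assumes "open S" "\<And>i j. smooth_on S (\<lambda>x. M x $ i $ j)"
  shows "smooth_on S (\<lambda>x. Determinants.det (M x))"
  unfolding Determinants.det_def using assms by (intro smooth_on_sum smooth_on_mult smooth_on_prod smooth_on_const)

lemma matrix_inv_works:
  fixes A :: "real^'n^'n::finite"
  assumes "Determinants.det A \<noteq> 0"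
  shows "A ** matrix_inv A = Finite_Cartesian_Product.mat 1" "matrix_inv A ** A = Finite_Cartesian_Product.mat 1"
proof -
  have "\<exists>B. A ** B = Finite_Cartesian_Product.mat 1 \<and> B ** A = Finite_Cartesian_Product.mat 1"
    using assms invertible_det_nz[of A] by (simp add: Finite_Cartesian_Product.invertible_def)
  from someI_ex[OF this] show "A ** matrix_inv A = Finite_Cartesian_Product.mat 1" "matrix_inv A ** A = Finite_Cartesian_Product.mat 1"
    unfolding matrix_inv_def by auto
qed

text \<open>Cramer's rule. It exhibits the entries of the inverse as quotients of polynomials in the
  entries of the matrix, which gives their smoothness.\<close>

lemma matrix_inv_component:
  fixes A :: "real^'n^'n::finite"
  assumes "Determinants.det A \<noteq> 0"
  shows "matrix_inv A $ i $ j = Determinants.det (\<chi> a b. if b = i then axis j 1 $ a else A $ a $ b) / Determinants.det A"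
proof -
  have "A *v (matrix_inv A *v axis j 1) = axis j 1"
    by (simp add: matrix_vector_mul_assoc matrix_inv_works[OF assms])
  then have "matrix_inv A *v axis j 1 = (\<chi> k. Determinants.det (\<chi> a b. if b = k then axis j 1 $ a else A $ a $ b) / Determinants.det A)"
    using cramer[OF assms] by simp
  then have "(matrix_inv A *v axis j 1) $ i = Determinants.det (\<chi> a b. if b = i then axis j 1 $ a else A $ a $ b) / Determinants.det A"
    by simp
  then show ?thesis by (simp add: matrix_vector_mult_basis column_def)
qed

lemma smooth_on_matrix_inv:
  fixes M :: "real^'n::finite \<Rightarrow> real^'m^'m::finite"
  assumes S: "open S" and M: "smooth_on S M" and "\<And>x. x \<in> S \<Longrightarrow> Determinants.det (M x) \<noteq> 0"
  shows "smooth_on S (\<lambda>x. matrix_inv (M x))"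
proof (intro smooth_on_vecI S)
  have *: "smooth_on S (\<lambda>x. M x $ i $ j)" for i j
    using S M by (intro smooth_on_vec_nth)
  show "smooth_on S (\<lambda>x. matrix_inv (M x) $ i $ j)" for i j
  proof (rule smooth_on_cong[OF S])
    show "smooth_on S (\<lambda>x. Determinants.det (\<chi> a b. if b = i then axis j 1 $ a else M x $ a $ b) / Determinants.det (M x))"
    proof (intro smooth_on_divide smooth_on_det S)
      show "smooth_on S (\<lambda>x. (\<chi> a b. if b = i then axis j 1 $ a else M x $ a $ b) $ k $ l)" for k l
        by (cases "l = i") (simp_all add: smooth_on_const *)
    qed (use assms * in auto)
  qed (use assms in \<open>simp add: matrix_inv_component\<close>)
qed

text \<open>The second difference of \<open>f\<close> along \<open>v\<close> and \<open>w\<close> is, by the mean value theorem, a value of either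
  mixed derivative.\<close>

lemma dd_dd_commute_real:
  fixes f :: "real^'n::finite \<Rightarrow> real"
  assumes S: "open S" "x \<in> S" and f: "smooth_on S f"
  shows "dd v (dd w f) x = dd w (dd v f) x"
proof -
  have key: "\<exists>p q. norm (p - x) \<le> h * (norm v + norm w) \<and> norm (q - x) \<le> h * (norm v + norm w)
      \<and> dd w (dd v f) p = dd v (dd w f) q"
    if h: "h > 0" "\<And>y. norm (y - x) \<le> h * (norm v + norm w) \<Longrightarrow> y \<in> S" for h
  proof -
    have diff: "\<exists>p. norm (p - x) \<le> h * (norm v + norm w) \<and>
       f (x + h *\<^sub>R v + h *\<^sub>R w) - f (x + h *\<^sub>R v) - f (x + h *\<^sub>R w) + f x = h * h * dd w (dd v f) p"
      if hS: "\<And>y. norm (y - x) \<le> h * (norm v + norm w) \<Longrightarrow> y \<in> S" for v w :: "real^'n"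
    proof -
      have inS: "norm ((x + s *\<^sub>R v + t *\<^sub>R w) - x) \<le> h * (norm v + norm w)" if "0 \<le> s" "s \<le> h" "0 \<le> t" "t \<le> h" for s t
      proof -
        have "norm ((x + s *\<^sub>R v + t *\<^sub>R w) - x) \<le> norm (s *\<^sub>R v) + norm (t *\<^sub>R w)"
          by (metis add.assoc add_diff_cancel_left' norm_triangle_ineq)
        also have "\<dots> \<le> h * norm v + h * norm w"
          using that by (intro add_mono) (auto intro: mult_right_mono)
        finally show ?thesis by (simp add: algebra_simps)
      qed
      note D = DERIV_along_line[OF smooth_on_differentiable]
      have v_sm: "smooth_on S (dd v f)" using f S by (intro smooth_on_dd)
      have "\<exists>s. 0 < s \<and> s < h \<and> (f ((x + h *\<^sub>R w) + h *\<^sub>R v) - f (x + h *\<^sub>R v)) - (f ((x + h *\<^sub>R w) + 0 *\<^sub>R v) - f (x + 0 *\<^sub>R v))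
          = (h - 0) * (dd v f ((x + h *\<^sub>R w) + s *\<^sub>R v) - dd v f (x + s *\<^sub>R v))"
      proof (rule MVT2[OF h(1)])
        fix s assume s: "0 \<le> s" "s \<le> h"
        have "(x + h *\<^sub>R w) + s *\<^sub>R v \<in> S" "x + s *\<^sub>R v \<in> S"
          using hS[OF inS[of s h]] hS[OF inS[of s 0]] s h by (auto simp: algebra_simps)
        then show "((\<lambda>s. f ((x + h *\<^sub>R w) + s *\<^sub>R v) - f (x + s *\<^sub>R v)) has_real_derivative
           (dd v f ((x + h *\<^sub>R w) + s *\<^sub>R v) - dd v f (x + s *\<^sub>R v))) (at s)"
          by (intro DERIV_diff D[OF f])
      qed
      then obtain s where s: "0 < s" "s < h" and
        e1: "(f ((x + h *\<^sub>R w) + h *\<^sub>R v) - f (x + h *\<^sub>R v)) - (f (x + h *\<^sub>R w) - f x)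
          = h * (dd v f ((x + h *\<^sub>R w) + s *\<^sub>R v) - dd v f (x + s *\<^sub>R v))" by auto
      have "\<exists>t. 0 < t \<and> t < h \<and> dd v f ((x + s *\<^sub>R v) + h *\<^sub>R w) - dd v f ((x + s *\<^sub>R v) + 0 *\<^sub>R w)
          = (h - 0) * dd w (dd v f) ((x + s *\<^sub>R v) + t *\<^sub>R w)"
      proof (rule MVT2[OF h(1)])
        fix t assume t: "0 \<le> t" "t \<le> h"
        show "((\<lambda>t. dd v f ((x + s *\<^sub>R v) + t *\<^sub>R w)) has_real_derivative dd w (dd v f) ((x + s *\<^sub>R v) + t *\<^sub>R w)) (at t)"
          using hS[OF inS[of s t]] s t by (intro D[OF v_sm]) auto
      qed
      then obtain t where t: "0 < t" "t < h" and
        e2: "dd v f ((x + s *\<^sub>R v) + h *\<^sub>R w) - dd v f (x + s *\<^sub>R v) = h * dd w (dd v f) ((x + s *\<^sub>R v) + t *\<^sub>R w)" by auto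
      show ?thesis
      proof (intro exI conjI)
        show "norm (((x + s *\<^sub>R v) + t *\<^sub>R w) - x) \<le> h * (norm v + norm w)" using inS s t by auto
        show "f (x + h *\<^sub>R v + h *\<^sub>R w) - f (x + h *\<^sub>R v) - f (x + h *\<^sub>R w) + f x = h * h * dd w (dd v f) ((x + s *\<^sub>R v) + t *\<^sub>R w)"
          using e1 e2 by (simp add: algebra_simps)
      qed
    qed
    obtain p where p: "norm (p - x) \<le> h * (norm v + norm w)"
      "f (x + h *\<^sub>R v + h *\<^sub>R w) - f (x + h *\<^sub>R v) - f (x + h *\<^sub>R w) + f x = h * h * dd w (dd v f) p"
      using diff[of v w] h(2) by blast
    obtain q where q: "norm (q - x) \<le> h * (norm v + norm w)"
      "f (x + h *\<^sub>R w + h *\<^sub>R v) - f (x + h *\<^sub>R w) - f (x + h *\<^sub>R v) + f x = h * h * dd v (dd w f) q"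
      using diff[of w v] h(2) by (auto simp: add.commute)
    have "h * h * dd w (dd v f) p = h * h * dd v (dd w f) q"
      using p(2) q(2) by (simp add: algebra_simps)
    then show ?thesis using h p q by auto
  qed
  obtain r where r: "r > 0" "ball x r \<subseteq> S" using S open_contains_ball by blast
  have cont: "continuous (at x) (dd w (dd v f))" "continuous (at x) (dd v (dd w f))"
    using f S by (auto intro!: continuous_on_interior[of S] smooth_on_imp_continuous_on smooth_on_dd simp: interior_open)
  show ?thesis
  proof (rule ccontr)
    assume ne: "\<not> ?thesis"
    \<comment> \<open>Half the gap between the two values at \<open>x\<close>: numbers within
      \<open>e\<close> of one and of the other cannot be equal.\<close>
    define e where "e = \<bar>dd v (dd w f) x - dd w (dd v f) x\<bar> / 2"
    have "e > 0" using ne by (simp add: e_def)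
    obtain d1 where d1: "d1 > 0" "\<And>y. dist y x < d1 \<Longrightarrow> dist (dd w (dd v f) y) (dd w (dd v f) x) < e"
      using cont(1) \<open>e > 0\<close> unfolding continuous_at_eps_delta by blast
    obtain d2 where d2: "d2 > 0" "\<And>y. dist y x < d2 \<Longrightarrow> dist (dd v (dd w f) y) (dd v (dd w f) x) < e"
      using cont(2) \<open>e > 0\<close> unfolding continuous_at_eps_delta by blast
    define d where "d = min r (min d1 d2)"
    \<comment> \<open>The step is so small that the parallelogram stays within distance
      \<open>d\<close> of \<open>x\<close>. The summand 1 keeps the denominator positive when
      \<open>v\<close> and \<open>w\<close> both vanish.\<close>
    define h where "h = d / (norm v + norm w + 1)"
    have dpos: "d > 0" using d1 d2 r by (simp add: d_def)
    have N: "norm v + norm w + 1 > 0" by (simp add: add_nonneg_pos)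
    have hpos: "h > 0" using dpos N by (simp add: h_def)
    have hN: "h * (norm v + norm w) < d"
    proof -
      have "h * (norm v + norm w) < h * (norm v + norm w + 1)" using hpos by simp
      also have "\<dots> = d" using N by (simp add: h_def)
      finally show ?thesis .
    qed
    have "y \<in> S" if "norm (y - x) \<le> h * (norm v + norm w)" for y
    proof -
      have "dist x y < r" using that hN by (simp add: d_def dist_norm norm_minus_commute)
      then show ?thesis using r by auto
    qed
    from key[OF hpos this] obtain p q where pq: "norm (p - x) \<le> h * (norm v + norm w)"
      "norm (q - x) \<le> h * (norm v + norm w)" "dd w (dd v f) p = dd v (dd w f) q" by blast
    have "dist (dd w (dd v f) p) (dd w (dd v f) x) < e" "dist (dd v (dd w f) q) (dd v (dd w f) x) < e"
      by (intro d1 d2; use pq hN in \<open>simp add: d_def dist_norm\<close>)+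
    then show False using pq(3) by (simp add: e_def dist_real_def abs_if split: if_splits)
  qed
qed

lemma dd_dd_commute:
  fixes f :: "real^'n::finite \<Rightarrow> 'b::euclidean_space"
  assumes S: "open S" "x \<in> S" and f: "smooth_on S f"
  shows "dd v (dd w f) x = dd w (dd v f) x"
proof (rule euclidean_eqI)
  fix b :: 'b
  have L: "bounded_linear (\<lambda>z. z \<bullet> b)" by (rule bounded_linear_inner_left)
  have *: "dd v (dd w f) x \<bullet> b = dd v (dd w (\<lambda>y. f y \<bullet> b)) x" for v w
  proof -
    have "dd v (dd w f) x \<bullet> b = dd v (\<lambda>y. dd w f y \<bullet> b) x"
      using assms by (intro dd_bounded_linear[OF L, symmetric] smooth_on_differentiable[OF smooth_on_dd])
    also have "\<dots> = dd v (dd w (\<lambda>y. f y \<bullet> b)) x"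
      using f by (intro dd_cong[OF S] dd_bounded_linear[OF L, symmetric]) (rule smooth_on_differentiable)
    finally show ?thesis .
  qed
  show "dd v (dd w f) x \<bullet> b = dd w (dd v f) x \<bullet> b"
    unfolding * using smooth_on_bounded_linear[OF L S(1) f] by (rule dd_dd_commute_real[OF S])
qed

subsection \<open>Cyclic vectors\<close>

text \<open>Independence is required of the family indexed by exponents, not of the set of Krylov
  vectors, so that a repetition among them counts as a dependence.\<close>

definition cyclic_vector :: "('v::euclidean_space \<Rightarrow> 'v) \<Rightarrow> 'v \<Rightarrow> bool" where
  "cyclic_vector A e \<longleftrightarrow> (\<forall>c. (\<Sum>i<DIM('v). c i *\<^sub>R (A ^^ i) e) = 0 \<longrightarrow> (\<forall>i<DIM('v). c i = 0))"

lemma linear_funpow: "linear A \<Longrightarrow> linear (A ^^ i)" for A :: "'v::real_vector \<Rightarrow> 'v"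
proof (induction i)
  case 0 show ?case by (auto intro: linearI)
next
  case (Suc i) then show ?case using linear_compose[of "A ^^ i" A] by (simp add: o_def)
qed

lemma cyclic_vector_expansion:
  fixes A :: "'v::euclidean_space \<Rightarrow> 'v"
  assumes "cyclic_vector A e"
  obtains c where "v = (\<Sum>i<DIM('v). c i *\<^sub>R (A ^^ i) e)"
proof -
  define b where "b i = (A ^^ i) e" for i
  have ind: "(\<Sum>i<DIM('v). c i *\<^sub>R b i) = 0 \<Longrightarrow> i < DIM('v) \<Longrightarrow> c i = 0" for c i
    using assms by (auto simp: cyclic_vector_def b_def)
  have inj: "inj_on b {..<DIM('v)}"
  proof (rule inj_onI)
    fix i j assume ij: "i \<in> {..<DIM('v)}" "j \<in> {..<DIM('v)}" "b i = b j"
    show "i = j"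
    proof (rule ccontr)
      assume ne: "i \<noteq> j"
      define c where "c k = (if k = i then 1 else 0) - (if k = j then 1 else 0 :: real)" for k
      have "(\<Sum>k<DIM('v). c k *\<^sub>R b k) = b i - b j"
        using ij by (simp add: c_def scaleR_diff_left sum_subtractf if_distrib[of "\<lambda>x. x *\<^sub>R _"] cong: if_cong)
      then have "c i = 0" using ind[of c i] ij by simp
      then show False using ne by (simp add: c_def)
    qed
  qed
  have "independent (b ` {..<DIM('v)})"
  proof (rule independent_if_scalars_zero)
    fix f x assume f: "(\<Sum>x\<in>b ` {..<DIM('v)}. f x *\<^sub>R x) = 0" and x: "x \<in> b ` {..<DIM('v)}"
    have "(\<Sum>i<DIM('v). f (b i) *\<^sub>R b i) = 0"
      using f by (simp add: sum.reindex[OF inj])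
    then show "f x = 0" using ind[of "\<lambda>i. f (b i)"] x by auto
  qed simp
  then have "(UNIV :: 'v set) \<subseteq> span (b ` {..<DIM('v)})"
    by (intro card_ge_dim_independent) (auto simp: card_image[OF inj] dim_UNIV)
  then have "v \<in> span (b ` {..<DIM('v)})" by auto
  then obtain u where "v = (\<Sum>x\<in>b ` {..<DIM('v)}. u x *\<^sub>R x)"
    by (auto simp: span_finite)
  then have "v = (\<Sum>i<DIM('v). u (b i) *\<^sub>R (A ^^ i) e)"
    by (simp add: sum.reindex[OF inj]) (simp add: b_def)
  then show ?thesis by (rule that)
qed

lemma cyclic_vector_ext:
  fixes A :: "'v::euclidean_space \<Rightarrow> 'v" and f g :: "'v \<Rightarrow> 'w::real_vector"
  assumes "cyclic_vector A e" "linear f" "linear g" "\<And>i. i < DIM('v) \<Longrightarrow> f ((A ^^ i) e) = g ((A ^^ i) e)"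
  shows "f v = g v"
proof -
  obtain c where "v = (\<Sum>i<DIM('v). c i *\<^sub>R (A ^^ i) e)" using cyclic_vector_expansion[OF assms(1)] .
  then show ?thesis using assms by (simp add: linear_sum linear_cmul)
qed

text \<open>The map from coefficients to combinations of Krylov vectors depends linearly on the
  starting vector. At \<open>e\<close> it is injective, hence bounded below, and a perturbation of
  smaller norm keeps it injective.\<close>

lemma cyclic_vector_Ex_perturb:
  fixes A :: "'v::euclidean_space \<Rightarrow> 'v"
  assumes A: "linear A" and e: "cyclic_vector A e"
  shows "\<exists>\<delta>>0. \<forall>t. \<bar>t\<bar> < \<delta> \<longrightarrow> cyclic_vector A (e + t *\<^sub>R Y)"
proof -
  obtain b :: "nat \<Rightarrow> 'v" where "bij_betw b {..<DIM('v)} Basis"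
    using ex_bij_betw_nat_finite[OF finite_Basis] by (auto simp: atLeast0LessThan)
  then have b: "b ` {..<DIM('v)} = Basis" "inj_on b {..<DIM('v)}" by (auto simp: bij_betw_def)
  have bb: "b i \<bullet> b j = (if i = j then 1 else 0)" if "i < DIM('v)" "j < DIM('v)" for i j
    using that b by (metis imageI inner_Basis inj_on_eq_iff lessThan_iff)
  \<comment> \<open>Coefficient families are encoded as vectors of the same space through an
    enumeration of the orthonormal basis, so that norm estimates for linear maps apply.\<close>
  define F where "F x w = (\<Sum>i<DIM('v). (w \<bullet> b i) *\<^sub>R (A ^^ i) x)" for x w
  have linF: "linear (F x)" for x
    unfolding F_def by (intro linearI) (simp_all add: inner_add_left scaleR_add_left sum.distrib scaleR_sum_right)
  have cyc: "cyclic_vector A x \<longleftrightarrow> (\<forall>w. F x w = 0 \<longrightarrow> w = 0)" for x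
  proof
    assume x: "cyclic_vector A x"
    show "\<forall>w. F x w = 0 \<longrightarrow> w = 0"
    proof (intro allI impI)
      fix w assume "F x w = 0"
      then have "\<forall>i<DIM('v). w \<bullet> b i = 0" using x by (auto simp: cyclic_vector_def F_def)
      then have "\<forall>u\<in>Basis. w \<bullet> u = 0" using b by (metis imageE lessThan_iff)
      then show "w = 0" by (auto intro: euclidean_eqI)
    qed
  next
    assume x: "\<forall>w. F x w = 0 \<longrightarrow> w = 0"
    show "cyclic_vector A x" unfolding cyclic_vector_def
    proof (intro allI impI)
      fix c i assume c: "(\<Sum>i<DIM('v). c i *\<^sub>R (A ^^ i) x) = 0" and i: "i < DIM('v)"
      define w where "w = (\<Sum>i<DIM('v). c i *\<^sub>R b i)"
      have w: "w \<bullet> b j = c j" if "j < DIM('v)" for j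
        using that by (simp add: w_def inner_sum_left bb if_distrib[of "\<lambda>x. _ * x"] cong: if_cong)
      have "F x w = 0" using c by (simp add: F_def w)
      then have "w = 0" using x by blast
      then show "c i = 0" using w[OF i] by simp
    qed
  qed
  have "inj (F e)" using e cyc linear_injective_0[OF linF] by blast
  then obtain B where B: "B > 0" "\<And>w. B * norm w \<le> norm (F e w)"
    using linear_inj_bounded_below_pos[OF linF] by blast
  obtain K where K: "K > 0" "\<And>w. norm (F Y w) \<le> K * norm w"
    using linear_bounded_pos[OF linF] by blast
  have "cyclic_vector A (e + t *\<^sub>R Y)" if t: "\<bar>t\<bar> < B / K" for t
    unfolding cyc
  proof (intro allI impI)
    fix w assume w: "F (e + t *\<^sub>R Y) w = 0"
    have "F (e + t *\<^sub>R Y) w = F e w + t *\<^sub>R F Y w"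
      by (simp add: F_def linear_add[OF linear_funpow[OF A]] linear_cmul[OF linear_funpow[OF A]]
          scaleR_add_right sum.distrib scaleR_sum_right mult.commute)
    then have "norm (F e w) = \<bar>t\<bar> * norm (F Y w)"
      using w by (metis add_eq_0_iff norm_minus_cancel norm_scaleR)
    also have "\<dots> \<le> \<bar>t\<bar> * (K * norm w)" using K by (intro mult_left_mono) auto
    finally have "B * norm w \<le> (\<bar>t\<bar> * K) * norm w" using B(2)[of w] by simp
    moreover have "\<bar>t\<bar> * K < B" using t K by (simp add: pos_less_divide_eq)
    ultimately show "w = 0" by (metis linorder_not_less mult_right_less_imp_less norm_eq_zero norm_ge_zero mult_less_cancel_right_disj zero_less_norm_iff)
  qed
  then show ?thesis using B K by (intro exI[of _ "B / K"]) auto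
qed

lemma cyclic_vector_6D:
  fixes A :: "'v::euclidean_space \<Rightarrow> 'v"
  assumes "cyclic_vector A e" "DIM('v) = 6"
    "a0 *\<^sub>R e + a1 *\<^sub>R (A ^^ 1) e + a2 *\<^sub>R (A ^^ 2) e + a3 *\<^sub>R (A ^^ 3) e + a4 *\<^sub>R (A ^^ 4) e + a5 *\<^sub>R (A ^^ 5) e = 0"
  shows "a0 = 0 \<and> a1 = 0 \<and> a2 = 0 \<and> a3 = 0 \<and> a4 = 0 \<and> a5 = 0"
proof -
  define c where "c i = [a0,a1,a2,a3,a4,a5] ! i" for i :: nat
  have "(\<Sum>i<DIM('v). c i *\<^sub>R (A ^^ i) e) = 0"
    using assms(3) unfolding assms(2) by (simp add: c_def eval_nat_numeral)
  then have "\<forall>i<6. c i = 0" using assms(1,2) by (auto simp: cyclic_vector_def)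
  then have "c 0 = 0" "c 1 = 0" "c 2 = 0" "c 3 = 0" "c 4 = 0" "c 5 = 0" by auto
  then show ?thesis by (simp add: c_def)
qed

lemma cyclic_vector_6E:
  fixes A :: "'v::euclidean_space \<Rightarrow> 'v"
  assumes "cyclic_vector A e" "DIM('v) = 6"
  obtains a0 a1 a2 a3 a4 a5 where
    "v = a0 *\<^sub>R e + a1 *\<^sub>R (A ^^ 1) e + a2 *\<^sub>R (A ^^ 2) e + a3 *\<^sub>R (A ^^ 3) e + a4 *\<^sub>R (A ^^ 4) e + a5 *\<^sub>R (A ^^ 5) e"
proof -
  obtain c where "v = (\<Sum>i<DIM('v). c i *\<^sub>R (A ^^ i) e)" using cyclic_vector_expansion[OF assms(1)] .
  then have "v = c 0 *\<^sub>R e + c 1 *\<^sub>R (A ^^ 1) e + c 2 *\<^sub>R (A ^^ 2) e + c 3 *\<^sub>R (A ^^ 3) e + c 4 *\<^sub>R (A ^^ 4) e + c 5 *\<^sub>R (A ^^ 5) e"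
    unfolding assms(2) by (simp add: eval_nat_numeral)
  then show ?thesis by (rule that)
qed

text \<open>Cyclicity is an open condition. If \<open>S = T - a - bA\<close> kills \<open>e\<close>, then
  \<open>S Y = S (e + tY) / t\<close> lies in the span of \<open>e + tY\<close> and \<open>A (e + tY)\<close> for all small \<open>t\<close>; two values of \<open>t\<close>
  give \<open>S Y = 0\<close> as soon as \<open>e\<close>, \<open>A e\<close>, \<open>Y\<close>, \<open>A Y\<close> are independent.\<close>

lemma pencil_if_cyclic_vectors:
  fixes A T :: "'v::euclidean_space \<Rightarrow> 'v"
  assumes dim: "DIM('v) = 6" and A: "linear A" and T: "linear T" and e: "cyclic_vector A e"
    and span: "\<And>x. cyclic_vector A x \<Longrightarrow> \<exists>a b. T x = a *\<^sub>R x + b *\<^sub>R A x"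
  shows "\<exists>a b. \<forall>x. T x = a *\<^sub>R x + b *\<^sub>R A x"
proof -
  obtain a b where ab: "T e = a *\<^sub>R e + b *\<^sub>R A e" using span[OF e] by blast
  define S where "S x = T x - a *\<^sub>R x - b *\<^sub>R A x" for x
  have S: "linear S" unfolding S_def
    by (intro linearI) (simp_all add: linear_add[OF A] linear_add[OF T] linear_cmul[OF A] linear_cmul[OF T] algebra_simps)
  have Se: "S e = 0" by (simp add: S_def ab)
  have Sspan: "\<exists>a b. S x = a *\<^sub>R x + b *\<^sub>R A x" if x: "cyclic_vector A x" for x
  proof -
    obtain a' b' where "T x = a' *\<^sub>R x + b' *\<^sub>R A x" using span[OF x] by blast
    then have "S x = (a' - a) *\<^sub>R x + (b' - b) *\<^sub>R A x" by (simp add: S_def algebra_simps)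
    then show ?thesis by blast
  qed
  have zero: "S Y = 0" if ind: "\<And>p q r s. p *\<^sub>R e + q *\<^sub>R A e + r *\<^sub>R Y + s *\<^sub>R A Y = 0 \<Longrightarrow> p = 0 \<and> q = 0 \<and> r = 0 \<and> s = 0" for Y
  proof -
    obtain d where d: "d > 0" "\<And>t. \<bar>t\<bar> < d \<Longrightarrow> cyclic_vector A (e + t *\<^sub>R Y)"
      using cyclic_vector_Ex_perturb[OF A e] by blast
    have ex: "\<exists>p q. S Y = p *\<^sub>R e + q *\<^sub>R A e + (t * p) *\<^sub>R Y + (t * q) *\<^sub>R A Y" if t: "0 < t" "t < d" for t
    proof -
      obtain p q where "S (e + t *\<^sub>R Y) = p *\<^sub>R (e + t *\<^sub>R Y) + q *\<^sub>R A (e + t *\<^sub>R Y)"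
        using Sspan[OF d(2)[of t]] t by auto
      then have "t *\<^sub>R S Y = p *\<^sub>R e + q *\<^sub>R A e + (t * p) *\<^sub>R Y + (t * q) *\<^sub>R A Y"
        by (simp add: linear_add[OF A] linear_add[OF S] linear_cmul[OF A] linear_cmul[OF S] Se algebra_simps)
      then have "(1 / t) *\<^sub>R t *\<^sub>R S Y = (1 / t) *\<^sub>R (p *\<^sub>R e + q *\<^sub>R A e + (t * p) *\<^sub>R Y + (t * q) *\<^sub>R A Y)" by simp
      then have "S Y = (p / t) *\<^sub>R e + (q / t) *\<^sub>R A e + (t * (p / t)) *\<^sub>R Y + (t * (q / t)) *\<^sub>R A Y"
        using t by (simp add: scaleR_add_right)
      then show ?thesis by blast
    qed
    obtain p q where pq: "S Y = p *\<^sub>R e + q *\<^sub>R A e + (d/2 * p) *\<^sub>R Y + (d/2 * q) *\<^sub>R A Y"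
      using ex[of "d/2"] d by auto
    obtain p' q' where pq': "S Y = p' *\<^sub>R e + q' *\<^sub>R A e + (d/3 * p') *\<^sub>R Y + (d/3 * q') *\<^sub>R A Y"
      using ex[of "d/3"] d by auto
    have "(p - p') *\<^sub>R e + (q - q') *\<^sub>R A e + (d/2 * p - d/3 * p') *\<^sub>R Y + (d/2 * q - d/3 * q') *\<^sub>R A Y = S Y - S Y"
      unfolding scaleR_diff_left by (subst pq, subst pq') simp
    then have "p - p' = 0 \<and> q - q' = 0 \<and> d/2 * p - d/3 * p' = 0 \<and> d/2 * q - d/3 * q' = 0"
      by (intro ind) simp
    then have "p = 0" "q = 0" using d by auto
    then show ?thesis using pq by simp
  qed
  define w where "w i = (A ^^ i) e" for i
  have Aw: "A (w i) = w (Suc i)" for i by (simp add: w_def)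
  have w0: "e = w 0" by (simp add: w_def)
  have ind: "a0 = 0 \<and> a1 = 0 \<and> a2 = 0 \<and> a3 = 0 \<and> a4 = 0 \<and> a5 = 0"
    if "a0 *\<^sub>R w 0 + a1 *\<^sub>R w 1 + a2 *\<^sub>R w 2 + a3 *\<^sub>R w 3 + a4 *\<^sub>R w 4 + a5 *\<^sub>R w 5 = 0" for a0 a1 a2 a3 a4 a5
    using cyclic_vector_6D[OF e dim, of a0 a1 a2 a3 a4 a5] that by (simp add: w_def)
  have Sadd: "S (x + y) = S x + S y" "S (c *\<^sub>R x) = c *\<^sub>R S x" for x y c
    by (simp_all add: linear_add[OF S] linear_cmul[OF S])
  have Aadd: "A (x + y) = A x + A y" "A (c *\<^sub>R x) = c *\<^sub>R A x" for x y c
    by (simp_all add: linear_add[OF A] linear_cmul[OF A])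
  have S2: "S (w 2) = 0"
    by (rule zero, unfold w0 Aw) (use ind[of _ _ _ _ 0 0] in \<open>simp add: numeral_eq_Suc\<close>)
  have S3: "S (w 3) = 0"
    by (rule zero, unfold w0 Aw) (use ind[of _ _ 0 _ _ 0] in \<open>simp add: numeral_eq_Suc\<close>)
  have S4: "S (w 4) = 0"
    by (rule zero, unfold w0 Aw) (use ind[of _ _ 0 0 _ _] in \<open>simp add: numeral_eq_Suc\<close>)
  \<comment> \<open>Since \<open>w 1\<close> is \<open>A e\<close> itself, it is shifted by
    \<open>w 3\<close>, where \<open>S\<close> is already known to vanish.\<close>
  have "S (w 1 + w 3) = 0"
  proof (rule zero)
    fix p q r s assume "p *\<^sub>R e + q *\<^sub>R A e + r *\<^sub>R (w 1 + w 3) + s *\<^sub>R A (w 1 + w 3) = 0"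
    then have "p *\<^sub>R w 0 + (q + r) *\<^sub>R w 1 + s *\<^sub>R w 2 + r *\<^sub>R w 3 + s *\<^sub>R w 4 + 0 *\<^sub>R w 5 = 0"
      by (simp add: w0 Aw Aadd algebra_simps numeral_eq_Suc)
    from ind[OF this] show "p = 0 \<and> q = 0 \<and> r = 0 \<and> s = 0" by auto
  qed
  then have S1: "S (w 1) = 0" using S3 by (simp add: Sadd)
  obtain c0 c1 c2 c3 c4 c5 where "w 6 = c0 *\<^sub>R w 0 + c1 *\<^sub>R w 1 + c2 *\<^sub>R w 2 + c3 *\<^sub>R w 3 + c4 *\<^sub>R w 4 + c5 *\<^sub>R w 5"
    by (rule cyclic_vector_6E[OF e dim, of "w 6"]) (rule that, simp add: w_def)
  then have A5: "A (w 5) = c0 *\<^sub>R w 0 + c1 *\<^sub>R w 1 + c2 *\<^sub>R w 2 + c3 *\<^sub>R w 3 + c4 *\<^sub>R w 4 + c5 *\<^sub>R w 5"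
    by (simp add: Aw)
  \<comment> \<open>\<open>A (w 5)\<close> is an arbitrary combination of the \<open>w i\<close>.
    Adding \<open>(1 - c4)\<close> times \<open>w 3\<close> makes the coefficient of
    \<open>w 4\<close> in the image equal to 1, which secures independence.\<close>
  have "S (w 5 + (1 - c4) *\<^sub>R w 3) = 0"
  proof (rule zero)
    fix p q r s
    assume "p *\<^sub>R e + q *\<^sub>R A e + r *\<^sub>R (w 5 + (1 - c4) *\<^sub>R w 3) + s *\<^sub>R A (w 5 + (1 - c4) *\<^sub>R w 3) = 0"
    then have "p *\<^sub>R w 0 + q *\<^sub>R w 1 + r *\<^sub>R (w 5 + (1 - c4) *\<^sub>R w 3) + s *\<^sub>R ((c0 *\<^sub>R w 0 + c1 *\<^sub>R w 1 + c2 *\<^sub>R w 2 + c3 *\<^sub>R w 3 + c4 *\<^sub>R w 4 + c5 *\<^sub>R w 5) + (1 - c4) *\<^sub>R w 4) = 0"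
      by (simp add: A5 Aadd) (simp add: w0 Aw)
    then have "(p + s * c0) *\<^sub>R w 0 + (q + s * c1) *\<^sub>R w 1 + (s * c2) *\<^sub>R w 2 + (r * (1 - c4) + s * c3) *\<^sub>R w 3 + s *\<^sub>R w 4 + (r + s * c5) *\<^sub>R w 5 = 0"
      by (simp add: algebra_simps)
    from ind[OF this] show "p = 0 \<and> q = 0 \<and> r = 0 \<and> s = 0" by auto
  qed
  then have S5: "S (w 5) = 0" using S3 by (simp add: Sadd)
  have "S x = 0" for x
  proof -
    obtain a0 a1 a2 a3 a4 a5 where "x = a0 *\<^sub>R w 0 + a1 *\<^sub>R w 1 + a2 *\<^sub>R w 2 + a3 *\<^sub>R w 3 + a4 *\<^sub>R w 4 + a5 *\<^sub>R w 5"
      by (rule cyclic_vector_6E[OF e dim, of x]) (rule that, simp add: w_def)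
    then show ?thesis using Se S1 S2 S3 S4 S5 by (simp add: Sadd w0)
  qed
  then have "T x = a *\<^sub>R x + b *\<^sub>R A x" for x by (metis S_def diff_diff_eq eq_iff_diff_eq_0)
  then show ?thesis by blast
qed

subsection \<open>Pointwise algebra of the curvature\<close>

text \<open>Nondegenerate rather than definite: a nonzero vector may be orthogonal to itself, so
  vectors are told apart by pairing with all others, as in \<open>g_eqI\<close>.\<close>

locale metric_space_form =
  fixes g :: "'v::euclidean_space \<Rightarrow> 'v \<Rightarrow> real"
  assumes g_bilinear: "bilinear g"
    and g_sym: "g x y = g y x"
    and g_nondeg: "(\<And>y. g x y = 0) \<Longrightarrow> x = 0"
begin

lemma g_linear: "linear (g x)" "linear (\<lambda>x. g x y)"
  using g_bilinear by (auto simp: bilinear_def)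

lemma g_simps:
  "g (x + y) z = g x z + g y z" "g z (x + y) = g z x + g z y"
  "g (x - y) z = g x z - g y z" "g z (x - y) = g z x - g z y"
  "g (c *\<^sub>R x) z = c * g x z" "g z (c *\<^sub>R x) = c * g z x" "g 0 z = 0" "g z 0 = 0" "g (- x) z = - g x z" "g z (- x) = - g z x"
  using g_bilinear by (simp_all add: bilinear_ladd bilinear_radd bilinear_lsub bilinear_rsub
      bilinear_lmul bilinear_rmul bilinear_lzero bilinear_rzero bilinear_lneg bilinear_rneg)

lemma g_eqI: "(\<And>z. g x z = g y z) \<Longrightarrow> x = y"
  using g_nondeg[of "x - y"] by (simp add: g_simps)

text \<open>A linear form that vanishes on the common kernel of two others is a combination of them.
  The orthogonal decomposition is Euclidean, because \<open>g\<close> may degenerate on the span of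
  \<open>p\<close> and \<open>q\<close>.\<close>

lemma mem_span_pair_if_annihilated:
  assumes "\<And>z. g p z = 0 \<Longrightarrow> g q z = 0 \<Longrightarrow> g w z = 0"
  shows "\<exists>a b. w = a *\<^sub>R p + b *\<^sub>R q"
proof -
  define G where "G x = adjoint (g x) 1" for x
  have G: "g x z = G x \<bullet> z" for x z
    using adjoint_works[OF g_linear(1), of z x 1] by (simp add: G_def inner_commute)
  have linG: "G (a *\<^sub>R x + b *\<^sub>R y) = a *\<^sub>R G x + b *\<^sub>R G y" for a b x y
    by (rule vector_eq_rdot[THEN iffD1]) (simp add: G[symmetric] inner_add_left g_simps)
  obtain y z where yz: "y \<in> span {G p, G q}" "\<And>u. u \<in> span {G p, G q} \<Longrightarrow> z \<bullet> u = 0" "G w = y + z"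
    using orthogonal_subspace_decomp_exists[of "{G p, G q}" "G w"] unfolding Linear_Algebra.orthogonal_def by blast
  have "g p z = 0" "g q z = 0" using yz(2)[of "G p"] yz(2)[of "G q"] by (auto simp: G span_base inner_commute)
  then have "G w \<bullet> z = 0" using assms G by auto
  moreover have "y \<bullet> z = 0" using yz(1,2) by (auto simp: inner_commute)
  ultimately have "z = 0" using yz(3) by (simp add: inner_add_left)
  then have "G w \<in> span {G p, G q}" using yz(1,3) by simp
  then obtain a where "G w - a *\<^sub>R G p \<in> span {G q}" by (rule span_breakdown_eq[THEN iffD1, THEN exE])
  then obtain b where "G w - a *\<^sub>R G p = b *\<^sub>R G q" by (auto simp: span_singleton)
  then have "G w = a *\<^sub>R G p + b *\<^sub>R G q" by (simp add: algebra_simps)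
  then have "G w = G (a *\<^sub>R p + b *\<^sub>R q)" by (simp add: linG)
  then have "w = a *\<^sub>R p + b *\<^sub>R q" by (intro g_eqI) (simp add: G)
  then show ?thesis by blast
qed

end

locale metric_operator = metric_space_form g for g :: "'v::euclidean_space \<Rightarrow> 'v \<Rightarrow> real" +
  fixes A :: "'v \<Rightarrow> 'v" and e :: 'v
  assumes A_linear: "linear A"
    and A_selfadjoint: "g (A x) y = g x (A y)"
    and cyclic: "cyclic_vector A e"
    and dim6: "DIM('v) = 6"
begin

lemma A_simps: "A (x + y) = A x + A y" "A (x - y) = A x - A y" "A (c *\<^sub>R x) = c *\<^sub>R A x" "A 0 = 0"
  by (simp_all add: linear_add linear_diff linear_cmul linear_0 A_linear)

text \<open>Commuting with the self-adjoint \<open>A\<close> makes the number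
  \<open>g (T ((A ^^ i) e)) ((A ^^ j) e)\<close> depend on \<open>i + j\<close> only, hence
  symmetric in \<open>i\<close> and \<open>j\<close>; skewness makes it antisymmetric.\<close>

lemma skew_commuting_eq_0:
  assumes T: "linear T" and comm: "\<And>x. T (A x) = A (T x)" and skew: "\<And>x y. g (T x) y = - g x (T y)"
  shows "T x = 0"
proof -
  have TA: "T ((A ^^ i) x) = (A ^^ i) (T x)" for i x
    by (induction i) (simp_all add: comm)
  have Asa: "g ((A ^^ i) x) y = g x ((A ^^ i) y)" for i x y
  proof (induction i arbitrary: y)
    case (Suc i)
    have "g ((A ^^ Suc i) x) y = g ((A ^^ i) x) (A y)" by (simp add: A_selfadjoint)
    also have "\<dots> = g x ((A ^^ Suc i) y)" by (simp add: Suc funpow_swap1)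
    finally show ?case .
  qed simp
  have Te: "g (T ((A ^^ i) e)) ((A ^^ j) e) = g (T e) ((A ^^ (i + j)) e)" for i j
    by (simp add: TA Asa funpow_add)
  have 0: "g (T ((A ^^ i) e)) ((A ^^ j) e) = 0" for i j
  proof -
    have "g (T ((A ^^ i) e)) ((A ^^ j) e) = - g (T ((A ^^ j) e)) ((A ^^ i) e)"
      using skew[of "(A ^^ i) e" "(A ^^ j) e"] g_sym by simp
    then show ?thesis using Te[of i j] Te[of j i] by (simp add: add.commute)
  qed
  have "T ((A ^^ i) e) = 0" for i
    using cyclic_vector_ext[OF cyclic g_linear(1) module_hom_zero] 0 by (intro g_nondeg) blast
  then show ?thesis using cyclic_vector_ext[OF cyclic T module_hom_zero] by blast
qed

text \<open>An operator in the commutant of \<open>A\<close> is determined by its value on a cyclic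
  vector.\<close>

lemma commuting_eq_pencil:
  assumes T: "linear T" and comm: "\<And>x. T (A x) = A (T x)" and e: "T e = a *\<^sub>R e + b *\<^sub>R A e"
  shows "T x = a *\<^sub>R x + b *\<^sub>R A x"
proof (rule cyclic_vector_ext[OF cyclic T])
  show "linear (\<lambda>x. a *\<^sub>R x + b *\<^sub>R A x)" by (intro linearI) (simp_all add: A_simps algebra_simps)
  have "T ((A ^^ i) e) = (A ^^ i) (T e)" for i
    by (induction i) (simp_all add: comm)
  moreover have "(A ^^ i) (a *\<^sub>R e + b *\<^sub>R A e) = a *\<^sub>R (A ^^ i) e + b *\<^sub>R A ((A ^^ i) e)" for i
    by (induction i) (simp_all add: A_simps)
  ultimately show "T ((A ^^ i) e) = a *\<^sub>R (A ^^ i) e + b *\<^sub>R A ((A ^^ i) e)" for i by (simp add: e)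
qed

text \<open>The forms \<open>s\<close> and \<open>t\<close> have a common nonzero zero
  \<open>Z\<close> in the three-dimensional span of \<open>w 0\<close>, \<open>w 1\<close>,
  \<open>w 2\<close>. The pencil then kills \<open>Z\<close>, and the coefficients of
  \<open>w 0\<close> to \<open>w 3\<close> force \<open>a = b = 0\<close>. This is what makes the
  coefficients of a pencil of solutions constant.\<close>

lemma pencil_rank_le_2_imp_0:
  assumes s: "linear s" and t: "linear t"
    and eq: "\<And>z w. a * g z w + b * g (A z) w = s z * t w + t z * s w"
  shows "a = 0 \<and> b = 0"
proof -
  define w where "w i = (A ^^ i) e" for i
  have Aw: "A (w i) = w (Suc i)" for i by (simp add: w_def)
  have ind: "a0 = 0 \<and> a1 = 0 \<and> a2 = 0 \<and> a3 = 0"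
    if "a0 *\<^sub>R w 0 + a1 *\<^sub>R w 1 + a2 *\<^sub>R w 2 + a3 *\<^sub>R w 3 = 0" for a0 a1 a2 a3
    using cyclic_vector_6D[OF cyclic dim6, of a0 a1 a2 a3 0 0] that by (simp add: w_def)
  \<comment> \<open>The cross product of the value triples of \<open>s\<close> and \<open>t\<close>
    solves both equations. If it is zero, the triples are proportional and one equation
    suffices.\<close>
  define c0 c1 c2 where c: "c0 = s (w 1) * t (w 2) - s (w 2) * t (w 1)"
    "c1 = s (w 2) * t (w 0) - s (w 0) * t (w 2)" "c2 = s (w 0) * t (w 1) - s (w 1) * t (w 0)"
  obtain z0 z1 z2 where z: "z0 \<noteq> 0 \<or> z1 \<noteq> 0 \<or> z2 \<noteq> (0::real)"
    "z0 * s (w 0) + z1 * s (w 1) + z2 * s (w 2) = 0" "z0 * t (w 0) + z1 * t (w 1) + z2 * t (w 2) = 0"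
  proof (cases "c0 = 0 \<and> c1 = 0 \<and> c2 = 0")
    case False
    show ?thesis by (rule that[of c0 c1 c2]) (use False in \<open>auto simp: c algebra_simps\<close>)
  next
    case True
    consider "s (w 0) = 0" "t (w 0) = 0" | "s (w 0) \<noteq> 0" | "t (w 0) \<noteq> 0" by blast
    then show ?thesis
    proof cases
      case 1 then show ?thesis by (intro that[of 1 0 0]) auto
    next
      case 2 then show ?thesis by (intro that[of "s (w 1)" "- s (w 0)" 0]) (use True in \<open>auto simp: c algebra_simps\<close>)
    next
      case 3 then show ?thesis by (intro that[of "t (w 1)" "- t (w 0)" 0]) (use True in \<open>auto simp: c algebra_simps\<close>)
    qed
  qed
  define Z where "Z = z0 *\<^sub>R w 0 + z1 *\<^sub>R w 1 + z2 *\<^sub>R w 2"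
  have "s Z = 0" "t Z = 0" using z by (simp_all add: Z_def linear_add linear_cmul s t)
  then have "a *\<^sub>R Z + b *\<^sub>R A Z = 0" using eq[of Z] by (intro g_nondeg) (simp add: g_simps)
  then have "(a * z0) *\<^sub>R w 0 + (a * z1 + b * z0) *\<^sub>R w 1 + (a * z2 + b * z1) *\<^sub>R w 2 + (b * z2) *\<^sub>R w 3 = 0"
    by (simp add: Z_def A_simps Aw algebra_simps numeral_eq_Suc)
  from ind[OF this] show ?thesis using z(1) by auto
qed

text \<open>By nondegeneracy the hypothesis is a vector identity in \<open>u\<close>,
  \<open>v\<close>, \<open>A u\<close>, \<open>A v\<close>. For \<open>u\<close> and
  \<open>v\<close> two steps apart in the Krylov basis these four vectors are independent. It is the
  algebraic end of the Schur argument, with \<open>k\<close> and \<open>m\<close> differentials of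
  functions.\<close>

lemma wedge_eq_0_imp:
  assumes k: "linear k"
    and eq: "\<And>u v z. k v * g (A u) z - k u * g (A v) z + m v * g u z - m u * g v z = 0"
  shows "k x = 0"
proof -
  define w where "w i = (A ^^ i) e" for i
  have Aw: "A (w i) = w (Suc i)" for i by (simp add: w_def)
  have ind: "a0 = 0 \<and> a1 = 0 \<and> a2 = 0 \<and> a3 = 0 \<and> a4 = 0 \<and> a5 = 0"
    if "a0 *\<^sub>R w 0 + a1 *\<^sub>R w 1 + a2 *\<^sub>R w 2 + a3 *\<^sub>R w 3 + a4 *\<^sub>R w 4 + a5 *\<^sub>R w 5 = 0" for a0 a1 a2 a3 a4 a5
    using cyclic_vector_6D[OF cyclic dim6, of a0 a1 a2 a3 a4 a5] that by (simp add: w_def)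
  have vec: "k v *\<^sub>R A u - k u *\<^sub>R A v + m v *\<^sub>R u - m u *\<^sub>R v = 0" for u v
    using eq[of v u] by (intro g_nondeg) (simp add: g_simps)
  have "k (w 2) *\<^sub>R w 1 - k (w 0) *\<^sub>R w 3 + m (w 2) *\<^sub>R w 0 - m (w 0) *\<^sub>R w 2 = 0"
    using vec[of "w 2" "w 0"] by (simp add: Aw numeral_eq_Suc)
  then have k02: "k (w 0) = 0" "k (w 2) = 0"
    using ind[of "m (w 2)" "k (w 2)" "- m (w 0)" "- k (w 0)" 0 0] by (auto simp: algebra_simps)
  have "k (w 3) *\<^sub>R w 2 - k (w 1) *\<^sub>R w 4 + m (w 3) *\<^sub>R w 1 - m (w 1) *\<^sub>R w 3 = 0"
    using vec[of "w 3" "w 1"] by (simp add: Aw numeral_eq_Suc)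
  then have k13: "k (w 1) = 0" "k (w 3) = 0"
    using ind[of 0 "m (w 3)" "k (w 3)" "- m (w 1)" "- k (w 1)" 0] by (auto simp: algebra_simps)
  have "k (w 4) *\<^sub>R w 1 + m (w 4) *\<^sub>R w 0 - m (w 0) *\<^sub>R w 4 = 0"
    using vec[of "w 4" "w 0"] k02 by (simp add: Aw numeral_eq_Suc)
  then have k4: "k (w 4) = 0"
    using ind[of "m (w 4)" "k (w 4)" 0 0 "- m (w 0)" 0] by (auto simp: algebra_simps)
  \<comment> \<open>\<open>A (w 5)\<close> would leave the Krylov basis, but its coefficient
    \<open>k (w 0)\<close> is already zero.\<close>
  have "k (w 5) *\<^sub>R w 1 + m (w 5) *\<^sub>R w 0 - m (w 0) *\<^sub>R w 5 = 0"
    using vec[of "w 5" "w 0"] k02 by (simp add: Aw numeral_eq_Suc)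
  then have k5: "k (w 5) = 0"
    using ind[of "m (w 5)" "k (w 5)" 0 0 0 "- m (w 0)"] by (auto simp: algebra_simps)
  have "k (w i) = 0" if "i < 6" for i
    using that k02 k13 k4 k5 by (auto simp: less_Suc_eq numeral_eq_Suc)
  then show ?thesis using cyclic_vector_ext[OF cyclic k module_hom_zero] dim6 by (simp add: w_def)
qed

end

text \<open>\<open>R_A\<close> is the Ricci identity for the tensor \<open>g (A x) y\<close>, with \<open>L\<close> the Hessian of its potential.\<close>

locale curvature_operator = metric_operator g A e
  for g :: "'v::euclidean_space \<Rightarrow> 'v \<Rightarrow> real" and A e +
  fixes R :: "'v \<Rightarrow> 'v \<Rightarrow> 'v \<Rightarrow> 'v" and L :: "'v \<Rightarrow> 'v \<Rightarrow> real"
  assumes R_linear: "linear (R u v)"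
    and R_skew: "R u v z = - R v u z"
    and R_metric: "g (R u v z) w = - g (R u v w) z"
    and R_bianchi: "R u v w + R v w u + R w u v = 0"
    and L_bilinear: "bilinear L"
    and L_sym: "L x y = L y x"
    and R_A: "g (R u v z) (A w) + g (R u v w) (A z)
        + (L u z * g v w + L u w * g v z - L v z * g u w - L v w * g u z) = 0"
begin

lemma L_simps:
  "L (x + y) z = L x z + L y z" "L z (x + y) = L z x + L z y"
  "L (x - y) z = L x z - L y z" "L z (x - y) = L z x - L z y"
  "L (c *\<^sub>R x) z = c * L x z" "L z (c *\<^sub>R x) = c * L z x" "L 0 z = 0" "L z 0 = 0"
  using L_bilinear by (simp_all add: bilinear_ladd bilinear_radd bilinear_lsub bilinear_rsub
      bilinear_lmul bilinear_rmul bilinear_lzero bilinear_rzero)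

text \<open>The octahedron argument: four Bianchi identities are combined, and the two
  antisymmetries cancel everything else.\<close>

lemma pair_symmetry: "g (R x y z) w = g (R z w x) y"
proof -
  have b: "g (R u v w) x + g (R v w u) x + g (R w u v) x = 0" for u v w x
    using arg_cong[OF R_bianchi[of u v w], of "\<lambda>t. g t x"] by (simp add: g_simps)
  have s: "g (R u v z) w = - g (R v u z) w" for u v z w
    using R_skew[of u v z] by (simp add: g_simps)
  note m = R_metric
  have "g (R x y z) w + g (R y z x) w + g (R z x y) w = 0" by (rule b)
  moreover have "g (R y z x) w + g (R z w x) y + g (R y w z) x = 0"
    using b[of y z w x] m[of y z w x] m[of z w y x] s[of w y z x] by linarith
  moreover have "g (R z w x) y + g (R x w y) z + g (R z x y) w = 0"
    using b[of z w x y] s[of w x z y] m[of x w z y] s[of x z w y] m[of z x w y] by linarith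
  moreover have "g (R x y z) w + g (R x w y) z + g (R y w z) x = 0"
    using b[of w x y z] s[of w x y z] m[of x y w z] m[of y w x z] by linarith
  ultimately show ?thesis by linarith
qed

text \<open>Pair symmetry makes \<open>g (R (A x) x z) (A z)\<close> symmetric in \<open>x\<close>
  and \<open>z\<close>, and \<open>R_A\<close> evaluates both versions. The result is
  \<open>g x z * Q x z = 0\<close> for the defect \<open>Q\<close>; both factors are linear in
  \<open>z\<close>, and the first is not the zero form unless \<open>x = 0\<close>.\<close>

lemma L_A_commute: "L (A x) z = L x (A z)"
proof -
  define Q where "Q x z = L (A x) z - L x (A z)" for x z
  have Qz: "Q x (y + z) = Q x y + Q x z" for x y z by (simp add: Q_def L_simps A_simps)
  have gQ: "g x z * Q x z = 0" for x z
  proof -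
    have "g (R (A x) x z) (A z) + g (R (A x) x z) (A z) + (L (A x) z * g x z + L (A x) z * g x z - L x z * g (A x) z - L x z * g (A x) z) = 0"
      by (rule R_A)
    moreover have "g (R (A z) z x) (A x) = g (R (A x) x z) (A z)"
      using pair_symmetry[of "A z" z x "A x"] R_skew[of x "A x" "A z"] R_metric[of "A x" x "A z" z] by (simp add: g_simps)
    moreover have "L z x = L x z" "L (A z) x = L x (A z)" "g z x = g x z" "g (A z) x = g (A x) z"
      using L_sym g_sym A_selfadjoint by metis+
    then have "g (R (A z) z x) (A x) + g (R (A z) z x) (A x) + (L x (A z) * g x z + L x (A z) * g x z - L x z * g (A x) z - L x z * g (A x) z) = 0"
      using R_A[of "A z" z x x] by simp
    ultimately have "L (A x) z * g x z = L x (A z) * g x z" by linarith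
    then show ?thesis by (simp add: Q_def algebra_simps)
  qed
  have "Q x z = 0" for x z
  proof (rule ccontr)
    assume ne: "Q x z \<noteq> 0"
    then have gz: "g x z = 0" using gQ[of x z] by simp
    have "g x y = 0" for y
    proof (rule ccontr)
      assume y: "g x y \<noteq> 0"
      then have "Q x y = 0" using gQ[of x y] by simp
      moreover have "g x (y + z) * Q x (y + z) = 0" by (rule gQ)
      ultimately show False using y gz ne by (simp add: Qz g_simps)
    qed
    then have "x = 0" by (rule g_nondeg)
    then show False using ne by (simp add: Q_def A_simps L_simps)
  qed
  then show ?thesis by (simp add: Q_def)
qed

text \<open>The \<open>m\<close> term cancels in \<open>R_A\<close>, and the space-form curvature
  with the same \<open>k\<close> satisfies the identity that remains. The difference
  \<open>T\<close> of the two curvatures commutes with \<open>A\<close> and is skew, so it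
  vanishes.\<close>

lemma constant_type_if_L_pencil:
  assumes L: "\<And>x y. L x y = m * g x y - k * g (A x) y"
  shows "R u v z = k *\<^sub>R (g v z *\<^sub>R u - g u z *\<^sub>R v)"
proof -
  define T where "T z = R u v z - k *\<^sub>R (g v z *\<^sub>R u - g u z *\<^sub>R v)" for z
  have lin: "linear T" unfolding T_def
    by (intro linearI) (simp_all add: linear_add[OF R_linear] linear_cmul[OF R_linear] g_simps algebra_simps)
  have skew: "g (T x) y = - g x (T y)" for x y
    using R_metric[of u v x y] g_sym[of x "R u v y"] g_sym[of x u] g_sym[of x v] by (simp add: T_def g_simps algebra_simps)
  have T0: "g (T x) (A y) + g (T y) (A x) = 0" for x y
    using R_A[of u v x y] unfolding L
    by (simp add: T_def g_simps A_selfadjoint algebra_simps)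
  have comm: "T (A x) = A (T x)" for x
  proof (rule g_eqI)
    fix z
    show "g (T (A x)) z = g (A (T x)) z"
      using T0[of x z] skew[of "A x" z] g_sym[of "A x" "T z"] by (simp add: A_selfadjoint)
  qed
  have "T z = 0" by (rule skew_commuting_eq_0[OF lin comm skew])
  then show ?thesis by (simp add: T_def)
qed

lemma constant_type_or_pencil:
  assumes B: "linear B" and B_sa: "\<And>x y. g (B x) y = g x (B y)"
    and L'_bilinear: "bilinear L'" and L'_sym: "\<And>x y. L' x y = L' y x"
    and R_B: "\<And>u v z w. g (R u v z) (B w) + g (R u v w) (B z)
        + (L' u z * g v w + L' u w * g v z - L' v z * g u w - L' v w * g u z) = 0"
  shows "(\<exists>a b. \<forall>x. B x = a *\<^sub>R x + b *\<^sub>R A x) \<or>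
     (\<exists>k. \<forall>u v z. R u v z = k *\<^sub>R (g v z *\<^sub>R u - g u z *\<^sub>R v))"
proof -
  have key: "L x z * g (B x) z - L' x z * g (A x) z = g x z * (L (B x) z - L' (A z) x)" for x z
  proof -
    have "g (R (B x) x z) (A z) + g (R (B x) x z) (A z) + (L (B x) z * g x z + L (B x) z * g x z - L x z * g (B x) z - L x z * g (B x) z) = 0"
      by (rule R_A)
    moreover have "g (R (A z) z x) (B x) + g (R (A z) z x) (B x) + (L' (A z) x * g z x + L' (A z) x * g z x - L' z x * g (A z) x - L' z x * g (A z) x) = 0"
      by (rule R_B)
    moreover have "g (R (A z) z x) (B x) = g (R (B x) x z) (A z)"
      using pair_symmetry[of "A z" z x "B x"] R_skew[of x "B x" "A z"] R_metric[of "B x" x "A z" z] by (simp add: g_simps)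
    moreover have "L' z x = L' x z" "g z x = g x z" "g (A z) x = g (A x) z"
      using L'_sym g_sym A_selfadjoint by metis+
    ultimately show ?thesis by (simp add: algebra_simps)
  qed
  \<comment> \<open>\<open>adjoint (g x) 1\<close> is the Euclidean vector that represents the
    functional \<open>g x\<close>. This map is injective, hence surjective, so every functional is
    represented by \<open>g\<close>, and \<open>L\<close> becomes an operator
    \<open>H\<close>.\<close>
  have inj: "inj (\<lambda>x. adjoint (g x) 1)"
  proof (rule injI)
    fix x y assume "adjoint (g x) 1 = adjoint (g y) 1"
    then show "x = y"
      using adjoint_works[OF g_linear(1), of _ x 1] adjoint_works[OF g_linear(1), of _ y 1] by (intro g_eqI) simp
  qed
  have lin: "linear (\<lambda>x. adjoint (g x) 1)"
    by (intro linearI; rule vector_eq_ldot[THEN iffD1])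
      (simp_all add: inner_add_right adjoint_works[OF g_linear(1)] g_simps)
  have "\<exists>y. \<forall>z. L x z = g y z" for x
  proof -
    have Llin: "linear (L x)" using L_bilinear by (simp add: bilinear_def)
    have "surj (\<lambda>x. adjoint (g x) 1)" using linear_injective_imp_surjective[OF lin inj] by simp
    then obtain y where y: "adjoint (L x) 1 = adjoint (g y) 1" using surjD[where y="adjoint (L x) 1"] by blast
    have "L x z = g y z" for z
      using adjoint_works[OF Llin, of z 1] adjoint_works[OF g_linear(1), of z y 1] y by simp
    then show ?thesis by blast
  qed
  then obtain H where H: "L x z = g (H x) z" for x z by metis
  have Hlin: "linear H"
    by (intro linearI; rule g_eqI) (simp_all add: H[symmetric] g_simps L_simps)
  have Hcomm: "H (A x) = A (H x)" for x
    by (rule g_eqI) (simp add: H[symmetric] A_selfadjoint L_A_commute)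
  show ?thesis
  \<comment> \<open>In the first case a single cyclic vector suffices, since \<open>H\<close>
    commutes with \<open>A\<close> and is fixed by its value there. In the second case
    \<open>H x\<close> lies outside the span of \<open>x\<close> and \<open>A x\<close> for every
    cyclic \<open>x\<close>, and \<open>key\<close> says something about \<open>B\<close> at all of
    them.\<close>
  proof (cases "\<exists>x a b. cyclic_vector A x \<and> H x = a *\<^sub>R x + b *\<^sub>R A x")
    case True
    then obtain x a b where x: "cyclic_vector A x" "H x = a *\<^sub>R x + b *\<^sub>R A x" by blast
    interpret x: metric_operator g A x
      by (intro metric_operator.intro metric_space_form_axioms metric_operator_axioms.intro A_linear A_selfadjoint x(1) dim6)
    have "H y = a *\<^sub>R y + b *\<^sub>R A y" for y
      by (rule x.commuting_eq_pencil[OF Hlin Hcomm x(2)])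
    then have "L y z = a * g y z - (- b) * g (A y) z" for y z by (simp add: H g_simps)
    then show ?thesis using constant_type_if_L_pencil by blast
  next
    case False
    have "\<exists>a b. B x = a *\<^sub>R x + b *\<^sub>R A x" if x: "cyclic_vector A x" for x
    proof -
      have "\<exists>z. g x z = 0 \<and> g (A x) z = 0 \<and> g (H x) z \<noteq> 0"
        using mem_span_pair_if_annihilated[of x "A x" "H x"] False x by blast
      then obtain z where z: "g x z = 0" "g (A x) z = 0" "g (H x) z \<noteq> 0" by blast
      have prod: "g (H x) y * g (B x) y = 0" if "g x y = 0" "g (A x) y = 0" for y
        using key[of x y] that by (simp add: H)
      \<comment> \<open>On the annihilator of \<open>x\<close> and \<open>A x\<close> the product of
        two linear forms vanishes, and the first is nonzero at \<open>z\<close>; evaluation at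
        \<open>y\<close>, \<open>z\<close> and \<open>y + z\<close> kills the second.\<close>
      have "g (B x) y = 0" if y: "g x y = 0" "g (A x) y = 0" for y
        using prod[OF y] prod[OF z(1,2)] prod[of "y + z"] z y by (auto simp: g_simps)
      then show ?thesis by (intro mem_span_pair_if_annihilated)
    qed
    then show ?thesis using pencil_if_cyclic_vectors[OF dim6 A_linear B cyclic] by blast
  qed
qed

end

subsection \<open>Cyclic vectors from the Jordan normal form\<close>

notation Matrix.vec_index (infixl \<open>$v\<close> 100)

text \<open>Composition with \<open>[:a, 1:]\<close> is the Taylor shift to \<open>a\<close>. Its
  binomial coefficients are those in the powers of a Jordan block with eigenvalue
  \<open>a\<close>.\<close>

lemma coeff_pcompose_linear:
  fixes a :: "'a::comm_ring_1"
  shows "coeff (pcompose (\<Sum>k<N. monom (c k) k) [:a, 1:]) m = (\<Sum>k<N. c k * (of_nat (k choose m) * a ^ (k - m)))"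
proof -
  have "coeff ([:a, 1:] ^ k) m = of_nat (k choose m) * a ^ (k - m)" for k
  proof (cases "m \<le> k")
    case False
    moreover have "degree ([:a, 1:] ^ k) \<le> k" using degree_power_le[of "[:a, 1:]" k] by simp
    ultimately show ?thesis by (simp add: binomial_eq_0 coeff_eq_0)
  qed (simp add: coeff_linear_poly_power)
  then show ?thesis
    by (simp add: pcompose_sum coeff_sum monom_altdef pcompose_smult pcompose_hom.hom_power)
qed

lemma jordan_block_dvd:
  fixes a :: complex
  assumes "\<And>i. i < n \<Longrightarrow> (\<Sum>k<N. c k * (((jordan_block n a ^\<^sub>m k) *\<^sub>v unit_vec n (n - 1)) $v i)) = 0"
  shows "[:- a, 1:] ^ n dvd (\<Sum>k<N. monom (c k) k)"
proof -
  let ?p = "\<Sum>k<N. monom (c k) k"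
  \<comment> \<open>In the last column of the \<open>k\<close>-th power, row
    \<open>n - 1 - m\<close> holds the \<open>m\<close>-th Taylor coefficient at \<open>a\<close> of
    the \<open>k\<close>-th monomial.\<close>
  have "coeff (pcompose ?p [:a, 1:]) m = 0" if m: "m < n" for m
  proof -
    have "((jordan_block n a ^\<^sub>m k) *\<^sub>v unit_vec n (n - 1)) $v (n - 1 - m) = of_nat (k choose m) * a ^ (k - m)" for k
    proof -
      have "jordan_block n a ^\<^sub>m k \<in> carrier_mat n n" by simp
      then have "((jordan_block n a ^\<^sub>m k) *\<^sub>v unit_vec n (n - 1)) $v (n - 1 - m) = (jordan_block n a ^\<^sub>m k) $$ (n - 1 - m, n - 1)"
        using m by simp
      then show ?thesis using m by (simp add: jordan_block_pow Suc_diff_Suc diff_le_mono2)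
    qed
    then show ?thesis using assms[of "n - 1 - m"] m by (simp add: coeff_pcompose_linear)
  qed
  then have "monom 1 n dvd pcompose ?p [:a, 1:]" by (simp add: monom_1_dvd_iff')
  then obtain q where "pcompose ?p [:a, 1:] = monom 1 n * q" by (rule dvdE)
  then have "pcompose (pcompose ?p [:a, 1:]) [:- a, 1:] = pcompose (monom 1 n * q) [:- a, 1:]" by simp
  moreover have "pcompose (pcompose ?p [:a, 1:]) [:- a, 1:] = ?p"
    by (simp add: pcompose_assoc[symmetric] pcompose_pCons)
  moreover have "pcompose (monom 1 n * q) [:- a, 1:] = [:- a, 1:] ^ n * pcompose q [:- a, 1:]"
    by (simp add: pcompose_mult monom_altdef pcompose_hom.hom_power)
  ultimately show ?thesis by simp
qed

lemma coprime_linear_prod_list: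
  fixes a :: complex
  assumes "a \<notin> snd ` set n_as"
  shows "coprime ([:- a, 1:] ^ n) (\<Prod>(n, b)\<leftarrow>n_as. [:- b, 1:] ^ n)"
  using assms
proof (induction n_as)
  case (Cons nb n_as)
  obtain m b where nb: "nb = (m, b)" by force
  have "coprime [:- a, 1:] [:- b, 1:]"
  proof (rule coprimeI)
    fix d assume "d dvd [:- a, 1:]" "d dvd [:- b, 1:]"
    then have "d dvd [:- a, 1:] - [:- b, 1:]" by (rule dvd_diff)
    then have "d dvd [:b - a:]" by simp
    moreover have "b - a \<noteq> 0" using Cons.prems nb by auto
    ultimately show "is_unit d" using dvd_unit_imp_unit is_unit_const_poly_iff by (metis dvd_field_iff)
  qed
  then have "coprime ([:- a, 1:] ^ n) ([:- b, 1:] ^ m)" by simp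
  then show ?case using Cons nb by simp
qed simp

text \<open>Taylor expansion at an eigenvalue: \<open>p(J)\<close> annihilates the last basis vector of a Jordan block of
  size \<open>n\<close> only if \<open>p\<close> is divisible by the \<open>n\<close>-th power of the corresponding linear factor.\<close>

lemma jordan_matrix_krylov:
  fixes n_as :: "(nat \<times> complex) list"
  assumes "0 \<notin> fst ` set n_as" "distinct (map snd n_as)"
  shows "\<exists>v\<in>carrier_vec (sum_list (map fst n_as)). \<forall>N c.
     (\<forall>i<sum_list (map fst n_as). (\<Sum>k<N. c k * ((jordan_matrix n_as ^\<^sub>m k) *\<^sub>v v) $v i) = 0) \<longrightarrow>
     (\<Prod>(n, a)\<leftarrow>n_as. [:- a, 1:] ^ n) dvd (\<Sum>k<N. monom (c k) k)"
  using assms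
proof (induction n_as)
  case Nil
  then show ?case by (intro bexI[of _ "0\<^sub>v 0"]) auto
next
  case (Cons na n_as)
  obtain n a where na: "na = (n, a)" by force
  let ?s = "sum_list (map fst n_as)"
  obtain v where v: "v \<in> carrier_vec ?s" and dv: "\<And>N c. (\<And>i. i < ?s \<Longrightarrow> (\<Sum>k<N. c k * ((jordan_matrix n_as ^\<^sub>m k) *\<^sub>v v) $v i) = 0)
     \<Longrightarrow> (\<Prod>(n, a)\<leftarrow>n_as. [:- a, 1:] ^ n) dvd (\<Sum>k<N. monom (c k) k)"
    using Cons by auto
  define u :: "complex Matrix.vec" where "u = unit_vec n (n - 1)"
  have u: "u \<in> carrier_vec n" by (simp add: u_def)
  have pow: "(jordan_matrix (na # n_as) ^\<^sub>m k) *\<^sub>v (u @\<^sub>v v) = (jordan_block n a ^\<^sub>m k *\<^sub>v u) @\<^sub>v (jordan_matrix n_as ^\<^sub>m k *\<^sub>v v)" for k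
    unfolding na jordan_matrix_Cons
    by (subst pow_four_block_mat[OF jordan_block_carrier jordan_matrix_carrier], rule mult_mat_vec_split) (use u v in auto)
  show ?case
  proof (intro bexI[of _ "u @\<^sub>v v"] allI impI)
    fix N c assume *: "\<forall>i<sum_list (map fst (na # n_as)). (\<Sum>k<N. c k * ((jordan_matrix (na # n_as) ^\<^sub>m k) *\<^sub>v (u @\<^sub>v v)) $v i) = 0"
    have "(\<Sum>k<N. c k * ((jordan_block n a ^\<^sub>m k) *\<^sub>v u) $v i) = 0" if "i < n" for i
      using *[rule_format, of i] that unfolding pow by (simp add: na)
    then have 1: "[:- a, 1:] ^ n dvd (\<Sum>k<N. monom (c k) k)"
      unfolding u_def by (rule jordan_block_dvd)
    have "(\<Sum>k<N. c k * ((jordan_matrix n_as ^\<^sub>m k) *\<^sub>v v) $v i) = 0" if "i < ?s" for i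
      using *[rule_format, of "n + i"] that unfolding pow by (simp add: na)
    then have 2: "(\<Prod>(n, a)\<leftarrow>n_as. [:- a, 1:] ^ n) dvd (\<Sum>k<N. monom (c k) k)" by (rule dv)
    \<comment> \<open>Distinct eigenvalues enter here: coprime divisors may be multiplied. With a
      repeated eigenvalue only the larger power would divide.\<close>
    have "coprime ([:- a, 1:] ^ n) (\<Prod>(n, b)\<leftarrow>n_as. [:- b, 1:] ^ n)"
      using Cons.prems na by (intro coprime_linear_prod_list) auto
    then show "(\<Prod>(n, a)\<leftarrow>na # n_as. [:- a, 1:] ^ n) dvd (\<Sum>k<N. monom (c k) k)"
      using divides_mult[OF 1 2] na by simp
  qed (use u v na in auto)
qed

text \<open>A dependence among the first \<open>n\<close> Krylov vectors is a polynomial of degree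
  below \<open>n\<close>, but it is divisible by a product of linear factors of degree
  \<open>n\<close>. The vector found for the Jordan matrix is carried over by the similarity
  \<open>P\<close>.\<close>

lemma jordan_nf_krylov:
  fixes B :: "complex mat"
  assumes B: "B \<in> carrier_mat n n" and jnf: "jordan_nf B n_as" and dist: "distinct (map snd n_as)"
  shows "\<exists>v\<in>carrier_vec n. \<forall>c. (\<forall>i<n. (\<Sum>k<n. c k * ((B ^\<^sub>m k) *\<^sub>v v) $v i) = 0) \<longrightarrow> (\<forall>k<n. c k = 0)"
proof -
  let ?J = "jordan_matrix n_as"
  have dimB: "n = dim_row B" using B by simp
  obtain P Q where simw: "similar_mat_wit B ?J P Q" using jnf by (auto simp: jordan_nf_def similar_mat_def)
  note D = similar_mat_witD[OF dimB simw]
  have n: "sum_list (map fst n_as) = n" using carrier_matD(1)[OF D(5)] by simp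
  have "0 \<notin> fst ` set n_as" using jnf by (simp add: jordan_nf_def)
  from jordan_matrix_krylov[OF this dist] obtain v where v: "v \<in> carrier_vec n"
    and dv: "\<And>c. (\<And>i. i < n \<Longrightarrow> (\<Sum>k<n. c k * ((?J ^\<^sub>m k) *\<^sub>v v) $v i) = 0)
     \<Longrightarrow> (\<Prod>(n, a)\<leftarrow>n_as. [:- a, 1:] ^ n) dvd (\<Sum>k<n. monom (c k) k)"
    unfolding n by blast
  have Jk: "?J ^\<^sub>m k \<in> carrier_mat n n" for k using D(5) by simp
  have Jv: "?J ^\<^sub>m k *\<^sub>v v \<in> carrier_vec n" for k using Jk v by (rule mult_mat_vec_carrier)
  have Bk: "(B ^\<^sub>m k) *\<^sub>v (P *\<^sub>v v) = P *\<^sub>v (?J ^\<^sub>m k *\<^sub>v v)" for k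
  proof -
    have "B ^\<^sub>m k = P * ?J ^\<^sub>m k * Q" by (rule similar_mat_wit_pow_id[OF simw])
    then have "(B ^\<^sub>m k) *\<^sub>v (P *\<^sub>v v) = (P * ?J ^\<^sub>m k) *\<^sub>v (Q *\<^sub>v (P *\<^sub>v v))"
      using D(1,2,6,7) Jk v by (simp add: assoc_mult_mat_vec[of _ n n _ n])
    also have "Q *\<^sub>v (P *\<^sub>v v) = v" using D(1,2,6,7) v by (simp add: assoc_mult_mat_vec[symmetric, of _ n n _ n])
    finally show ?thesis using D(1,2,6,7) Jk v by (simp add: assoc_mult_mat_vec[of _ n n _ n])
  qed
  show ?thesis
  proof (intro bexI[of _ "P *\<^sub>v v"] allI impI)
    show "P *\<^sub>v v \<in> carrier_vec n" using D(1,2,6,7) v by simp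
    fix c k assume c: "\<forall>i<n. (\<Sum>k<n. c k * ((B ^\<^sub>m k) *\<^sub>v (P *\<^sub>v v)) $v i) = 0" and k: "k < n"
    define w where "w = Matrix.vec n (\<lambda>j. \<Sum>k<n. c k * (?J ^\<^sub>m k *\<^sub>v v) $v j)"
    have wc: "w \<in> carrier_vec n" by (simp add: w_def)
    have Pu: "(P *\<^sub>v u) $v i = (\<Sum>j<n. P $$ (i, j) * u $v j)" if "u \<in> carrier_vec n" "i < n" for u i
      using that carrier_matD[OF D(6)] carrier_vecD[OF that(1)] by (simp add: scalar_prod_def atLeast0LessThan)
    have "P *\<^sub>v w = 0\<^sub>v n"
    proof (rule eq_vecI)
      show "dim_vec (P *\<^sub>v w) = dim_vec (0\<^sub>v n)" using carrier_matD[OF D(6)] by simp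
      fix i assume "i < dim_vec (0\<^sub>v n :: complex Matrix.vec)"
      then have i: "i < n" by simp
      have "(P *\<^sub>v w) $v i = (\<Sum>j<n. P $$ (i, j) * (\<Sum>k<n. c k * (?J ^\<^sub>m k *\<^sub>v v) $v j))"
        using Pu[OF wc i] by (simp add: w_def)
      also have "\<dots> = (\<Sum>k<n. c k * (\<Sum>j<n. P $$ (i, j) * (?J ^\<^sub>m k *\<^sub>v v) $v j))"
        by (simp add: sum_distrib_left mult.left_commute) (rule sum.swap)
      also have "\<dots> = (\<Sum>k<n. c k * (P *\<^sub>v (?J ^\<^sub>m k *\<^sub>v v)) $v i)"
        by (simp add: Pu[OF Jv i])
      also have "\<dots> = 0" using c i by (simp add: Bk)
      finally show "(P *\<^sub>v w) $v i = 0\<^sub>v n $v i" using i by simp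
    qed
    then have "Q *\<^sub>v (P *\<^sub>v w) = Q *\<^sub>v 0\<^sub>v n" by simp
    also have "\<dots> = 0\<^sub>v n" using carrier_matD[OF D(7)] by (intro eq_vecI) (auto simp: scalar_prod_def)
    finally have "Q *\<^sub>v (P *\<^sub>v w) = 0\<^sub>v n" .
    moreover have "Q *\<^sub>v (P *\<^sub>v w) = w"
      using D(2,6,7) by (simp add: assoc_mult_mat_vec[symmetric, of _ n n _ n] w_def)
    ultimately have w0: "w = 0\<^sub>v n" by simp
    have "(\<Sum>k<n. c k * (?J ^\<^sub>m k *\<^sub>v v) $v i) = 0" if "i < n" for i
      using arg_cong[OF w0, of "\<lambda>w. w $v i"] that by (simp add: w_def)
    then have dvd: "(\<Prod>(n, a)\<leftarrow>n_as. [:- a, 1:] ^ n) dvd (\<Sum>k<n. monom (c k) k)" by (rule dv)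
    have deg: "degree (\<Prod>(n, a)\<leftarrow>n_as. [:- a, 1:] ^ n) = sum_list (map fst n_as) \<and> (\<Prod>(n, a)\<leftarrow>n_as. [:- a, 1:] ^ n) \<noteq> 0"
      by (induction n_as) (auto simp: degree_mult_eq degree_power_eq)
    have "(\<Sum>k<n. monom (c k) k) = 0"
    proof (rule ccontr)
      assume nz: "(\<Sum>k<n. monom (c k) k) \<noteq> 0"
      have "n \<le> degree (\<Sum>k<n. monom (c k) k)"
        using dvd_imp_degree_le[OF dvd nz] deg n by simp
      moreover have "degree (\<Sum>k<n. monom (c k) k) < n"
        using k by (intro degree_lessI) (auto simp: coeff_sum nz)
      ultimately show False by simp
    qed
    then have "coeff (\<Sum>k<n. monom (c k) k) k = 0" by simp
    then show "c k = 0" using k by (simp add: coeff_sum)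
  qed
qed

text \<open>For a complex cyclic vector \<open>X + \<i>Y\<close>, the Krylov determinant of \<open>X + tY\<close> is a polynomial in \<open>t\<close>
  that does not vanish at \<open>t = \<i>\<close>, hence not at some real \<open>t\<close>.\<close>

lemma cyclic_vector_if_distinct_bases:
  fixes M :: "real^'n^'n::finite"
  assumes "distinct_bases M"
  shows "\<exists>e. cyclic_vector ((*v) M) e"
proof -
  define n where "n = CARD('n)"
  define f where "f = (from_nat_into UNIV :: nat \<Rightarrow> 'n)"
  have f: "bij_betw f {..<n} UNIV"
    using bij_betw_from_nat_into_finite[of "UNIV :: 'n set"] by (simp add: f_def n_def)
  let ?B = "complex_mat M"
  have B: "?B \<in> carrier_mat n n" by (simp add: complex_mat_def n_def)
  have Bij: "?B $$ (i, j) = complex_of_real (M $ f i $ f j)" if "i < n" "j < n" for i j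
    using that by (simp add: complex_mat_def n_def f_def)
  obtain n_as where "jordan_nf ?B n_as" "distinct (map snd n_as)"
    using assms by (auto simp: distinct_bases_def)
  from jordan_nf_krylov[OF B this] obtain v where v: "v \<in> carrier_vec n"
    and cyc: "\<And>c k. (\<And>i. i < n \<Longrightarrow> (\<Sum>k<n. c k * ((?B ^\<^sub>m k) *\<^sub>v v) $v i) = 0) \<Longrightarrow> k < n \<Longrightarrow> c k = 0" by blast
  define cv where "cv X Y = Matrix.vec n (\<lambda>i. complex_of_real (X $ f i) + \<i> * complex_of_real (Y $ f i))" for X Y :: "real^'n"
  define g where "g = the_inv_into {..<n} f"
  define X where "X = (\<chi> j. Re (v $v g j))"
  define Y where "Y = (\<chi> j. Im (v $v g j))"
  have gf: "g (f i) = i" if "i < n" for i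
    using f that by (simp add: g_def bij_betw_def the_inv_into_f_f)
  have vcv: "v = cv X Y"
    using v by (intro eq_vecI) (auto simp: cv_def X_def Y_def gf complex_eq[symmetric])
  have step: "?B *\<^sub>v cv X Y = cv (M *v X) (M *v Y)" for X Y
  proof (rule eq_vecI)
    show "dim_vec (?B *\<^sub>v cv X Y) = dim_vec (cv (M *v X) (M *v Y))" using B by (simp add: cv_def)
    fix i assume "i < dim_vec (cv (M *v X) (M *v Y))"
    then have i: "i < n" by (simp add: cv_def)
    have re: "(M *v Z) $ f i = (\<Sum>j<n. M $ f i $ f j * Z $ f j)" for Z
      by (simp add: matrix_vector_mult_def sum.reindex_bij_betw[OF f, symmetric])
    have "(?B *\<^sub>v cv X Y) $v i = (\<Sum>j<n. complex_of_real (M $ f i $ f j) * (complex_of_real (X $ f j) + \<i> * complex_of_real (Y $ f j)))"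
      using i B by (simp add: scalar_prod_def atLeast0LessThan cv_def Bij)
    also have "\<dots> = cv (M *v X) (M *v Y) $v i"
      using i by (simp add: cv_def re distrib_left sum.distrib sum_distrib_left mult.left_commute)
    finally show "(?B *\<^sub>v cv X Y) $v i = cv (M *v X) (M *v Y) $v i" .
  qed
  have cvc: "cv X Y \<in> carrier_vec n" for X Y by (simp add: cv_def)
  have pow: "(?B ^\<^sub>m k) *\<^sub>v cv X Y = cv ((((*v) M) ^^ k) X) ((((*v) M) ^^ k) Y)" for k X Y
  proof (induction k arbitrary: X Y)
    case 0
    then show ?case using cvc B by simp
  next
    case (Suc k)
    have "(?B ^\<^sub>m Suc k) *\<^sub>v cv X Y = (?B ^\<^sub>m k) *\<^sub>v (?B *\<^sub>v cv X Y)"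
      using B cvc by (simp add: assoc_mult_mat_vec[of _ n n _ n])
    then show ?case by (simp add: step Suc funpow_swap1)
  qed
  define K where "K = Matrix.mat n n (\<lambda>(i, k). [:complex_of_real ((((*v) M) ^^ k) X $ f i), complex_of_real ((((*v) M) ^^ k) Y $ f i):])"
  define Kt where "Kt t = Matrix.mat n n (\<lambda>(i, k). complex_of_real ((((*v) M) ^^ k) X $ f i) + t * complex_of_real ((((*v) M) ^^ k) Y $ f i))" for t
  have Kc: "K \<in> carrier_mat n n" "Kt t \<in> carrier_mat n n" for t by (simp_all add: K_def Kt_def)
  have det: "poly (Determinant.det K) t = Determinant.det (Kt t)" for t
    by (rule poly_det_cong[OF Kc(2) Kc(1)]) (simp add: K_def Kt_def)
  have Ktw: "(Kt t *\<^sub>v w) $v i = (\<Sum>k<n. w $v k * (complex_of_real ((((*v) M) ^^ k) X $ f i) + t * complex_of_real ((((*v) M) ^^ k) Y $ f i)))"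
    if "w \<in> carrier_vec n" "i < n" for t w i
    using that by (simp add: Kt_def scalar_prod_def atLeast0LessThan mult.commute)
  have "Determinant.det (Kt \<i>) \<noteq> 0"
  proof
    assume "Determinant.det (Kt \<i>) = 0"
    then obtain w where w: "w \<in> carrier_vec n" "w \<noteq> 0\<^sub>v n" "Kt \<i> *\<^sub>v w = 0\<^sub>v n"
      using det_0_iff_vec_prod_zero_field[OF Kc(2)] by blast
    have "(\<Sum>k<n. w $v k * ((?B ^\<^sub>m k) *\<^sub>v v) $v i) = 0" if "i < n" for i
      using Ktw[OF w(1) that, of \<i>] w(3) that unfolding vcv pow by (simp add: cv_def)
    then have "w $v k = 0" if "k < n" for k using cyc[of "\<lambda>k. w $v k"] that by blast
    then have "w = 0\<^sub>v n" using w(1) by (intro eq_vecI) auto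
    then show False using w by simp
  qed
  then have "Determinant.det K \<noteq> 0" using det[of \<i>] by auto
  then have "finite {t. poly (Determinant.det K) t = 0}" by (rule poly_roots_finite)
  then have "finite (complex_of_real -` {t. poly (Determinant.det K) t = 0})"
    by (rule finite_vimageI) (auto intro: injI)
  then obtain t :: real where "poly (Determinant.det K) (complex_of_real t) \<noteq> 0"
    using ex_new_if_finite[OF infinite_UNIV_char_0] by auto
  then have dt: "Determinant.det (Kt (complex_of_real t)) \<noteq> 0" by (simp add: det)
  let ?e = "X + t *\<^sub>R Y"
  have pw: "((((*v) M) ^^ k) ?e) = (((*v) M) ^^ k) X + t *\<^sub>R (((*v) M) ^^ k) Y" for k
    using linear_funpow[OF matrix_vector_mul_linear[of M], of k] by (simp add: linear_add linear_cmul)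
  have "cyclic_vector ((*v) M) ?e"
    unfolding cyclic_vector_def
  proof (intro allI impI)
    fix c :: "nat \<Rightarrow> real" and k
    assume c: "(\<Sum>i<DIM(real^'n). c i *\<^sub>R (((*v) M) ^^ i) ?e) = 0" and k: "k < DIM(real^'n)"
    have dn: "DIM(real^'n) = n" by (simp add: n_def)
    define w where "w = Matrix.vec n (\<lambda>k. complex_of_real (c k))"
    have w: "w \<in> carrier_vec n" by (simp add: w_def)
    have "Kt (complex_of_real t) *\<^sub>v w = 0\<^sub>v n"
    proof (rule eq_vecI)
      fix i assume "i < dim_vec (0\<^sub>v n :: complex Matrix.vec)"
      then have i: "i < n" by simp
      have "(\<Sum>k<n. c k *\<^sub>R (((*v) M) ^^ k) ?e) $ f i = 0" using c unfolding dn by simp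
      then have "(\<Sum>k<n. c k * ((((*v) M) ^^ k) X $ f i + t * (((*v) M) ^^ k) Y $ f i)) = 0"
        by (simp add: pw)
      then have "complex_of_real (\<Sum>k<n. c k * ((((*v) M) ^^ k) X $ f i + t * (((*v) M) ^^ k) Y $ f i)) = 0" by simp
      then show "(Kt (complex_of_real t) *\<^sub>v w) $v i = 0\<^sub>v n $v i"
        using i by (simp add: Ktw[OF w i]) (simp add: w_def)
    qed (simp add: Kt_def)
    then have "w = 0\<^sub>v n" using det_0_iff_vec_prod_zero_field[OF Kc(2)] dt w by blast
    then have "w $v k = 0" using k dn by simp
    then show "c k = 0" using k dn by (simp add: w_def)
  qed
  then show ?thesis by blast
qed

subsection \<open>A metric in a chart\<close>

lemma matrix_vector_mult_minus: "(A :: real^'n^'m) *v (- x) = - (A *v x)"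
  using matrix_vector_mult_scaleR[of A "- 1" x] by simp

section \<open>Matrices as bilinear forms\<close>

definition form :: "real^'n^'n::finite \<Rightarrow> real^'n \<Rightarrow> real^'n \<Rightarrow> real" where
  "form M z w = z \<bullet> (M *v w)"

lemma form_simps:
  "form M (x + y) z = form M x z + form M y z" "form M z (x + y) = form M z x + form M z y"
  "form M (x - y) z = form M x z - form M y z" "form M z (x - y) = form M z x - form M z y"
  "form M (- x) z = - form M x z" "form M z (- x) = - form M z x"
  "form M (c *\<^sub>R x) z = c * form M x z" "form M z (c *\<^sub>R x) = c * form M z x"
  "form M 0 z = 0" "form M z 0 = 0"
  "form (M + N) x y = form M x y + form N x y" "form (M - N) x y = form M x y - form N x y"
  "form (c *\<^sub>R M) x y = c * form M x y" "form 0 x y = 0"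
  by (simp_all add: form_def inner_add_left inner_add_right inner_diff_left inner_diff_right
      matrix_vector_right_distrib matrix_vector_mult_diff_distrib matrix_vector_mult_add_rdistrib
      matrix_vector_mult_diff_rdistrib matrix_vector_mult_minus matrix_vector_mult_scaleR scaleR_matrix_vector_assoc[symmetric])

lemma bilinear_form: "bilinear (form M)"
  by (auto simp: bilinear_def intro!: linearI simp: form_simps)

lemma form_axis: "form M (axis i 1) (axis j 1) = M $ i $ j"
  by (simp add: form_def matrix_vector_mult_basis column_def inner_axis' )

lemma form_sum: "form M (\<Sum>i\<in>I. f i) z = (\<Sum>i\<in>I. form M (f i) z)" "form M z (\<Sum>i\<in>I. f i) = (\<Sum>i\<in>I. form M z (f i))"
  using bilinear_form[of M] linear_sum[of "\<lambda>x. form M x z"] linear_sum[of "form M z"] by (auto simp: bilinear_def)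

lemma form_sym: "transpose M = M \<Longrightarrow> form M x y = form M y x"
  by (metis dot_lmul_matrix form_def inner_commute transpose_matrix_vector)

lemma form_ext: "(\<And>i j. form M (axis i 1) (axis j 1) = form N (axis i 1) (axis j 1)) \<Longrightarrow> M = N"
  by (simp add: form_axis Finite_Cartesian_Product.vec_eq_iff)

lemma vec_expansion: "v = (\<Sum>i\<in>UNIV. v $ i *\<^sub>R axis i (1::real))"
  by (simp add: basis_expansion scalar_mult_eq_scaleR[symmetric])

lemma bilinear_expansion:
  fixes B :: "real^'n::finite \<Rightarrow> real^'m::finite \<Rightarrow> 'b::real_vector"
  assumes "bilinear B"
  shows "B v w = (\<Sum>i\<in>UNIV. \<Sum>j\<in>UNIV. (v $ i * w $ j) *\<^sub>R B (axis i 1) (axis j 1))"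
proof -
  have "B v w = B (\<Sum>i\<in>UNIV. v $ i *\<^sub>R axis i 1) (\<Sum>i\<in>UNIV. w $ i *\<^sub>R axis i 1)"
    by (simp only: vec_expansion[symmetric])
  also have "\<dots> = (\<Sum>i\<in>UNIV. \<Sum>j\<in>UNIV. (v $ i * w $ j) *\<^sub>R B (axis i 1) (axis j 1))"
    using assms by (simp add: bilinear_sum sum.cartesian_product bilinear_lmul bilinear_rmul)
  finally show ?thesis .
qed

lemma bounded_bilinear_matrix_vector: "bounded_bilinear (\<lambda>(M::real^'n^'m) x. M *v x)"
  by (rule bilinear_conv_bounded_bilinear[THEN iffD1])
    (auto simp: bilinear_def matrix_vector_right_distrib matrix_vector_mult_add_rdistrib
      matrix_vector_mult_scaleR scaleR_matrix_vector_assoc[symmetric] intro!: linearI)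

lemma differentiable_form:
  fixes M :: "'a::real_normed_vector \<Rightarrow> real^'n^'n::finite"
  assumes "M differentiable (at x)" "F differentiable (at x)" "K differentiable (at x)"
  shows "(\<lambda>y. form (M y) (F y) (K y)) differentiable (at x)"
  unfolding form_def
  by (intro differentiable_bounded_bilinear[OF bounded_bilinear_inner] differentiable_bounded_bilinear[OF bounded_bilinear_matrix_vector] assms)

lemma dd_form:
  fixes M :: "'a::real_normed_vector \<Rightarrow> real^'n^'n::finite"
  assumes "M differentiable (at x)" "F differentiable (at x)" "K differentiable (at x)"
  shows "dd v (\<lambda>y. form (M y) (F y) (K y)) x =
    form (dd v M x) (F x) (K x) + form (M x) (dd v F x) (K x) + form (M x) (F x) (dd v K x)"
  unfolding form_def
  using assms by (simp add: dd_bounded_bilinear[OF bounded_bilinear_inner] dd_bounded_bilinear[OF bounded_bilinear_matrix_vector]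
      differentiable_bounded_bilinear[OF bounded_bilinear_matrix_vector] inner_add_right)

lemma dd_form_const:
  fixes M :: "'a::real_normed_vector \<Rightarrow> real^'n^'n::finite"
  assumes "M differentiable (at x)"
  shows "dd v (\<lambda>y. form (M y) z w) x = form (dd v M x) z w"
  using dd_form[OF assms, of "\<lambda>_. z" "\<lambda>_. w"] by (simp add: form_simps)

lemma smooth_on_form:
  "open S \<Longrightarrow> smooth_on S M \<Longrightarrow> smooth_on S F \<Longrightarrow> smooth_on S K \<Longrightarrow> smooth_on S (\<lambda>y. form (M y) (F y) (K y))"
  unfolding form_def
  by (intro smooth_on_bounded_bilinear[OF bounded_bilinear_inner] smooth_on_bounded_bilinear[OF bounded_bilinear_matrix_vector])

lemma smooth_on_inner: "open S \<Longrightarrow> smooth_on S F \<Longrightarrow> smooth_on S K \<Longrightarrow> smooth_on S (\<lambda>y. F y \<bullet> K y)"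
  by (rule smooth_on_bounded_bilinear[OF bounded_bilinear_inner])

lemma smooth_on_matrix_vector: "open S \<Longrightarrow> smooth_on S M \<Longrightarrow> smooth_on S K \<Longrightarrow> smooth_on S (\<lambda>y. (M y :: real^'n^'m) *v K y)"
  by (rule smooth_on_bounded_bilinear[OF bounded_bilinear_matrix_vector])

lemma smooth_on_bilinear_family:
  fixes B :: "real^'n::finite \<Rightarrow> real^'m::finite \<Rightarrow> real^'k::finite \<Rightarrow> 'b::real_normed_vector"
  assumes S: "open S" and "\<And>x. x \<in> S \<Longrightarrow> bilinear (B x)" "\<And>i j. smooth_on S (\<lambda>x. B x (axis i 1) (axis j 1))"
    and "smooth_on S F" "smooth_on S K"
  shows "smooth_on S (\<lambda>x. B x (F x) (K x))"
proof (rule smooth_on_cong[OF S])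
  show "smooth_on S (\<lambda>x. \<Sum>i\<in>UNIV. \<Sum>j\<in>UNIV. (F x $ i * K x $ j) *\<^sub>R B x (axis i 1) (axis j 1))"
    using assms by (intro smooth_on_sum smooth_on_scaleR smooth_on_mult smooth_on_vec_nth)
  show "(\<Sum>i\<in>UNIV. \<Sum>j\<in>UNIV. (F x $ i * K x $ j) *\<^sub>R B x (axis i 1) (axis j 1)) = B x (F x) (K x)" if "x \<in> S" for x
    by (rule bilinear_expansion[OF assms(2)[OF that], symmetric])
qed

section \<open>Levi-Civita connection, curvature and Eisenhart equation in one chart\<close>

locale metric_chart =
  fixes S :: "(real^'n::finite) set" and G :: "real^'n \<Rightarrow> real^'n^'n"
  assumes S: "open S" and G_smooth: "smooth_on S G"
    and G_sym: "x \<in> S \<Longrightarrow> transpose (G x) = G x"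
    and G_det: "x \<in> S \<Longrightarrow> Determinants.det (G x) \<noteq> 0"
begin

text \<open>\<open>Gam x v w\<close> has the components \<open>\<Gamma>\<^sup>k\<^sub>i\<^sub>j v\<^sup>i w\<^sup>j\<close>, and \<open>up x k\<close> is the basis vector \<open>k\<close> with its index raised.\<close>

definition koszul :: "real^'n \<Rightarrow> real^'n \<Rightarrow> real^'n \<Rightarrow> real^'n \<Rightarrow> real" where
  "koszul x v w z = (form (dd v G x) w z + form (dd w G x) v z - form (dd z G x) v w) / 2"

definition Gam :: "real^'n \<Rightarrow> real^'n \<Rightarrow> real^'n \<Rightarrow> real^'n" where
  "Gam x v w = matrix_inv (G x) *v (\<chi> l. koszul x v w (axis l 1))"

definition up :: "real^'n \<Rightarrow> 'n \<Rightarrow> real^'n" where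
  "up x k = matrix_inv (G x) *v axis k 1"

text \<open>The arguments are vector fields with constant components in the chart, whose brackets
  vanish, so the bracket term of the curvature is absent.\<close>

definition Riem :: "real^'n \<Rightarrow> real^'n \<Rightarrow> real^'n \<Rightarrow> real^'n \<Rightarrow> real^'n" where
  "Riem x u v w = dd u (\<lambda>y. Gam y v w) x - dd v (\<lambda>y. Gam y u w) x + Gam x u (Gam x v w) - Gam x v (Gam x u w)"

lemma G_diff: "x \<in> S \<Longrightarrow> G differentiable (at x)"
  using G_smooth smooth_on_differentiable by blast

lemma inv_smooth: "smooth_on S (\<lambda>x. matrix_inv (G x))"
  using S G_smooth G_det by (rule smooth_on_matrix_inv)

lemma up_smooth: "smooth_on S (\<lambda>x. up x k)"
  unfolding up_def using S inv_smooth by (intro smooth_on_matrix_vector smooth_on_const)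

lemma G_inv: "x \<in> S \<Longrightarrow> G x *v (matrix_inv (G x) *v w) = w"
  using matrix_inv_works(1)[OF G_det] by (simp add: matrix_vector_mul_assoc)

lemma inv_G: "x \<in> S \<Longrightarrow> matrix_inv (G x) *v (G x *v w) = w"
  using matrix_inv_works(2)[OF G_det] by (simp add: matrix_vector_mul_assoc)

lemma g_up: "x \<in> S \<Longrightarrow> form (G x) z (up x k) = z $ k"
  by (simp add: form_def up_def G_inv inner_axis)

lemma g_sym: "x \<in> S \<Longrightarrow> form (G x) v w = form (G x) w v"
  using G_sym form_sym by blast

text \<open>\<open>axis k 1\<close> and \<open>up x k\<close> are dual bases for the metric. Here
  and in \<open>contract_2\<close> a vector is expanded in one of them; all traces below are sums
  over this pair.\<close>

lemma contract_1: "x \<in> S \<Longrightarrow> linear f \<Longrightarrow> (\<Sum>k\<in>UNIV. f (axis k 1) * form (G x) u (up x k)) = f u"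
  for f :: "real^'n \<Rightarrow> real"
proof -
  assume x: "x \<in> S" and f: "linear f"
  have "f u = f (\<Sum>k\<in>UNIV. u $ k *\<^sub>R axis k 1)" by (simp only: vec_expansion[symmetric])
  then show ?thesis by (simp add: g_up[OF x] linear_sum[OF f] linear_cmul[OF f] mult.commute)
qed

lemma contract_2: "x \<in> S \<Longrightarrow> linear f \<Longrightarrow> (\<Sum>k\<in>UNIV. f (up x k) * form (G x) (axis k 1) u) = f u"
  for f :: "real^'n \<Rightarrow> real"
proof -
  assume x: "x \<in> S" and f: "linear f"
  have "u = matrix_inv (G x) *v (\<Sum>k\<in>UNIV. (G x *v u) $ k *\<^sub>R axis k 1)"
    by (simp only: vec_expansion[symmetric] inv_G[OF x])
  also have "\<dots> = (\<Sum>k\<in>UNIV. form (G x) (axis k 1) u *\<^sub>R up x k)"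
    by (simp add: linear_sum[OF matrix_vector_mul_linear] matrix_vector_mult_scaleR up_def form_def inner_axis')
  finally have "f u = f (\<Sum>k\<in>UNIV. form (G x) (axis k 1) u *\<^sub>R up x k)" by simp
  then show ?thesis by (simp add: linear_sum[OF f] linear_cmul[OF f] mult.commute)
qed

lemma contract_g: "x \<in> S \<Longrightarrow> (\<Sum>k\<in>UNIV. form (G x) (axis k 1) (up x k)) = CARD('n)"
  by (simp add: g_up)

lemma form_nondeg: "x \<in> S \<Longrightarrow> (\<And>w. form (G x) z w = 0) \<Longrightarrow> z = 0"
  using g_up[of x z] by (simp add: Finite_Cartesian_Product.vec_eq_iff)

lemma metric_space_form: "x \<in> S \<Longrightarrow> metric_space_form (form (G x))"
  using form_nondeg g_sym bilinear_form by unfold_locales blast+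

lemma form_eqI: "x \<in> S \<Longrightarrow> (\<And>w. form (G x) y w = form (G x) z w) \<Longrightarrow> y = z"
  using form_nondeg[of x "y - z"] by (simp add: form_simps)

lemma dG_sym: "x \<in> S \<Longrightarrow> form (dd v G x) w z = form (dd v G x) z w"
  using dd_cong[OF S, of x "\<lambda>y. form (G y) w z" "\<lambda>y. form (G y) z w" v] g_sym
  by (simp add: dd_form_const G_diff)

lemma koszul_linear:
  assumes "x \<in> S"
  shows "koszul x (u + v) w z = koszul x u w z + koszul x v w z" "koszul x (c *\<^sub>R v) w z = c * koszul x v w z"
    "koszul x w (u + v) z = koszul x w u z + koszul x w v z" "koszul x w (c *\<^sub>R v) z = c * koszul x w v z"
    "koszul x w z (u + v) = koszul x w z u + koszul x w z v" "koszul x w z (c *\<^sub>R v) = c * koszul x w z v"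
  using G_diff[OF assms] by (simp_all add: koszul_def dd_direction_simps form_simps field_simps)

lemma g_Gam: "x \<in> S \<Longrightarrow> form (G x) (Gam x v w) z = koszul x v w z"
proof -
  assume x: "x \<in> S"
  have "form (G x) (Gam x v w) z = form (G x) z (Gam x v w)" by (rule g_sym[OF x])
  also have "\<dots> = z \<bullet> (\<chi> l. koszul x v w (axis l 1))"
    by (simp add: form_def Gam_def G_inv[OF x])
  also have "\<dots> = (\<Sum>l\<in>UNIV. koszul x v w (z $ l *\<^sub>R axis l 1))"
    by (simp add: inner_vec_def koszul_linear[OF x])
  also have "\<dots> = koszul x v w (\<Sum>l\<in>UNIV. z $ l *\<^sub>R axis l 1)"
    by (rule linear_sum[symmetric]) (auto intro!: linearI simp: koszul_linear[OF x])
  finally show ?thesis by (simp only: vec_expansion[symmetric])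
qed

lemma Gam_sym: "x \<in> S \<Longrightarrow> Gam x v w = Gam x w v"
  by (rule form_eqI) (auto simp: g_Gam koszul_def dG_sym)

lemma Gam_simps:
  assumes "x \<in> S"
  shows "Gam x (u + v) w = Gam x u w + Gam x v w" "Gam x (c *\<^sub>R v) w = c *\<^sub>R Gam x v w"
    "Gam x w (u + v) = Gam x w u + Gam x w v" "Gam x w (c *\<^sub>R v) = c *\<^sub>R Gam x w v"
    "Gam x w (u - v) = Gam x w u - Gam x w v"
proof -
  show 1: "Gam x (u + v) w = Gam x u w + Gam x v w" for u v w
    by (rule form_eqI[OF assms]) (simp add: g_Gam koszul_linear form_simps assms)
  show 2: "Gam x (c *\<^sub>R v) w = c *\<^sub>R Gam x v w" for c v w
    by (rule form_eqI[OF assms]) (simp add: g_Gam koszul_linear form_simps assms)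
  show 3: "Gam x w (u + v) = Gam x w u + Gam x w v" "Gam x w (c *\<^sub>R v) = c *\<^sub>R Gam x w v" for u v c
    using 1 2 Gam_sym[OF assms] by metis+
  show "Gam x w (u - v) = Gam x w u - Gam x w v"
    using 3(1)[of u "- v"] 3(2)[of "-1" v] by simp
qed

lemma Gam_bilinear: "x \<in> S \<Longrightarrow> bilinear (Gam x)"
  by (auto simp: bilinear_def Gam_simps intro!: linearI)

lemma dG: "x \<in> S \<Longrightarrow> form (dd u G x) z w = form (G x) (Gam x u z) w + form (G x) z (Gam x u w)"
  using g_sym[of x z "Gam x u w"] dG_sym[of x] by (simp add: g_Gam koszul_def field_simps)

lemma Gam_smooth: "smooth_on S F \<Longrightarrow> smooth_on S K \<Longrightarrow> smooth_on S (\<lambda>y. Gam y (F y) (K y))"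
proof (rule smooth_on_bilinear_family[OF S Gam_bilinear])
  fix i j
  have "smooth_on S (\<lambda>x. koszul x v w z)" for v w z
    unfolding koszul_def using S G_smooth
    by (intro smooth_on_divide smooth_on_add smooth_on_diff smooth_on_form smooth_on_const smooth_on_dd) auto
  then have "smooth_on S (\<lambda>x. \<chi> l. koszul x (axis i 1) (axis j 1) (axis l 1))"
    using S by (intro smooth_on_vecI) simp_all
  then show "smooth_on S (\<lambda>x. Gam x (axis i 1) (axis j 1))"
    unfolding Gam_def using S inv_smooth by (intro smooth_on_matrix_vector)
qed auto

lemma Gam_diff: "x \<in> S \<Longrightarrow> (\<lambda>y. Gam y v w) differentiable (at x)"
  using Gam_smooth[OF smooth_on_const smooth_on_const] smooth_on_differentiable by blast

lemma dd_Gam_simps: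
  assumes x: "x \<in> S"
  shows "dd z (\<lambda>y. Gam y (u + v) w) x = dd z (\<lambda>y. Gam y u w) x + dd z (\<lambda>y. Gam y v w) x"
    "dd z (\<lambda>y. Gam y (c *\<^sub>R v) w) x = c *\<^sub>R dd z (\<lambda>y. Gam y v w) x"
    "dd z (\<lambda>y. Gam y w (u + v)) x = dd z (\<lambda>y. Gam y w u) x + dd z (\<lambda>y. Gam y w v) x"
    "dd z (\<lambda>y. Gam y w (c *\<^sub>R v)) x = c *\<^sub>R dd z (\<lambda>y. Gam y w v) x"
proof -
  have a: "dd z (\<lambda>y. Gam y u w + Gam y v w) x = dd z (\<lambda>y. Gam y u w) x + dd z (\<lambda>y. Gam y v w) x" for u v w
    by (rule dd_add) (rule Gam_diff[OF x])+
  have b: "dd z (\<lambda>y. c *\<^sub>R Gam y v w) x = c *\<^sub>R dd z (\<lambda>y. Gam y v w) x" for c v w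
    by (rule dd_bounded_linear[OF bounded_linear_scaleR_right Gam_diff[OF x]])
  show "dd z (\<lambda>y. Gam y (u + v) w) x = dd z (\<lambda>y. Gam y u w) x + dd z (\<lambda>y. Gam y v w) x"
    by (subst a[symmetric], rule dd_cong[OF S x]) (simp add: Gam_simps)
  show "dd z (\<lambda>y. Gam y (c *\<^sub>R v) w) x = c *\<^sub>R dd z (\<lambda>y. Gam y v w) x"
    by (subst b[symmetric], rule dd_cong[OF S x]) (simp add: Gam_simps)
  show "dd z (\<lambda>y. Gam y w (u + v)) x = dd z (\<lambda>y. Gam y w u) x + dd z (\<lambda>y. Gam y w v) x"
  proof -
    have "dd z (\<lambda>y. Gam y w (u + v)) x = dd z (\<lambda>y. Gam y w u + Gam y w v) x"
      by (rule dd_cong[OF S x]) (simp add: Gam_simps)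
    also have "\<dots> = dd z (\<lambda>y. Gam y w u) x + dd z (\<lambda>y. Gam y w v) x"
      by (rule dd_add) (rule Gam_diff[OF x])+
    finally show ?thesis .
  qed
  show "dd z (\<lambda>y. Gam y w (c *\<^sub>R v)) x = c *\<^sub>R dd z (\<lambda>y. Gam y w v) x"
    by (subst b[symmetric], rule dd_cong[OF S x]) (simp add: Gam_simps)
qed

lemma Riem_linear:
  assumes x: "x \<in> S"
  shows "linear (Riem x u v)" "linear (\<lambda>v. Riem x u v w)" "linear (\<lambda>u. Riem x u v w)"
  unfolding Riem_def
  by (intro linearI; simp add: dd_Gam_simps[OF x] Gam_simps[OF x] dd_direction_simps[OF Gam_diff[OF x]] algebra_simps)+

lemma Riem_skew: "Riem x u v w = - Riem x v u w"
  by (simp add: Riem_def)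

lemma Riem_bianchi: "x \<in> S \<Longrightarrow> Riem x u v w + Riem x v w u + Riem x w u v = 0"
proof -
  assume x: "x \<in> S"
  have d: "dd z (\<lambda>y. Gam y v w) x = dd z (\<lambda>y. Gam y w v) x" for z v w
    by (rule dd_cong[OF S x Gam_sym])
  then show ?thesis
    by (simp add: Riem_def Gam_sym[OF x, of w u] Gam_sym[OF x, of v u] Gam_sym[OF x, of w v]
        d[of _ w u] d[of _ v u] d[of _ w v])
qed

lemma Riem_smooth: "smooth_on S (\<lambda>y. Riem y u v w)"
  unfolding Riem_def using S by (intro smooth_on_add smooth_on_diff smooth_on_dd Gam_smooth smooth_on_const)

lemma Riem_field_smooth: "smooth_on S F \<Longrightarrow> smooth_on S (\<lambda>y. Riem y u v (F y))"
proof (rule smooth_on_cong[OF S])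
  assume F: "smooth_on S F"
  show "smooth_on S (\<lambda>y. \<Sum>l\<in>UNIV. (F y $ l) *\<^sub>R Riem y u v (axis l 1))"
    using S F Riem_smooth by (intro smooth_on_sum smooth_on_scaleR smooth_on_vec_nth)
  show "(\<Sum>l\<in>UNIV. (F y $ l) *\<^sub>R Riem y u v (axis l 1)) = Riem y u v (F y)" if "y \<in> S" for y
  proof -
    have "Riem y u v (F y) = Riem y u v (\<Sum>l\<in>UNIV. (F y $ l) *\<^sub>R axis l 1)"
      by (simp only: vec_expansion[symmetric])
    then show ?thesis by (simp add: linear_sum[OF Riem_linear(1)[OF that]] linear_cmul[OF Riem_linear(1)[OF that]])
  qed
qed

text \<open>\<open>p\<close> is the coordinate gradient of the potential of \<open>H\<close>.\<close>

definition solution :: "(real^'n \<Rightarrow> real^'n^'n) \<Rightarrow> (real^'n \<Rightarrow> real^'n) \<Rightarrow> bool" where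
  "solution H p \<longleftrightarrow> smooth_on S H \<and> smooth_on S p \<and> (\<forall>x\<in>S. transpose (H x) = H x) \<and>
     (\<forall>x\<in>S. \<forall>u v. dd u p x \<bullet> v = dd v p x \<bullet> u) \<and>
     (\<forall>x\<in>S. \<forall>u z w. form (dd u H x) z w = form (H x) (Gam x u z) w + form (H x) z (Gam x u w)
        + 2 * (p x \<bullet> u) * form (G x) z w + (p x \<bullet> z) * form (G x) u w + (p x \<bullet> w) * form (G x) u z)"

lemma solutionD:
  assumes "solution H p"
  shows "smooth_on S H" "smooth_on S p" "x \<in> S \<Longrightarrow> transpose (H x) = H x" "x \<in> S \<Longrightarrow> dd u p x \<bullet> v = dd v p x \<bullet> u"
    "x \<in> S \<Longrightarrow> form (dd u H x) z w = form (H x) (Gam x u z) w + form (H x) z (Gam x u w)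
        + 2 * (p x \<bullet> u) * form (G x) z w + (p x \<bullet> z) * form (G x) u w + (p x \<bullet> w) * form (G x) u z"
  using assms by (auto simp: solution_def)

definition hess :: "(real^'n \<Rightarrow> real^'n) \<Rightarrow> real^'n \<Rightarrow> real^'n \<Rightarrow> real^'n \<Rightarrow> real" where
  "hess p x u v = dd u p x \<bullet> v - p x \<bullet> Gam x u v"

text \<open>Second derivatives of \<open>H\<close> commute, so the antisymmetric part of the
  differentiated Eisenhart equation contains only the curvature and the Hessian. The term with
  factor 2 drops out because \<open>p\<close> is closed.\<close>

lemma solution_ricci:
  assumes sol: "solution H p" and x: "x \<in> S"
  shows "form (H x) (Riem x u v z) w + form (H x) z (Riem x u v w)
    + (hess p x u z * form (G x) v w + hess p x u w * form (G x) v z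
       - hess p x v z * form (G x) u w - hess p x v w * form (G x) u z) = 0"
proof -
  note Hs = solutionD(1)[OF sol] and ps = solutionD(2)[OF sol] and closed = solutionD(4)[OF sol] and eq = solutionD(5)[OF sol]
  have Hd: "H differentiable (at x)" and pd: "p differentiable (at x)" and Gd: "G differentiable (at x)"
    using Hs ps x smooth_on_differentiable G_diff by blast+
  have second: "form (dd u (dd v H) x) z w =
      form (dd u H x) (Gam x v z) w + form (H x) (dd u (\<lambda>y. Gam y v z) x) w
      + (form (dd u H x) z (Gam x v w) + form (H x) z (dd u (\<lambda>y. Gam y v w) x))
      + (2 * (dd u p x \<bullet> v) * form (G x) z w + 2 * (p x \<bullet> v) * form (dd u G x) z w)
      + ((dd u p x \<bullet> z) * form (G x) v w + (p x \<bullet> z) * form (dd u G x) v w)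
      + ((dd u p x \<bullet> w) * form (G x) v z + (p x \<bullet> w) * form (dd u G x) v z)" for u v
  proof -
    have "form (dd u (dd v H) x) z w = dd u (\<lambda>y. form (dd v H y) z w) x"
      using S Hs x by (intro dd_form_const[symmetric] smooth_on_differentiable[OF smooth_on_dd])
    also have "\<dots> = dd u (\<lambda>y. form (H y) (Gam y v z) w + form (H y) z (Gam y v w)
        + 2 * (p y \<bullet> v) * form (G y) z w + (p y \<bullet> z) * form (G y) v w + (p y \<bullet> w) * form (G y) v z) x"
      by (rule dd_cong[OF S x eq])
    finally have e: "form (dd u (dd v H) x) z w = dd u (\<lambda>y. form (H y) (Gam y v z) w + form (H y) z (Gam y v w)
        + 2 * (p y \<bullet> v) * form (G y) z w + (p y \<bullet> z) * form (G y) v w + (p y \<bullet> w) * form (G y) v z) x" .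
      have t: "((\<lambda>y. c * (p y \<bullet> a) * form (G y) b d) has_derivative
           (\<lambda>u. c * (dd u p x \<bullet> a) * form (G x) b d + c * (p x \<bullet> a) * form (dd u G x) b d)) (at x)" for a b c d
      proof -
        have 1: "((\<lambda>y. p y \<bullet> a) has_derivative (\<lambda>u. dd u p x \<bullet> a)) (at x)"
          using has_derivative_dd[OF pd] by (intro has_derivative_inner_left)
        have "((\<lambda>y. form (G y) b d) has_derivative (\<lambda>u. dd u (\<lambda>y. form (G y) b d) x)) (at x)"
          by (intro has_derivative_dd differentiable_form Gd differentiable_const)
        then have 2: "((\<lambda>y. form (G y) b d) has_derivative (\<lambda>u. form (dd u G x) b d)) (at x)"
          by (simp add: dd_form_const[OF Gd])
        show ?thesis
          by (rule has_derivative_eq_rhs[OF has_derivative_mult[OF has_derivative_mult_right[OF 1] 2]]) (simp add: fun_eq_iff)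
      qed
      have h: "((\<lambda>y. form (H y) (F y) (K y)) has_derivative (\<lambda>u. form (dd u H x) (F x) (K x) + form (H x) (dd u F x) (K x) + form (H x) (F x) (dd u K x))) (at x)"
        if "F differentiable (at x)" "K differentiable (at x)" for F K
        using has_derivative_dd[OF differentiable_form[OF Hd that]] by (simp add: dd_form[OF Hd that])
      have h1: "((\<lambda>y. form (H y) (Gam y v z) w) has_derivative (\<lambda>u. form (dd u H x) (Gam x v z) w + form (H x) (dd u (\<lambda>y. Gam y v z) x) w)) (at x)"
        using h[OF Gam_diff[OF x] differentiable_const, of v z w] by (simp add: form_simps)
      have h2: "((\<lambda>y. form (H y) z (Gam y v w)) has_derivative (\<lambda>u. form (dd u H x) z (Gam x v w) + form (H x) z (dd u (\<lambda>y. Gam y v w) x))) (at x)"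
        using h[OF differentiable_const Gam_diff[OF x], of z v w] by (simp add: form_simps)
      show ?thesis
        unfolding e by (rule dd_eqI) (intro has_derivative_add h1 h2 t t[of 1, simplified])
  qed
  have "form (dd u (dd v H) x) z w = form (dd v (dd u H) x) z w"
    using dd_dd_commute[OF S x Hs] by simp
  then show ?thesis
    unfolding second eq[OF x] dG[OF x] Riem_def hess_def
    using closed[OF x, of u v] Gam_sym[OF x, of u v]
    by (simp add: form_simps inner_simps algebra_simps)
qed

end

subsection \<open>Unique continuation\<close>

text \<open>The module generated by \<open>F\<close> over the smooth functions on \<open>S\<close>,
  up to equality on \<open>S\<close>. The inductive form gives derivatives and bounds by rule
  induction, so no coefficient matrix is ever written down.\<close>

inductive lincomb :: "(real^'n::finite) set \<Rightarrow> (real^'n \<Rightarrow> real) set \<Rightarrow> (real^'n \<Rightarrow> real) \<Rightarrow> bool"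
  for S F where
  lincomb_base: "f \<in> F \<Longrightarrow> lincomb S F f"
| lincomb_0: "lincomb S F (\<lambda>_. 0)"
| lincomb_mult: "smooth_on S c \<Longrightarrow> lincomb S F f \<Longrightarrow> lincomb S F (\<lambda>x. c x * f x)"
| lincomb_add: "lincomb S F f \<Longrightarrow> lincomb S F g \<Longrightarrow> lincomb S F (\<lambda>x. f x + g x)"
| lincomb_cong: "lincomb S F f \<Longrightarrow> (\<And>x. x \<in> S \<Longrightarrow> f x = g x) \<Longrightarrow> lincomb S F g"

lemma lincomb_cmult: "lincomb S F f \<Longrightarrow> lincomb S F (\<lambda>x. c * f x)"
  by (rule lincomb_mult[OF smooth_on_const])

lemma lincomb_divide: "lincomb S F f \<Longrightarrow> lincomb S F (\<lambda>x. f x / c)"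
  using lincomb_cmult[of S F f "1 / c"] by simp

lemma lincomb_diff: "lincomb S F f \<Longrightarrow> lincomb S F g \<Longrightarrow> lincomb S F (\<lambda>x. f x - g x)"
  using lincomb_add[of S F f "\<lambda>x. (- 1) * g x"] lincomb_cmult[of S F g "- 1"] by simp

lemma lincomb_sum: "(\<And>i. i \<in> I \<Longrightarrow> lincomb S F (f i)) \<Longrightarrow> lincomb S F (\<lambda>x. \<Sum>i\<in>I. f i x)"
  by (induction I rule: infinite_finite_induct) (auto intro: lincomb_0 lincomb_add)

lemma lincomb_mono: "lincomb S F f \<Longrightarrow> F \<subseteq> F' \<Longrightarrow> lincomb S F' f"
  by (induction rule: lincomb.induct) (auto intro: lincomb.intros)

lemma lincomb_smooth: "lincomb S F f \<Longrightarrow> open S \<Longrightarrow> (\<And>f. f \<in> F \<Longrightarrow> smooth_on S f) \<Longrightarrow> smooth_on S f"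
  by (induction rule: lincomb.induct, blast, rule smooth_on_const, blast intro: smooth_on_mult,
      blast intro: smooth_on_add, blast intro: smooth_on_cong)

text \<open>The product rule also leaves the old generators, multiplied by derivatives of
  coefficients, which is why \<open>F'\<close> must contain \<open>F\<close>.\<close>

lemma lincomb_dd:
  assumes S: "open S" and F: "\<And>f. f \<in> F \<Longrightarrow> smooth_on S f" "\<And>f. f \<in> F \<Longrightarrow> lincomb S F' (dd v f)" "F \<subseteq> F'"
  shows "lincomb S F f \<Longrightarrow> lincomb S F' (dd v f)"
proof (induction rule: lincomb.induct)
  case (lincomb_base f)
  then show ?case using F by blast
next
  case lincomb_0
  have "dd v (\<lambda>_. 0 :: real) = (\<lambda>_. 0)" by (auto simp: fun_eq_iff)
  then show ?case by (simp add: lincomb.lincomb_0)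
next
  case (lincomb_mult c f)
  have f: "smooth_on S f" using lincomb_smooth[OF lincomb_mult(2) S F(1)] .
  have "lincomb S F' (\<lambda>x. c x * dd v f x + dd v c x * f x)"
    by (intro lincomb.lincomb_add lincomb.lincomb_mult lincomb_mult lincomb_mono[OF lincomb_mult(2) F(3)] smooth_on_dd S)
  then show ?case
    by (rule lincomb_cong)
      (use f lincomb_mult(1) in \<open>simp add: dd_bounded_bilinear[OF bounded_bilinear_mult] smooth_on_differentiable\<close>)
next
  case (lincomb_add f g)
  have "smooth_on S f" "smooth_on S g"
    using lincomb_smooth[OF lincomb_add(1) S F(1)] lincomb_smooth[OF lincomb_add(2) S F(1)] by auto
  then show ?case
    by (intro lincomb_cong[OF lincomb.lincomb_add[OF lincomb_add(3,4)]]) (simp add: dd_add smooth_on_differentiable)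
next
  case (lincomb_cong f g)
  then show ?case using lincomb.lincomb_cong[OF lincomb_cong(3)] dd_cong[OF S] by blast
qed

lemma lincomb_bound:
  assumes "compact K" "K \<subseteq> S"
  shows "lincomb S F f \<Longrightarrow> finite F \<Longrightarrow> \<exists>C\<ge>0. \<forall>y\<in>K. \<bar>f y\<bar> \<le> C * (\<Sum>h\<in>F. \<bar>h y\<bar>)"
proof (induction rule: lincomb.induct)
  case (lincomb_base f)
  then have "\<bar>f y\<bar> \<le> 1 * (\<Sum>h\<in>F. \<bar>h y\<bar>)" for y
    using member_le_sum[of f F "\<lambda>h. \<bar>h y\<bar>"] by simp
  then show ?case by (intro exI[of _ 1]) auto
next
  case lincomb_0
  show ?case by (intro exI[of _ 0]) auto
next
  case (lincomb_mult c f)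
  then obtain C where C: "C \<ge> 0" "\<And>y. y \<in> K \<Longrightarrow> \<bar>f y\<bar> \<le> C * (\<Sum>h\<in>F. \<bar>h y\<bar>)" by blast
  have "continuous_on K c"
    using smooth_on_imp_continuous_on[OF lincomb_mult(1)] assms(2) continuous_on_subset by blast
  then have "bounded (c ` K)" using assms(1) compact_continuous_image compact_imp_bounded by blast
  then obtain D where D: "\<And>y. y \<in> K \<Longrightarrow> \<bar>c y\<bar> \<le> D" by (auto simp: bounded_iff)
  have "\<bar>c y * f y\<bar> \<le> (max D 0 * C) * (\<Sum>h\<in>F. \<bar>h y\<bar>)" if "y \<in> K" for y
  proof -
    have "\<bar>c y * f y\<bar> \<le> max D 0 * (C * (\<Sum>h\<in>F. \<bar>h y\<bar>))"
      unfolding abs_mult using D[OF that] C(2)[OF that] by (intro mult_mono) auto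
    then show ?thesis by simp
  qed
  then show ?case using C(1) by (intro exI[of _ "max D 0 * C"]) auto
next
  case (lincomb_add f g)
  then obtain C C' where C: "C \<ge> 0" "\<And>y. y \<in> K \<Longrightarrow> \<bar>f y\<bar> \<le> C * (\<Sum>h\<in>F. \<bar>h y\<bar>)"
    "C' \<ge> 0" "\<And>y. y \<in> K \<Longrightarrow> \<bar>g y\<bar> \<le> C' * (\<Sum>h\<in>F. \<bar>h y\<bar>)" by blast
  have "\<bar>f y + g y\<bar> \<le> (C + C') * (\<Sum>h\<in>F. \<bar>h y\<bar>)" if "y \<in> K" for y
    using C(2)[OF that] C(4)[OF that] by (simp add: distrib_right)
  then show ?case using C by (intro exI[of _ "C + C'"]) auto
next
  case (lincomb_cong f g)
  then obtain C where C: "C \<ge> 0" "\<And>y. y \<in> K \<Longrightarrow> \<bar>f y\<bar> \<le> C * (\<Sum>h\<in>F. \<bar>h y\<bar>)" by blast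
  then show ?case using lincomb_cong(2) assms(2) by (intro exI[of _ C]) (metis subsetD)
qed

text \<open>Gronwall's inequality along a segment.\<close>

lemma linear_system_vanishes:
  fixes F :: "(real^'n::finite \<Rightarrow> real) set"
  assumes S: "open S" "closed_segment x0 x \<subseteq> S" and fin: "finite F"
    and sm: "\<And>f. f \<in> F \<Longrightarrow> smooth_on S f" and deriv: "\<And>f. f \<in> F \<Longrightarrow> lincomb S F (dd (x - x0) f)"
    and zero: "\<And>f. f \<in> F \<Longrightarrow> f x0 = 0"
  shows "\<forall>f\<in>F. f x = 0"
proof -
  let ?d = "x - x0"
  have seg: "x0 + t *\<^sub>R ?d \<in> closed_segment x0 x" if "0 \<le> t" "t \<le> 1" for t
    using that by (auto simp: closed_segment_def algebra_simps intro!: exI[of _ t])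
  have "\<forall>f\<in>F. \<exists>C\<ge>0. \<forall>y\<in>closed_segment x0 x. \<bar>dd ?d f y\<bar> \<le> C * (\<Sum>h\<in>F. \<bar>h y\<bar>)"
    using lincomb_bound[OF compact_segment S(2) deriv fin] by blast
  then obtain C where C: "\<And>f. f \<in> F \<Longrightarrow> C f \<ge> 0"
    "\<And>f y. f \<in> F \<Longrightarrow> y \<in> closed_segment x0 x \<Longrightarrow> \<bar>dd ?d f y\<bar> \<le> C f * (\<Sum>h\<in>F. \<bar>h y\<bar>)" by metis
  define W where "W y = (\<Sum>f\<in>F. (f y)\<^sup>2)" for y
  \<comment> \<open>There is one summand \<open>2 * C f\<close> for each pair of functions, since
    every product of two absolute values is at most \<open>W y\<close>.\<close>
  define L where "L = (\<Sum>f\<in>F. \<Sum>h\<in>F. 2 * C f)"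
  define W' where "W' y = (\<Sum>f\<in>F. 2 * f y * dd ?d f y)" for y
  have le: "\<bar>f y\<bar> * \<bar>h y\<bar> \<le> W y" if "f \<in> F" "h \<in> F" for f h y
  proof -
    have "(f y)\<^sup>2 \<le> W y" "(h y)\<^sup>2 \<le> W y"
      unfolding W_def using that fin by (auto intro: member_le_sum[of _ F "\<lambda>f. (f y)\<^sup>2"])
    moreover have "\<bar>f y\<bar> * \<bar>h y\<bar> \<le> ((f y)\<^sup>2 + (h y)\<^sup>2) / 2"
      using sum_squares_bound[of "\<bar>f y\<bar>" "\<bar>h y\<bar>"] by simp
    ultimately show ?thesis by simp
  qed
  have W'_le: "W' y \<le> L * W y" if y: "y \<in> closed_segment x0 x" for y
  proof -
    have "2 * f y * dd ?d f y \<le> (\<Sum>h\<in>F. 2 * C f) * W y" if f: "f \<in> F" for f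
    proof -
      have "2 * f y * dd ?d f y \<le> 2 * (\<bar>f y\<bar> * \<bar>dd ?d f y\<bar>)"
        by (metis abs_ge_self abs_mult mult.assoc mult_left_mono zero_le_numeral)
      also have "\<dots> \<le> 2 * (\<bar>f y\<bar> * (C f * (\<Sum>h\<in>F. \<bar>h y\<bar>)))"
        using C(2)[OF f y] by (intro mult_left_mono) auto
      also have "\<dots> = (\<Sum>h\<in>F. 2 * C f * (\<bar>f y\<bar> * \<bar>h y\<bar>))"
        by (simp add: sum_distrib_left algebra_simps)
      also have "\<dots> \<le> (\<Sum>h\<in>F. 2 * C f * W y)"
        using le[OF f] C(1)[OF f] by (intro sum_mono mult_left_mono) auto
      finally show ?thesis by (simp add: sum_distrib_right)
    qed
    then show ?thesis unfolding W'_def L_def sum_distrib_right by (intro sum_mono) auto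
  qed
  have DW: "((\<lambda>t. W (x0 + t *\<^sub>R ?d)) has_real_derivative W' (x0 + t *\<^sub>R ?d)) (at t)" if "0 \<le> t" "t \<le> 1" for t
  proof -
    have "f differentiable (at (x0 + t *\<^sub>R ?d))" if "f \<in> F" for f
      using sm[OF that] seg[OF \<open>0 \<le> t\<close> \<open>t \<le> 1\<close>] S(2) smooth_on_differentiable by blast
    note D = DERIV_along_line[OF this]
    have "((\<lambda>t. (f (x0 + t *\<^sub>R ?d))\<^sup>2) has_real_derivative 2 * f (x0 + t *\<^sub>R ?d) * dd ?d f (x0 + t *\<^sub>R ?d)) (at t)" if "f \<in> F" for f
      using DERIV_power[OF D[OF that], of 2] by (simp add: algebra_simps)
    then show ?thesis unfolding W_def W'_def by (intro DERIV_sum) auto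
  qed
  have "exp (- L * 1) * W (x0 + 1 *\<^sub>R ?d) \<le> exp (- L * 0) * W (x0 + 0 *\<^sub>R ?d)"
  proof (rule DERIV_nonpos_imp_nonincreasing[of 0 1 "\<lambda>t. exp (- L * t) * W (x0 + t *\<^sub>R ?d)"])
    fix t :: real assume t: "0 \<le> t" "t \<le> 1"
    have E: "((\<lambda>t. exp (- L * t)) has_real_derivative (- L * exp (- L * t))) (at t)"
      by (auto intro!: derivative_eq_intros)
    have "exp (- L * t) * W' (x0 + t *\<^sub>R ?d) \<le> exp (- L * t) * (L * W (x0 + t *\<^sub>R ?d))"
      using W'_le[OF seg[OF t]] by (intro mult_left_mono) auto
    then show "\<exists>y. ((\<lambda>t. exp (- L * t) * W (x0 + t *\<^sub>R ?d)) has_real_derivative y) (at t) \<and> y \<le> 0"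
      using DERIV_mult[OF E DW[OF t]] by (intro exI conjI) (auto simp: algebra_simps)
  qed simp
  moreover have "W x0 = 0" by (simp add: W_def zero)
  ultimately have "exp (- L) * W x \<le> 0" by simp
  then have "W x \<le> 0" by (simp add: mult_le_0_iff not_less)
  moreover have "W x \<ge> 0" by (simp add: W_def sum_nonneg)
  ultimately have "W x = 0" by simp
  then show ?thesis using fin by (simp add: W_def sum_nonneg_eq_0_iff)
qed

section \<open>Prolongation of the Eisenhart equation\<close>

context metric_chart
begin

lemma hess_linear:
  assumes "x \<in> S" "p differentiable (at x)"
  shows "linear (hess p x u)" "linear (\<lambda>u. hess p x u v)"
  using assms by (auto intro!: linearI simp: hess_def Gam_simps dd_direction_simps inner_simps algebra_simps)

lemma hess_sym: "solution H p \<Longrightarrow> x \<in> S \<Longrightarrow> hess p x u v = hess p x v u"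
  using Gam_sym[of x u v] by (auto simp: hess_def solution_def)

definition hess_trace :: "(real^'n \<Rightarrow> real^'n) \<Rightarrow> real^'n \<Rightarrow> real" where
  "hess_trace p x = (\<Sum>k\<in>UNIV. hess p x (axis k 1) (up x k))"

lemma hess_trace_smooth: "smooth_on S p \<Longrightarrow> smooth_on S (hess_trace p)"
  unfolding hess_trace_def[abs_def] hess_def using S up_smooth
  by (intro smooth_on_sum smooth_on_diff smooth_on_inner smooth_on_dd Gam_smooth smooth_on_const)

definition curv_term :: "(real^'n \<Rightarrow> real^'n^'n) \<Rightarrow> real^'n \<Rightarrow> real^'n \<Rightarrow> real^'n \<Rightarrow> real" where
  "curv_term H x u z = (\<Sum>k\<in>UNIV. form (H x) (Riem x u (axis k 1) z) (up x k) + form (H x) z (Riem x u (axis k 1) (up x k)))"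

text \<open>The Ricci identity, traced over \<open>v\<close> and \<open>w\<close>. It expresses the
  derivative of \<open>p\<close> through \<open>H\<close>, \<open>p\<close> and the single new
  unknown \<open>hess_trace p\<close>.\<close>

lemma hess_eq:
  assumes sol: "solution H p" and x: "x \<in> S"
  shows "CARD('n) * hess p x u z = hess_trace p x * form (G x) u z - curv_term H x u z"
proof -
  have p: "p differentiable (at x)" using sol x smooth_on_differentiable by (auto simp: solution_def)
  have "0 = (\<Sum>k\<in>UNIV. form (H x) (Riem x u (axis k 1) z) (up x k) + form (H x) z (Riem x u (axis k 1) (up x k))
    + (hess p x u z * form (G x) (axis k 1) (up x k) + hess p x u (up x k) * form (G x) (axis k 1) z
       - hess p x (axis k 1) z * form (G x) u (up x k) - hess p x (axis k 1) (up x k) * form (G x) u z))"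
    using solution_ricci[OF sol x] by (simp only: sum.neutral_const)
  also have "\<dots> = curv_term H x u z + hess p x u z * CARD('n) + hess p x u z - hess p x u z - hess_trace p x * form (G x) u z"
    unfolding sum.distrib sum_subtractf
    using contract_1[OF x hess_linear(2)[OF x p]] contract_2[OF x hess_linear(1)[OF x p]] contract_g[OF x]
    by (simp add: curv_term_def hess_trace_def sum_distrib_left[symmetric] sum_distrib_right[symmetric] sum.distrib)
  finally show ?thesis by (simp add: mult.commute)
qed

text \<open>The components of \<open>H\<close>, \<open>p\<close> and the trace of the Hessian satisfy a
  closed linear system of first order.\<close>

lemma solution_unique:
  assumes sol: "solution H p" and conv: "convex S" and card: "CARD('n) \<ge> 2"
    and N: "open N" "x0 \<in> N" "N \<subseteq> S" and zero: "\<And>y. y \<in> N \<Longrightarrow> H y = 0" and x: "x \<in> S"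
  shows "H x = 0"
proof -
  let ?n = "real CARD('n)"
  note Hs = solutionD(1)[OF sol] and ps = solutionD(2)[OF sol] and eq = solutionD(5)[OF sol]
  have pd: "p differentiable (at y)" and Hd: "H differentiable (at y)" if "y \<in> S" for y
    using Hs ps that smooth_on_differentiable by blast+
  define mu where "mu = hess_trace p"
  define F1 where "F1 = (\<Union>i. range (\<lambda>j y. H y $ i $ j)) \<union> range (\<lambda>i y. p y $ i)"
  define F2 where "F2 = insert mu F1"
  have sm1: "smooth_on S f" if "f \<in> F1" for f
    using that Hs ps S by (auto simp: F1_def intro!: smooth_on_vec_nth)
  have mu_s: "smooth_on S mu" unfolding mu_def by (rule hess_trace_smooth[OF ps])
  have sm2: "smooth_on S f" if "f \<in> F2" for f using that sm1 mu_s by (auto simp: F2_def)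
  have fin: "finite F2" by (simp add: F2_def F1_def)
  have F12: "F1 \<subseteq> F2" by (auto simp: F2_def)
  have lcH: "lincomb S F1 (\<lambda>y. form (H y) (A y) (B y))" if "smooth_on S A" "smooth_on S B" for A B
  proof (rule lincomb_cong)
    show "lincomb S F1 (\<lambda>y. \<Sum>i\<in>UNIV. \<Sum>j\<in>UNIV. (A y $ i * B y $ j) * H y $ i $ j)"
      using S that by (intro lincomb_sum lincomb_mult smooth_on_mult smooth_on_vec_nth lincomb_base) (auto simp: F1_def)
    show "(\<Sum>i\<in>UNIV. \<Sum>j\<in>UNIV. (A y $ i * B y $ j) * H y $ i $ j) = form (H y) (A y) (B y)" for y
      by (subst bilinear_expansion[OF bilinear_form]) (simp add: form_axis)
  qed
  have lcp: "lincomb S F1 (\<lambda>y. p y \<bullet> A y)" if "smooth_on S A" for A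
  proof (rule lincomb_cong)
    show "lincomb S F1 (\<lambda>y. \<Sum>i\<in>UNIV. A y $ i * p y $ i)"
      using S that by (intro lincomb_sum lincomb_mult smooth_on_vec_nth lincomb_base) (auto simp: F1_def)
  qed (simp add: inner_vec_def mult.commute)
  have dH: "lincomb S F1 (dd v (\<lambda>y. H y $ i $ j))" for v i j
  proof (rule lincomb_cong)
    show "lincomb S F1 (\<lambda>y. form (H y) (Gam y v (axis i 1)) (axis j 1) + form (H y) (axis i 1) (Gam y v (axis j 1))
        + form (G y) (axis i 1) (axis j 1) * (2 * (p y \<bullet> v)) + form (G y) v (axis j 1) * (p y \<bullet> axis i 1)
        + form (G y) v (axis i 1) * (p y \<bullet> axis j 1))"
      using S G_smooth
      by (intro lincomb_add lincomb_mult[of S "\<lambda>y. form (G y) _ _"] lincomb_cmult lcH lcp Gam_smooth smooth_on_const smooth_on_form)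
    show "form (H y) (Gam y v (axis i 1)) (axis j 1) + form (H y) (axis i 1) (Gam y v (axis j 1))
        + form (G y) (axis i 1) (axis j 1) * (2 * (p y \<bullet> v)) + form (G y) v (axis j 1) * (p y \<bullet> axis i 1)
        + form (G y) v (axis i 1) * (p y \<bullet> axis j 1) = dd v (\<lambda>y. H y $ i $ j) y" if "y \<in> S" for y
      using eq[OF that, of v "axis i 1" "axis j 1"] dd_form_const[OF Hd[OF that], of v "axis i 1" "axis j 1"]
      by (simp add: form_axis algebra_simps)
  qed
  have lcT: "lincomb S F1 (\<lambda>y. curv_term H y u z)" for u z
    unfolding curv_term_def
    by (intro lincomb_sum lincomb_add lcH Riem_field_smooth up_smooth smooth_on_const)
  \<comment> \<open>\<open>E\<close> is the part of the derivative of \<open>p\<close> that is free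
    of \<open>mu\<close>. It is built from \<open>H\<close> and \<open>p\<close> alone, so
    differentiating it produces no derivative of \<open>mu\<close>; this is what closes the
    system.\<close>
  define E where "E u z y = p y \<bullet> Gam y u z - curv_term H y u z / ?n" for u z y
  have lcE: "lincomb S F1 (E u z)" for u z
    unfolding E_def[abs_def] by (intro lincomb_diff lincomb_divide lcT lcp Gam_smooth smooth_on_const)
  have dp: "dd u p y \<bullet> z = mu y * (form (G y) u z / ?n) + E u z y" if "y \<in> S" for u z y
    using hess_eq[OF sol that, of u z] by (simp add: E_def mu_def hess_def field_simps)
  have dp1: "lincomb S F2 (dd v (\<lambda>y. p y $ i))" for v i
  proof (rule lincomb_cong)
    show "lincomb S F2 (\<lambda>y. (form (G y) v (axis i 1) / ?n) * mu y + E v (axis i 1) y)"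
      using S G_smooth by (intro lincomb_add lincomb_mult smooth_on_divide smooth_on_form smooth_on_const lincomb_mono[OF lcE F12] lincomb_base)
        (auto simp: F2_def)
    show "(form (G y) v (axis i 1) / ?n) * mu y + E v (axis i 1) y = dd v (\<lambda>y. p y $ i) y" if "y \<in> S" for y
      using dp[OF that, of v "axis i 1"] dd_bounded_linear[OF bounded_linear_inner_left pd[OF that], of v "axis i 1"]
      by (simp add: inner_axis mult.commute)
  qed
  have d1: "lincomb S F2 (dd v f)" if "f \<in> F1" for f v
    using that dH[THEN lincomb_mono[OF _ F12]] dp1 by (auto simp: F1_def)
  have lcdE: "lincomb S F2 (dd v (E u z))" for v u z
    by (rule lincomb_dd[OF S sm1 d1 F12 lcE])
  define q where "q u v z y = - mu y * (form (dd v G y) u z - form (dd u G y) v z) - ?n * (dd v (E u z) y - dd u (E v z) y)" for u v z y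
  have lcq: "lincomb S F2 (q u v z)" for u v z
  proof (rule lincomb_cong)
    show "lincomb S F2 (\<lambda>y. (form (dd u G y) v z - form (dd v G y) u z) * mu y - ?n * (dd v (E u z) y - dd u (E v z) y))"
      using S G_smooth by (intro lincomb_diff lincomb_cmult lcdE lincomb_mult smooth_on_diff smooth_on_form smooth_on_dd smooth_on_const lincomb_base)
        (auto simp: F2_def)
  qed (simp add: q_def algebra_simps)
  have mud: "mu differentiable (at y)" if "y \<in> S" for y using mu_s that smooth_on_differentiable by blast
  \<comment> \<open>Equality of the mixed derivatives of \<open>p\<close> after substituting
    \<open>dp\<close>. The differential of \<open>mu\<close> enters only through the metric
    term.\<close>
  have comm: "dd v mu y * form (G y) u z - dd u mu y * form (G y) v z = q u v z y" if y: "y \<in> S" for u v z y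
  proof -
    have *: "dd v (dd u p) y \<bullet> z = (dd v mu y * form (G y) u z + mu y * form (dd v G y) u z) / ?n + dd v (E u z) y" for u v
    proof -
      have Ed: "E u z differentiable (at y)"
        using lincomb_smooth[OF lcE S sm1] y smooth_on_differentiable by blast
      have gd: "((\<lambda>y. form (G y) u z) has_derivative (\<lambda>v. form (dd v G y) u z)) (at y)"
        using has_derivative_dd[OF differentiable_form[OF G_diff[OF y] differentiable_const differentiable_const], of u z]
        by (simp add: dd_form_const[OF G_diff[OF y]])
      have "dd v (dd u p) y \<bullet> z = dd v (\<lambda>y. dd u p y \<bullet> z) y"
        using S ps y by (intro dd_bounded_linear[OF bounded_linear_inner_left, symmetric] smooth_on_differentiable[OF smooth_on_dd])
      also have "\<dots> = dd v (\<lambda>y. mu y * (form (G y) u z / ?n) + E u z y) y"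
        by (rule dd_cong[OF S y dp])
      also have "\<dots> = (dd v mu y * form (G y) u z + mu y * form (dd v G y) u z) / ?n + dd v (E u z) y"
      proof (rule dd_eqI)
        show "((\<lambda>y. mu y * (form (G y) u z / ?n) + E u z y) has_derivative
          (\<lambda>v. (dd v mu y * form (G y) u z + mu y * form (dd v G y) u z) / ?n + dd v (E u z) y)) (at y)"
          by (rule has_derivative_eq_rhs[OF has_derivative_add[OF has_derivative_mult[OF has_derivative_dd[OF mud[OF y]]
              bounded_linear.has_derivative[OF bounded_linear_divide gd]] has_derivative_dd[OF Ed]]]) (simp add: fun_eq_iff field_simps)
      qed
      finally show ?thesis .
    qed
    have "dd v (dd u p) y \<bullet> z = dd u (dd v p) y \<bullet> z" using dd_dd_commute[OF S y ps] by simp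
    then show ?thesis unfolding * by (simp add: q_def field_simps)
  qed
  \<comment> \<open>Contracting \<open>u\<close> with \<open>z\<close> leaves \<open>?n - 1\<close>
    times the differential of \<open>mu\<close>; here dimension at least two is used.\<close>
  have dmu: "(?n - 1) * dd v mu y = (\<Sum>k\<in>UNIV. \<Sum>l\<in>UNIV. up y k $ l * q (axis k 1) v (axis l 1) y)" if y: "y \<in> S" for v y
  proof -
    have lin: "linear (\<lambda>v. dd v mu y)" using linear_dd[OF mud[OF y]] .
    have "(\<Sum>l\<in>UNIV. up y k $ l * q (axis k 1) v (axis l 1) y) = dd v mu y * form (G y) (axis k 1) (up y k) - dd (axis k 1) mu y * form (G y) v (up y k)" for k
    proof -
      have f: "form (G y) a (up y k) = (\<Sum>l\<in>UNIV. up y k $ l * form (G y) a (axis l 1))" for a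
        by (subst vec_expansion[of "up y k"]) (simp only: form_sum form_simps)
      show ?thesis unfolding f comm[OF y, symmetric]
        by (simp add: sum_distrib_left sum_subtractf right_diff_distrib mult.left_commute)
    qed
    then show ?thesis
      using contract_1[OF y lin, of v] contract_g[OF y] by (simp add: sum_subtractf sum_distrib_left[symmetric] left_diff_distrib)
  qed
  have "lincomb S F2 (dd v mu)" for v
  proof (rule lincomb_cong)
    show "lincomb S F2 (\<lambda>y. (\<Sum>k\<in>UNIV. \<Sum>l\<in>UNIV. up y k $ l * q (axis k 1) v (axis l 1) y) / (?n - 1))"
      using S up_smooth by (intro lincomb_divide lincomb_sum lincomb_mult lcq smooth_on_vec_nth)
    show "(\<Sum>k\<in>UNIV. \<Sum>l\<in>UNIV. up y k $ l * q (axis k 1) v (axis l 1) y) / (?n - 1) = dd v mu y" if "y \<in> S" for y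
      using dmu[OF that, of v] card by (simp add: field_simps)
  qed
  then have d2: "lincomb S F2 (dd v f)" if "f \<in> F2" for f v
    using that d1 by (auto simp: F2_def)
  have pN: "p y = 0" if y: "y \<in> N" for y
  proof -
    have yS: "y \<in> S" using y N by blast
    have "dd u H y = 0" for u
      using dd_cong[OF N(1) y, of H "\<lambda>_. 0"] zero by simp
    then have e: "2 * (p y \<bullet> u) * form (G y) z w + (p y \<bullet> z) * form (G y) u w + (p y \<bullet> w) * form (G y) u z = 0" for u z w
      using eq[OF yS, of u z w] zero[OF y] by (simp add: form_simps)
    have lin: "linear (\<lambda>u. p y \<bullet> u)" by (intro linearI) (auto simp: inner_simps)
    have "p y \<bullet> u = 0" for u
    proof -
      \<comment> \<open>The trace over \<open>z\<close> and \<open>w\<close> is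
        \<open>2 * ?n + 2\<close> times \<open>p y \<bullet> u\<close>.\<close>
      have "0 = (\<Sum>k\<in>UNIV. 2 * (p y \<bullet> u) * form (G y) (axis k 1) (up y k) + (p y \<bullet> axis k 1) * form (G y) u (up y k) + (p y \<bullet> up y k) * form (G y) u (axis k 1))"
        by (simp only: e sum.neutral_const)
      also have "\<dots> = (\<Sum>k\<in>UNIV. 2 * (p y \<bullet> u) * form (G y) (axis k 1) (up y k) + (p y \<bullet> axis k 1) * form (G y) u (up y k) + (p y \<bullet> up y k) * form (G y) (axis k 1) u)"
        using g_sym[OF yS, of u] by simp
      also have "\<dots> = 2 * (p y \<bullet> u) * ?n + p y \<bullet> u + p y \<bullet> u"
        using contract_1[OF yS lin, of u] contract_2[OF yS lin, of u] contract_g[OF yS]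
        by (simp add: sum.distrib sum_distrib_left[symmetric])
      finally have "(p y \<bullet> u) * (2 * ?n + 2) = 0" by (simp add: algebra_simps)
      moreover have "2 * ?n + 2 > 0" by simp
      ultimately show ?thesis by (metis less_irrefl mult_eq_0_iff)
    qed
    then show ?thesis by (metis inner_eq_zero_iff)
  qed
  have x0: "x0 \<in> S" using N by blast
  have "dd u p x0 = 0" for u using dd_cong[OF N(1,2), of p "\<lambda>_. 0"] pN by simp
  then have "mu x0 = 0" using pN[OF N(2)] by (simp add: mu_def hess_trace_def hess_def)
  then have z0: "f x0 = 0" if "f \<in> F2" for f
    using that zero[OF N(2)] pN[OF N(2)] by (auto simp: F2_def F1_def)
  have seg: "closed_segment x0 x \<subseteq> S" using conv x0 x by (simp add: closed_segment_subset)
  have all: "\<forall>f\<in>F2. f x = 0"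
    by (rule linear_system_vanishes[OF S seg fin]) (auto intro: sm2 d2 z0)
  have "(\<lambda>y. H y $ i $ j) \<in> F2" for i j by (auto simp: F2_def F1_def)
  then have "H x $ i $ j = 0" for i j using bspec[OF all] by fastforce
  then show ?thesis by (simp add: Finite_Cartesian_Product.vec_eq_iff)
qed

end

subsection \<open>Lie derivatives\<close>

text \<open>The direction moves with the point, so the derivative of \<open>V\<close> appears beside
  a second derivative of \<open>f\<close>, whose two directions are then exchanged.\<close>

lemma dd_along_field:
  fixes f :: "real^'n::finite \<Rightarrow> 'b::euclidean_space"
  assumes S: "open S" "x \<in> S" and f: "smooth_on S f" and V: "smooth_on S V"
  shows "dd z (\<lambda>y. dd (V y) f y) x = dd (dd z V x) f x + dd (V x) (dd z f) x"
proof -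
  have fd: "f differentiable (at y)" if "y \<in> S" for y using f that smooth_on_differentiable by blast
  have Vd: "V differentiable (at x)" using V S smooth_on_differentiable by blast
  have fzd: "dd z f differentiable (at x)" "\<And>i. pd i f differentiable (at x)"
    using S f smooth_on_differentiable smooth_on_dd smooth_on_pd by blast+
  have Vi: "(\<lambda>y. V y $ i) differentiable (at x)" for i
    by (rule differentiable_bounded_linear[OF bounded_linear_vec_nth Vd])
  have "dd z (\<lambda>y. dd (V y) f y) x = dd z (\<lambda>y. \<Sum>i\<in>UNIV. V y $ i *\<^sub>R pd i f y) x"
    by (rule dd_cong[OF S]) (simp add: dd_eq_sum_pd fd)
  also have "\<dots> = (\<Sum>i\<in>UNIV. dd z (\<lambda>y. V y $ i *\<^sub>R pd i f y) x)"
    by (intro dd_sum differentiable_bounded_bilinear[OF bounded_bilinear_scaleR] Vi fzd)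
  also have "\<dots> = (\<Sum>i\<in>UNIV. V x $ i *\<^sub>R dd z (pd i f) x + (dd z V x $ i) *\<^sub>R pd i f x)"
    by (simp add: dd_bounded_bilinear[OF bounded_bilinear_scaleR] Vi fzd dd_bounded_linear[OF bounded_linear_vec_nth Vd])
  also have "\<dots> = (\<Sum>i\<in>UNIV. V x $ i *\<^sub>R pd i (dd z f) x) + (\<Sum>i\<in>UNIV. (dd z V x $ i) *\<^sub>R pd i f x)"
    unfolding pd_eq_dd sum.distrib by (simp add: dd_dd_commute[OF S f, of z])
  also have "\<dots> = dd (V x) (dd z f) x + dd (dd z V x) f x"
    by (simp add: dd_eq_sum_pd fzd fd S)
  finally show ?thesis by simp
qed

lemma dd_comp:
  assumes "\<psi> differentiable (at x)" "f differentiable (at (\<psi> x))"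
  shows "dd u (\<lambda>y. f (\<psi> y)) x = dd (dd u \<psi> x) f (\<psi> x)"
  using has_derivative_compose[OF has_derivative_dd[OF assms(1)] has_derivative_dd[OF assms(2)]]
  by (rule dd_eqI)

lemma differentiable_comp:
  assumes "\<psi> differentiable (at x)" "f differentiable (at (\<psi> x))"
  shows "(\<lambda>y. f (\<psi> y)) differentiable (at x)"
  using has_derivative_compose[OF has_derivative_dd[OF assms(1)] has_derivative_dd[OF assms(2)]]
  by (auto simp: differentiable_def)

definition lie :: "(real^'n \<Rightarrow> real^'n) \<Rightarrow> (real^'n \<Rightarrow> real^'n^'n) \<Rightarrow> real^'n::finite \<Rightarrow> real^'n \<Rightarrow> real^'n \<Rightarrow> real" where
  "lie V H x z w = form (dd (V x) H x) z w + form (H x) (dd z V x) w + form (H x) z (dd w V x)"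

text \<open>Naturality of the Lie derivative. Differentiating the transformation laws of
  \<open>H\<close> and of \<open>V\<close> produces second derivatives of \<open>\<psi>\<close>, and
  the two contributions agree. It serves both for a projective field and for the gradient of the
  potential.\<close>

lemma lie_pullback:
  assumes N: "open N" "x \<in> N" and psi: "smooth_on N \<psi>" "\<psi> x \<in> S'" and S': "open S'"
    and V: "smooth_on N V" and H: "smooth_on N H" and V': "smooth_on S' V'" and H': "smooth_on S' H'"
    and VV': "\<And>y. y \<in> N \<Longrightarrow> V' (\<psi> y) = dd (V y) \<psi> y"
    and HH': "\<And>y z w. y \<in> N \<Longrightarrow> form (H y) z w = form (H' (\<psi> y)) (dd z \<psi> y) (dd w \<psi> y)"
  shows "lie V H x z w = lie V' H' (\<psi> x) (dd z \<psi> x) (dd w \<psi> x)"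
proof -
  have pd: "\<psi> differentiable (at x)" "\<And>z. dd z \<psi> differentiable (at x)"
    using psi N smooth_on_differentiable smooth_on_dd by blast+
  have Hd: "H differentiable (at x)" using H N smooth_on_differentiable by blast
  have H'd: "H' differentiable (at (\<psi> x))" "V' differentiable (at (\<psi> x))"
    using H' V' psi smooth_on_differentiable by blast+
  have "form (dd (V x) H x) z w = dd (V x) (\<lambda>y. form (H' (\<psi> y)) (dd z \<psi> y) (dd w \<psi> y)) x"
    unfolding dd_form_const[OF Hd, symmetric] by (rule dd_cong[OF N HH'])
  also have "\<dots> = form (dd (V x) (\<lambda>y. H' (\<psi> y)) x) (dd z \<psi> x) (dd w \<psi> x)
      + form (H' (\<psi> x)) (dd (V x) (dd z \<psi>) x) (dd w \<psi> x) + form (H' (\<psi> x)) (dd z \<psi> x) (dd (V x) (dd w \<psi>) x)"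
    by (rule dd_form[OF differentiable_comp[OF pd(1) H'd(1)] pd(2) pd(2)])
  also have "dd (V x) (\<lambda>y. H' (\<psi> y)) x = dd (V' (\<psi> x)) H' (\<psi> x)"
    by (simp add: dd_comp pd H'd VV' N)
  finally have 1: "form (dd (V x) H x) z w = form (dd (V' (\<psi> x)) H' (\<psi> x)) (dd z \<psi> x) (dd w \<psi> x)
      + form (H' (\<psi> x)) (dd (V x) (dd z \<psi>) x) (dd w \<psi> x) + form (H' (\<psi> x)) (dd z \<psi> x) (dd (V x) (dd w \<psi>) x)" .
  have 2: "dd (dd z \<psi> x) V' (\<psi> x) = dd (dd z V x) \<psi> x + dd (V x) (dd z \<psi>) x" for z
  proof -
    have "dd (dd z \<psi> x) V' (\<psi> x) = dd z (\<lambda>y. V' (\<psi> y)) x" by (simp add: dd_comp pd H'd)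
    also have "\<dots> = dd z (\<lambda>y. dd (V y) \<psi> y) x" by (rule dd_cong[OF N VV'])
    also have "\<dots> = dd (dd z V x) \<psi> x + dd (V x) (dd z \<psi>) x" by (rule dd_along_field[OF N psi(1) V])
    finally show ?thesis .
  qed
  show ?thesis
    unfolding lie_def 1 2 by (simp add: form_simps HH' N)
qed

text \<open>The Lie derivative along a bracket is the commutator of the Lie derivatives, and
  multiplications by the constants \<open>a\<close> and \<open>b\<close> commute.\<close>

lemma lie_bracket_homothetic:
  assumes S: "open S" "x \<in> S" and G: "smooth_on S G" and V: "smooth_on S V" and W: "smooth_on S W"
    and a: "\<And>y z w. y \<in> S \<Longrightarrow> lie V G y z w = a * form (G y) z w"
    and b: "\<And>y z w. y \<in> S \<Longrightarrow> lie W G y z w = b * form (G y) z w"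
  shows "lie (\<lambda>y. dd (V y) W y - dd (W y) V y) G x z w = 0"
proof -
  have Gd: "G differentiable (at x)" "V differentiable (at x)" "W differentiable (at x)"
    using S G V W smooth_on_differentiable by blast+
  have dVW: "(\<lambda>y. dd (V y) f y) differentiable (at x)" if V: "smooth_on S V" and f: "smooth_on S f"
    for V :: "real^'a \<Rightarrow> real^'a" and f :: "real^'a \<Rightarrow> 'b::euclidean_space"
  proof (rule differentiable_cong_open[OF S])
    show "(\<Sum>i\<in>UNIV. V y $ i *\<^sub>R pd i f y) = dd (V y) f y" if "y \<in> S" for y
      using f that by (simp add: dd_eq_sum_pd smooth_on_differentiable)
    have "smooth_on S (\<lambda>y. \<Sum>i\<in>UNIV. V y $ i *\<^sub>R pd i f y)"
      using S V f by (intro smooth_on_sum smooth_on_scaleR smooth_on_vec_nth smooth_on_pd)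
    then show "(\<lambda>y. \<Sum>i\<in>UNIV. V y $ i *\<^sub>R pd i f y) differentiable (at x)"
      using S smooth_on_differentiable by blast
  qed
  have ddV: "dd z V differentiable (at x)" if "smooth_on S V" for z and V :: "real^'a \<Rightarrow> real^'a"
    using S that smooth_on_differentiable smooth_on_dd by blast
  \<comment> \<open>The homothety equation of one field, differentiated in a direction
    \<open>u\<close> with \<open>z\<close> and \<open>w\<close> fixed. It is used with
    \<open>u\<close> the value of the other field.\<close>
  have diff: "form (dd (dd u V x) G x) z w + form (dd (V x) (dd u G) x) z w
      + (form (dd u G x) (dd z V x) w + form (G x) (dd u (dd z V) x) w)
      + (form (dd u G x) z (dd w V x) + form (G x) z (dd u (dd w V) x)) = a * form (dd u G x) z w"
    if V: "smooth_on S V" and a: "\<And>y z w. y \<in> S \<Longrightarrow> lie V G y z w = a * form (G y) z w" for V a u z w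
  proof -
    have "dd u (\<lambda>y. form (dd (V y) G y) z w + form (G y) (dd z V y) w + form (G y) z (dd w V y)) x = dd u (\<lambda>y. a * form (G y) z w) x"
      using a by (intro dd_cong[OF S]) (simp add: lie_def)
    also have "\<dots> = a * form (dd u G x) z w"
      using dd_bounded_linear[OF bounded_linear_mult_right differentiable_form[OF Gd(1) differentiable_const differentiable_const]]
      by (simp add: dd_form_const Gd)
    finally have "dd u (\<lambda>y. form (dd (V y) G y) z w + form (G y) (dd z V y) w + form (G y) z (dd w V y)) x = a * form (dd u G x) z w" .
    moreover have "dd u (\<lambda>y. form (dd (V y) G y) z w + form (G y) (dd z V y) w + form (G y) z (dd w V y)) x
      = form (dd u (\<lambda>y. dd (V y) G y) x) z w + (form (dd u G x) (dd z V x) w + form (G x) (dd u (dd z V) x) w)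
      + (form (dd u G x) z (dd w V x) + form (G x) z (dd u (dd w V) x))"
      by (simp add: dd_add differentiable_add differentiable_form dd_form dVW[OF V G] ddV[OF V] Gd dd_form_const form_simps)
    ultimately show ?thesis by (simp add: dd_along_field[OF S G V] form_simps)
  qed
  have U: "dd z (\<lambda>y. dd (V y) W y - dd (W y) V y) x = dd (dd z V x) W x + dd (V x) (dd z W) x - (dd (dd z W x) V x + dd (W x) (dd z V) x)" for z
    by (simp add: dd_diff dVW[OF V W] dVW[OF W V] dd_along_field[OF S V W] dd_along_field[OF S W V])
  have lin: "dd (u - v) G x = dd u G x - dd v G x" for u v
    using linear_diff[OF linear_dd[OF Gd(1)]] .
  have cV: "form (dd (V x) G x) z w = a * form (G x) z w - form (G x) (dd z V x) w - form (G x) z (dd w V x)" for z w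
    using a[OF S(2), of z w] by (simp add: lie_def)
  have cW: "form (dd (W x) G x) z w = b * form (G x) z w - form (G x) (dd z W x) w - form (G x) z (dd w W x)" for z w
    using b[OF S(2), of z w] by (simp add: lie_def)
  have comm: "dd (V x) (dd (W x) G) x = dd (W x) (dd (V x) G) x" by (rule dd_dd_commute[OF S G])
  show ?thesis
    using diff[OF V a, of "W x" z w] diff[OF W b, of "V x" z w]
    unfolding lie_def U lin cV cW comm
    by (simp add: form_simps algebra_simps)
qed

subsection \<open>Constant curvature and pencils of solutions\<close>

context metric_chart
begin

definition constant_type :: "real^'n \<Rightarrow> real \<Rightarrow> bool" where
  "constant_type x k \<longleftrightarrow> (\<forall>u v z. Riem x u v z = k *\<^sub>R (form (G x) v z *\<^sub>R u - form (G x) u z *\<^sub>R v))"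

definition scal :: "real^'n \<Rightarrow> real" where
  "scal x = (\<Sum>k\<in>UNIV. \<Sum>l\<in>UNIV. form (G x) (Riem x (axis k 1) (axis l 1) (up x l)) (up x k))"

definition operator :: "(real^'n \<Rightarrow> real^'n^'n) \<Rightarrow> real^'n \<Rightarrow> real^'n^'n" where
  "operator H x = matrix_inv (G x) ** H x"

lemma g_operator: "x \<in> S \<Longrightarrow> form (G x) z (operator H x *v w) = form (H x) z w"
  by (simp add: form_def operator_def matrix_vector_mul_assoc[symmetric] G_inv)

lemma scal_smooth: "smooth_on S scal"
  unfolding scal_def[abs_def] using S G_smooth
  by (intro smooth_on_sum smooth_on_form Riem_field_smooth up_smooth)

text \<open>Two traces of the space-form curvature recover \<open>k\<close>. In dimension 6 the
  factor is 30, the constant by which \<open>scal\<close> is divided below.\<close>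

lemma constant_type_scal:
  assumes x: "x \<in> S" and k: "constant_type x k"
  shows "scal x = k * (real CARD('n) * (real CARD('n) - 1))"
proof -
  have "scal x = (\<Sum>(i::'n)\<in>UNIV. \<Sum>(j::'n)\<in>UNIV. k * (1 - (if i = j then 1 else 0)))"
    unfolding scal_def using k
    by (intro sum.cong refl) (simp add: constant_type_def form_simps g_up[OF x] axis_def)
  also have "\<dots> = k * (real CARD('n) * (real CARD('n) - 1))"
    by (simp add: sum_distrib_left[symmetric] sum_subtractf algebra_simps)
  finally show ?thesis .
qed

lemma solution_G: "solution G (\<lambda>_. 0)"
  using G_smooth G_sym dG by (simp add: solution_def smooth_on_const)

text \<open>This is the Ricci identity of the metric itself, a solution with zero gradient.\<close>

lemma Riem_metric: "x \<in> S \<Longrightarrow> form (G x) (Riem x u v z) w = - form (G x) (Riem x u v w) z"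
  using solution_ricci[OF solution_G, of x u v z w] g_sym[of x z "Riem x u v w"] by (simp add: hess_def)

lemma solution_sym: "solution H p \<Longrightarrow> x \<in> S \<Longrightarrow> form (H x) z w = form (H x) w z"
  using form_sym by (auto simp: solution_def)

text \<open>The space-form curvature turns the traced Ricci identity into a pencil. The coefficient
  of \<open>H\<close> is \<open>- k\<close>, so the sectional curvature can be read off from the
  Hessian.\<close>

lemma constant_type_hess:
  assumes x: "x \<in> S" and k: "constant_type x k" and sol: "solution H p"
  shows "hess p x u z = (hess_trace p x + k * (\<Sum>j\<in>UNIV. form (H x) (axis j 1) (up x j))) / CARD('n) * form (G x) u z - k * form (H x) u z"
proof -
  let ?t = "\<Sum>j\<in>UNIV. form (H x) (axis j 1) (up x j)"
  have lin: "linear (form (H x) v)" "linear (\<lambda>u. form (H x) u v)" for v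
    using bilinear_form[of "H x"] by (auto simp: bilinear_def)
  have R: "Riem x u v z = k *\<^sub>R (form (G x) v z *\<^sub>R u - form (G x) u z *\<^sub>R v)" for u v z
    using k by (simp add: constant_type_def)
  have "curv_term H x u z = (\<Sum>j\<in>UNIV. k * (form (H x) u (up x j) * form (G x) (axis j 1) z)
      - k * (form (G x) u z * form (H x) (axis j 1) (up x j)) + (k * (form (H x) z u * form (G x) (axis j 1) (up x j))
      - k * (form (H x) z (axis j 1) * form (G x) u (up x j))))"
    unfolding curv_term_def by (intro sum.cong refl) (simp add: R form_simps right_diff_distrib mult.commute mult.left_commute)
  also have "\<dots> = k * form (H x) u z - k * (form (G x) u z * ?t) + (k * (form (H x) z u * CARD('n)) - k * form (H x) z u)"
    by (simp only: sum.distrib sum_subtractf sum_distrib_left[symmetric] contract_1[OF x lin(1)] contract_2[OF x lin(1)] contract_g[OF x])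
  finally show ?thesis
    using hess_eq[OF sol x, of u z] solution_sym[OF sol x, of u z] by (simp add: field_simps)
qed

lemma metric_operator_at:
  assumes card: "CARD('n) = 6" and x: "x \<in> S" and sol: "solution H p" and e: "cyclic_vector ((*v) (operator H x)) e"
  shows "metric_operator (form (G x)) ((*v) (operator H x)) e"
proof (intro metric_operator.intro metric_space_form x metric_operator_axioms.intro matrix_vector_mul_linear e)
  show "form (G x) (operator H x *v z) w = form (G x) z (operator H x *v w)" for z w
    using g_sym[OF x, of "operator H x *v z" w] solution_sym[OF sol x] by (simp add: g_operator[OF x])
  show "DIM(real^'n) = 6" using card by simp
qed

lemma constant_type_or_pencil_at:
  assumes card: "CARD('n) = 6" and x: "x \<in> S" and sol: "solution H p" and sol': "solution H' p'"
    and e: "cyclic_vector ((*v) (operator H x)) e"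
  shows "(\<exists>k. constant_type x k) \<or> (\<exists>a b. H' x = a *\<^sub>R G x + b *\<^sub>R H x)"
proof -
  have pd: "p differentiable (at x)" "p' differentiable (at x)"
    using sol sol' x smooth_on_differentiable by (auto simp: solution_def)
  interpret metric_operator "form (G x)" "(*v) (operator H x)" e
    by (rule metric_operator_at[OF card x sol e])
  have bil: "bilinear (hess p x)" "bilinear (hess p' x)"
    using hess_linear[OF x] pd by (auto simp: bilinear_def)
  have R: "form (G x) (Riem x u v z) (operator H x *v w) + form (G x) (Riem x u v w) (operator H x *v z)
      + (hess p x u z * form (G x) v w + hess p x u w * form (G x) v z - hess p x v z * form (G x) u w - hess p x v w * form (G x) u z) = 0"
    if "solution H p" for H p u v z w
    using solution_ricci[OF that x, of u v z w] solution_sym[OF that x, of z] by (simp add: g_operator[OF x])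
  interpret curvature_operator "form (G x)" "(*v) (operator H x)" e "Riem x" "hess p x"
    by (intro curvature_operator.intro metric_operator_axioms curvature_operator_axioms.intro)
      (rule Riem_linear[OF x] Riem_skew Riem_metric[OF x] Riem_bianchi[OF x] bil hess_sym[OF sol x] R[OF sol])+
  have "(\<exists>a b. \<forall>z. operator H' x *v z = a *\<^sub>R z + b *\<^sub>R (operator H x *v z)) \<or>
     (\<exists>k. \<forall>u v z. Riem x u v z = k *\<^sub>R (form (G x) v z *\<^sub>R u - form (G x) u z *\<^sub>R v))"
  proof (rule constant_type_or_pencil[OF matrix_vector_mul_linear _ bil(2) hess_sym[OF sol' x] R[OF sol']])
    show "form (G x) (operator H' x *v z) w = form (G x) z (operator H' x *v w)" for z w
      using metric_chart.g_sym[OF metric_chart_axioms x, of "operator H' x *v z" w] solution_sym[OF sol' x] by (simp add: g_operator[OF x])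
  qed
  then show ?thesis
  proof
    assume "\<exists>a b. \<forall>z. operator H' x *v z = a *\<^sub>R z + b *\<^sub>R (operator H x *v z)"
    then obtain a b where ab: "\<And>z. operator H' x *v z = a *\<^sub>R z + b *\<^sub>R (operator H x *v z)" by blast
    have "H' x = a *\<^sub>R G x + b *\<^sub>R H x"
      by (rule form_ext) (simp add: g_operator[OF x, of _ H', symmetric] ab form_simps g_operator[OF x])
    then show ?thesis by blast
  qed (auto simp: constant_type_def)
qed

text \<open>The only candidate for \<open>k\<close> is a multiple of the smooth function
  \<open>scal\<close>, so constant type is the vanishing of continuous expressions.\<close>

lemma not_constant_type_open:
  assumes x: "x \<in> S" and not: "\<nexists>k. constant_type x k" and card: "CARD('n) \<ge> 2"
  shows "\<exists>N. open N \<and> x \<in> N \<and> N \<subseteq> S \<and> (\<forall>y\<in>N. \<nexists>k. constant_type y k)"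
proof -
  let ?m = "real CARD('n) * (real CARD('n) - 1)"
  have m: "?m \<noteq> 0" using card by simp
  obtain u v z where ne: "Riem x u v z \<noteq> (scal x / ?m) *\<^sub>R (form (G x) v z *\<^sub>R u - form (G x) u z *\<^sub>R v)"
    using not unfolding constant_type_def by blast
  define F where "F y = Riem y u v z - (scal y / ?m) *\<^sub>R (form (G y) v z *\<^sub>R u - form (G y) u z *\<^sub>R v)" for y
  have "smooth_on S F"
    unfolding F_def[abs_def] using S G_smooth scal_smooth m
    by (intro smooth_on_diff Riem_smooth smooth_on_scaleR smooth_on_divide smooth_on_form smooth_on_const) auto
  then have "continuous_on S F" by (rule smooth_on_imp_continuous_on)
  moreover have "open (- {0 :: real^'n})" by (simp add: open_Compl)
  ultimately have "open (S \<inter> F -` (- {0}))" using continuous_on_open_vimage[OF S] by (metis Int_commute)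
  moreover have "\<nexists>k. constant_type y k" if "y \<in> S" "F y \<noteq> 0" for y
  proof
    assume "\<exists>k. constant_type y k"
    then obtain k where k: "constant_type y k" by blast
    then have "k = scal y / ?m" using constant_type_scal[OF that(1)] m by simp
    then show False using k that(2) by (simp add: F_def constant_type_def)
  qed
  ultimately show ?thesis using x ne
    by (intro exI[of _ "S \<inter> F -` (- {0})"]) (auto simp: F_def)
qed

text \<open>For a multiple of the identity, \<open>e\<close> and its image would be dependent.
  Consequently the coefficients of a pencil of \<open>G\<close> and \<open>H\<close> are
  unique.\<close>

lemma not_proportional:
  assumes card: "CARD('n) = 6" and x: "x \<in> S" and cyc: "\<exists>e. cyclic_vector ((*v) (operator H x)) e"
  shows "H x \<noteq> c *\<^sub>R G x"
proof
  assume "H x = c *\<^sub>R G x"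
  then have op: "operator H x *v z = c *\<^sub>R z" for z
    by (simp add: operator_def matrix_vector_mul_assoc[symmetric] scaleR_matrix_vector_assoc[symmetric] matrix_vector_mult_scaleR inv_G[OF x])
  obtain e where e: "cyclic_vector ((*v) (operator H x)) e" using cyc by blast
  have "DIM(real^'n) = 6" using card by simp
  from cyclic_vector_6D[OF e this, of "- c" 1 0 0 0 0] show False by (simp add: op)
qed

text \<open>The radius is chosen before \<open>H'\<close>, so that one ball serves all fields of the
  Lie algebra simultaneously.\<close>

lemma pencil_coefficients_constant:
  assumes card: "CARD('n) = 6" and sol: "solution H p" and N: "open N" "N \<subseteq> S" "x0 \<in> N"
    and cyc: "\<And>x. x \<in> N \<Longrightarrow> \<exists>e. cyclic_vector ((*v) (operator H x)) e"
  shows "\<exists>r>0. ball x0 r \<subseteq> N \<and> (\<forall>H' p'. solution H' p' \<longrightarrow> (\<forall>x\<in>N. \<exists>a b. H' x = a *\<^sub>R G x + b *\<^sub>R H x) \<longrightarrow>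
     (\<exists>a b. \<forall>x\<in>ball x0 r. H' x = a *\<^sub>R G x + b *\<^sub>R H x))"
proof -
  have x0: "x0 \<in> S" using N by blast
  have Hs: "smooth_on S H" using sol by (simp add: solution_def)
  \<comment> \<open>A nonzero two by two minor of the components of \<open>G\<close> and
    \<open>H\<close>. By Cramer's rule it makes the coefficients of every pencil smooth near
    \<open>x0\<close>.\<close>
  have "\<exists>i j k l. G x0 $ i $ j * H x0 $ k $ l - G x0 $ k $ l * H x0 $ i $ j \<noteq> 0"
  proof (rule ccontr)
    assume "\<not> ?thesis"
    then have *: "G x0 $ i $ j * H x0 $ k $ l = G x0 $ k $ l * H x0 $ i $ j" for i j k l by auto
    have "G x0 \<noteq> 0"
      using form_nondeg[OF x0, of "axis undefined 1"] by (auto simp: form_simps)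
    then obtain i j where ij: "G x0 $ i $ j \<noteq> 0" by (auto simp: Finite_Cartesian_Product.vec_eq_iff)
    have "H x0 = (H x0 $ i $ j / G x0 $ i $ j) *\<^sub>R G x0"
      using *[of i j] ij by (simp add: Finite_Cartesian_Product.vec_eq_iff field_simps)
    then show False using not_proportional[OF card x0 cyc[OF N(3)]] by blast
  qed
  then obtain i j k l where ne: "G x0 $ i $ j * H x0 $ k $ l - G x0 $ k $ l * H x0 $ i $ j \<noteq> 0" by blast
  define D where "D x = G x $ i $ j * H x $ k $ l - G x $ k $ l * H x $ i $ j" for x
  have "smooth_on S D" unfolding D_def[abs_def] using S G_smooth Hs by (intro smooth_on_diff smooth_on_mult smooth_on_vec_nth)
  then have "continuous_on N D" using smooth_on_imp_continuous_on N(2) continuous_on_subset by blast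
  moreover have "open (- {0 :: real})" by (simp add: open_Compl)
  ultimately have "open (N \<inter> D -` (- {0}))" using continuous_on_open_vimage[OF N(1)] by (metis Int_commute)
  moreover have "x0 \<in> N \<inter> D -` (- {0})" using N ne by (simp add: D_def)
  ultimately obtain r where r: "r > 0" "ball x0 r \<subseteq> N \<inter> D -` (- {0})" using open_contains_ball by blast
  show ?thesis
  proof (rule exI[of _ r], intro conjI allI impI)
    show "r > 0" "ball x0 r \<subseteq> N" using r by auto
    fix H' p' assume sol': "solution H' p'" and pencil: "\<forall>x\<in>N. \<exists>a b. H' x = a *\<^sub>R G x + b *\<^sub>R H x"
    define B where "B = ball x0 r"
    have B: "open B" "B \<subseteq> S" "B \<subseteq> N" using r N by (auto simp: B_def)
    have BD: "D x \<noteq> 0" if "x \<in> B" for x using r that by (auto simp: B_def)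
    define a where "a x = (H' x $ i $ j * H x $ k $ l - H' x $ k $ l * H x $ i $ j) / D x" for x
    define b where "b x = (G x $ i $ j * H' x $ k $ l - G x $ k $ l * H' x $ i $ j) / D x" for x
    have ab: "H' x = a x *\<^sub>R G x + b x *\<^sub>R H x" if x: "x \<in> B" for x
    proof -
      obtain a' b' where *: "H' x = a' *\<^sub>R G x + b' *\<^sub>R H x" using pencil x B by blast
      have "a x = a'" "b x = b'" using BD[OF x] by (simp_all add: a_def b_def * field_simps D_def)
      then show ?thesis using * by simp
    qed
    have H's: "smooth_on B H'" "smooth_on B H" "smooth_on B G" "smooth_on B D"
      using sol' Hs G_smooth \<open>smooth_on S D\<close> B(2) smooth_on_subset by (auto simp: solution_def)
    have smab: "smooth_on B a" "smooth_on B b"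
      unfolding a_def[abs_def] b_def[abs_def] using H's B BD
      by (intro smooth_on_divide smooth_on_diff smooth_on_mult smooth_on_vec_nth; auto)+
    have zero: "dd u a x = 0 \<and> dd u b x = 0" if x: "x \<in> B" for u x
    proof -
      have xS: "x \<in> S" using x B by blast
      obtain e where e: "cyclic_vector ((*v) (operator H x)) e" using cyc x B by blast
      interpret m: metric_operator "form (G x)" "(*v) (operator H x)" e
        by (rule metric_operator_at[OF card xS sol e])
      \<comment> \<open>What is left of the gradient of \<open>H'\<close> after removing the share
        of \<open>H\<close>; the metric has zero gradient and contributes nothing.\<close>
      define \<sigma> where "\<sigma> = p' x - b x *\<^sub>R p x"
      have ds: "a differentiable (at x)" "b differentiable (at x)" "G differentiable (at x)" "H differentiable (at x)"
        using smab H's x smooth_on_differentiable by blast+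
      have dH': "dd u H' x = (a x *\<^sub>R dd u G x + dd u a x *\<^sub>R G x) + (b x *\<^sub>R dd u H x + dd u b x *\<^sub>R H x)" for u
      proof -
        have "dd u H' x = dd u (\<lambda>y. a y *\<^sub>R G y + b y *\<^sub>R H y) x" by (rule dd_cong[OF B(1) x ab])
        then show ?thesis
          by (simp add: dd_add differentiable_bounded_bilinear[OF bounded_bilinear_scaleR] ds dd_bounded_bilinear[OF bounded_bilinear_scaleR])
      qed
      \<comment> \<open>Subtracting the Eisenhart equations from the differentiated pencil cancels
        the connection terms. For fixed \<open>u\<close> the left side is a pencil in
        \<open>z\<close> and \<open>w\<close>, while the right side has rank at most two.\<close>
      have eq: "(dd u a x - 2 * (\<sigma> \<bullet> u)) * form (G x) z w + dd u b x * form (H x) z w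
          = (\<sigma> \<bullet> z) * form (G x) u w + form (G x) u z * (\<sigma> \<bullet> w)" for u z w
      proof -
        note 1 = solutionD(5)[OF sol xS] and 2 = solutionD(5)[OF sol' xS, of u z w]
        show ?thesis
          using 2 unfolding dH' ab[OF x] form_simps 1 dG[OF xS] \<sigma>_def
          by (simp add: inner_simps algebra_simps)
      qed
      have lin: "linear (\<lambda>z. \<sigma> \<bullet> z)" "linear (\<lambda>z. form (G x) u z)" for u
        using bilinear_form[of "G x"] by (auto intro!: linearI simp: inner_simps bilinear_def)
      have ab0: "dd u a x - 2 * (\<sigma> \<bullet> u) = 0 \<and> dd u b x = 0" for u
        by (rule m.pencil_rank_le_2_imp_0[OF lin(1) lin(2)[of u]])
          (use eq m.A_selfadjoint in \<open>simp add: g_operator[OF xS]\<close>)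
      \<comment> \<open>The left side of \<open>eq\<close> is now zero. If
        \<open>\<sigma> \<bullet> z\<close> were nonzero, \<open>w = z\<close> would make
        \<open>z\<close> orthogonal to every \<open>u\<close>. Once \<open>\<sigma>\<close> is gone,
        so is the differential of \<open>a\<close>.\<close>
      have "\<sigma> \<bullet> z = 0" for z
      proof (rule ccontr)
        assume z: "\<sigma> \<bullet> z \<noteq> 0"
        have "form (G x) z u = 0" for u
          using eq[of u z z] ab0[of u] z g_sym[OF xS, of u z] by auto
        then have "z = 0" by (rule form_nondeg[OF xS])
        then show False using z by simp
      qed
      then show ?thesis using ab0[of u] by simp
    qed
    have const: "f x = f x0" if f: "smooth_on B f" "\<And>u x. x \<in> B \<Longrightarrow> dd u f x = 0" and x: "x \<in> B" for f :: "real^'n \<Rightarrow> real" and x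
    proof -
      have "(f has_derivative (\<lambda>h. 0)) (at y within B)" if "y \<in> B" for y
        using has_derivative_dd[OF smooth_on_differentiable[OF f(1) that]] f(2)[OF that] has_derivative_at_withinI by auto
      then obtain c where "\<And>y. y \<in> B \<Longrightarrow> f y = c"
        using has_derivative_zero_constant[of B f] by (auto simp: B_def)
      then show ?thesis using x r by (simp add: B_def)
    qed
    have "H' x = a x0 *\<^sub>R G x + b x0 *\<^sub>R H x" if "x \<in> B" for x
      using ab[OF that] const[OF smab(1) _ that] const[OF smab(2) _ that] zero by simp
    then show "\<exists>a b. \<forall>x\<in>ball x0 r. H' x = a *\<^sub>R G x + b *\<^sub>R H x"
      unfolding B_def by blast
  qed
qed

text \<open>Constant type everywhere makes the Hessian of the potential a pencil
  \<open>m G - k H\<close>. The integrability condition of this equation for \<open>p\<close>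
  relates the differentials of \<open>m\<close> and \<open>k\<close> so tightly that a cyclic vector
  forces the latter to vanish.\<close>

lemma schur:
  assumes card: "CARD('n) = 6" and sol: "solution H p"
    and cyc: "\<And>x. x \<in> S \<Longrightarrow> \<exists>e. cyclic_vector ((*v) (operator H x)) e"
    and ct: "\<And>x. x \<in> S \<Longrightarrow> \<exists>k. constant_type x k" and x: "x \<in> S"
  shows "dd v scal x = 0"
proof -
  define k where "k y = scal y / 30" for y
  have k: "constant_type y (k y)" if y: "y \<in> S" for y
  proof -
    obtain c where c: "constant_type y c" using ct[OF y] by blast
    then have "c = k y" using constant_type_scal[OF y c] card by (simp add: k_def)
    then show ?thesis using c by simp
  qed
  note Hs = solutionD(1)[OF sol] and ps = solutionD(2)[OF sol] and eq = solutionD(5)[OF sol]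
  have ks: "smooth_on S k"
    unfolding k_def[abs_def] using S scal_smooth by (intro smooth_on_divide smooth_on_const) auto
  define m where "m y = (hess_trace p y + k y * (\<Sum>j\<in>UNIV. form (H y) (axis j 1) (up y j))) / CARD('n)" for y
  have ms: "smooth_on S m"
    unfolding m_def[abs_def] using S ks Hs up_smooth
    by (intro hess_trace_smooth[OF ps] smooth_on_divide smooth_on_add smooth_on_mult smooth_on_sum smooth_on_form smooth_on_const) auto
  have h: "dd u p y \<bullet> z = p y \<bullet> Gam y u z + (m y * form (G y) u z - k y * form (H y) u z)" if "y \<in> S" for u z y
    using constant_type_hess[OF that k[OF that] sol, of u z] by (simp add: m_def hess_def)
  have ds: "m differentiable (at x)" "k differentiable (at x)" "H differentiable (at x)" "p differentiable (at x)" "G differentiable (at x)"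
    using ms ks Hs ps G_smooth x smooth_on_differentiable by blast+
  have second: "dd v (dd u p) x \<bullet> z = dd v p x \<bullet> Gam x u z + p x \<bullet> dd v (\<lambda>y. Gam y u z) x
      + (dd v m x * form (G x) u z + m x * form (dd v G x) u z - (dd v k x * form (H x) u z + k x * form (dd v H x) u z))" for u v z
  proof -
    have "dd v (dd u p) x \<bullet> z = dd v (\<lambda>y. dd u p y \<bullet> z) x"
      using S ps x by (intro dd_bounded_linear[OF bounded_linear_inner_left, symmetric] smooth_on_differentiable[OF smooth_on_dd])
    also have "\<dots> = dd v (\<lambda>y. p y \<bullet> Gam y u z + (m y * form (G y) u z - k y * form (H y) u z)) x"
      by (rule dd_cong[OF S x h])
    also have "\<dots> = dd v p x \<bullet> Gam x u z + p x \<bullet> dd v (\<lambda>y. Gam y u z) x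
      + (dd v m x * form (G x) u z + m x * form (dd v G x) u z - (dd v k x * form (H x) u z + k x * form (dd v H x) u z))"
      by (simp add: dd_add dd_diff differentiable_diff differentiable_bounded_bilinear[OF bounded_bilinear_mult]
          differentiable_bounded_bilinear[OF bounded_bilinear_inner] differentiable_form ds Gam_diff x
          dd_bounded_bilinear[OF bounded_bilinear_mult] dd_bounded_bilinear[OF bounded_bilinear_inner] dd_form_const)
    finally show ?thesis .
  qed
  \<comment> \<open>Mixed derivatives of \<open>p\<close> commute, and the curvature term is
    replaced by its space-form value; the terms without derivatives of \<open>k\<close> and
    \<open>m\<close> then cancel.\<close>
  have key: "dd v k x * form (H x) u z - dd u k x * form (H x) v z
     + (- dd v m x) * form (G x) u z - (- dd u m x) * form (G x) v z = 0" for u v z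
  proof -
    have "dd v (dd u p) x \<bullet> z = dd u (dd v p) x \<bullet> z" using dd_dd_commute[OF S x ps] by simp
    moreover have "Riem x v u z = k x *\<^sub>R (form (G x) u z *\<^sub>R v - form (G x) v z *\<^sub>R u)"
      using k[OF x] by (simp add: constant_type_def)
    then have "p x \<bullet> Riem x v u z = k x * (form (G x) u z * (p x \<bullet> v) - form (G x) v z * (p x \<bullet> u))"
      by (simp add: inner_simps)
    ultimately show ?thesis
      unfolding second h[OF x] eq[OF x] dG[OF x] Riem_def
      using Gam_sym[OF x, of u v] g_sym[OF x, of u v]
      by (simp add: form_simps inner_simps algebra_simps)
  qed
  obtain e where e: "cyclic_vector ((*v) (operator H x)) e" using cyc x by blast
  interpret mo: metric_operator "form (G x)" "(*v) (operator H x)" e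
    by (rule metric_operator_at[OF card x sol e])
  have "dd v k x = 0"
  proof (rule mo.wedge_eq_0_imp[OF linear_dd[OF ds(2)], where m="\<lambda>v. - dd v m x"])
    show "dd v k x * form (G x) (operator H x *v u) z - dd u k x * form (G x) (operator H x *v v) z
       + (- dd v m x) * form (G x) u z - (- dd u m x) * form (G x) v z = 0" for u v z
      using key[of v u z] mo.A_selfadjoint by (simp add: g_operator[OF x])
  qed
  moreover have "dd v k x = dd v scal x / 30"
    unfolding k_def[abs_def] using smooth_on_differentiable[OF scal_smooth x]
    by (intro dd_bounded_linear[OF bounded_linear_divide])
  ultimately show ?thesis by simp
qed

text \<open>It reduces the behaviour of the Hessian under a change of chart to the naturality of the
  Lie derivative. The connection terms cancel by the symmetry of \<open>Gam\<close>.\<close>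

lemma lie_grad:
  assumes p: "smooth_on S p" and x: "x \<in> S"
  shows "lie (\<lambda>y. matrix_inv (G y) *v p y) G x u w = hess p x u w + hess p x w u"
proof -
  define V where "V y = matrix_inv (G y) *v p y" for y
  have Vs: "smooth_on S V" unfolding V_def[abs_def] using S inv_smooth p by (intro smooth_on_matrix_vector)
  have Vd: "V differentiable (at x)" "p differentiable (at x)" using Vs p x smooth_on_differentiable by blast+
  have gV: "form (G y) z (V y) = p y \<bullet> z" if "y \<in> S" for y z
    using G_inv[OF that] by (simp add: form_def V_def inner_commute)
  have dV: "form (G x) z (dd u V x) = hess p x u z - form (G x) z (Gam x u (V x))" for u z
  proof -
    have "dd u p x \<bullet> z = dd u (\<lambda>y. p y \<bullet> z) x"
      by (rule dd_bounded_linear[OF bounded_linear_inner_left Vd(2), symmetric])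
    also have "\<dots> = dd u (\<lambda>y. form (G y) z (V y)) x"
      by (rule dd_cong[OF S x]) (simp add: gV)
    also have "\<dots> = form (dd u G x) z (V x) + form (G x) z (dd u V x)"
      by (simp add: dd_form G_diff x Vd form_simps)
    finally show ?thesis using gV[OF x, of "Gam x u z"] by (simp add: dG[OF x] hess_def)
  qed
  have "lie V G x u w = hess p x u w + hess p x w u"
    unfolding lie_def dG[OF x] g_sym[OF x, of "dd u V x" w] dV
    using Gam_sym[OF x, of "V x"] g_sym[OF x, of "Gam x u (V x)" w] by (simp)
  then show ?thesis by (simp add: V_def[abs_def])
qed

end

subsection \<open>Index notation\<close>

lemma det_nonzero_if_has_signature:
  fixes A :: "real^'n^'n::finite"
  assumes "has_signature A p q"
  shows "Determinants.det A \<noteq> 0"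
proof -
  obtain P :: "real^'n^'n" and \<epsilon> :: "'n \<Rightarrow> real" where P: "transpose P ** A ** P = (\<chi> i j. if i = j then \<epsilon> i else 0)" and \<epsilon>: "range \<epsilon> \<subseteq> {1, -1 :: real}"
    using assms unfolding has_signature_def by blast
  have "Determinants.det (\<chi> i j. if i = j then \<epsilon> i else 0) = (\<Prod>i\<in>UNIV. \<epsilon> i)"
    by (subst Determinants.det_diagonal) auto
  moreover have "(\<Prod>i\<in>UNIV. \<epsilon> i) \<noteq> 0" using \<epsilon> by (auto simp: prod_zero_iff) (metis insertE rangeI singletonD subsetD zero_neq_neg_one zero_neq_one)
  ultimately have "Determinants.det (transpose P ** A ** P) \<noteq> 0" by (simp add: P)
  then show ?thesis by (auto simp: Determinants.det_mul)
qed

lemma dd_vec_nth: "f differentiable (at x) \<Longrightarrow> dd v (\<lambda>y. f y $ i) x = dd v f x $ i"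
  by (rule dd_bounded_linear[OF bounded_linear_vec_nth])

lemma dd_matrix_nth: "M differentiable (at x) \<Longrightarrow> dd v (\<lambda>y. M y $ i $ j) x = form (dd v M x) (axis i 1) (axis j 1)"
  for M :: "real^'n \<Rightarrow> real^'n^'n::finite"
  by (simp add: form_axis dd_vec_nth differentiable_bounded_linear[OF bounded_linear_vec_nth])

lemma form_row: "form M v (axis j 1) = (\<Sum>l\<in>UNIV. v $ l * M $ l $ j)" "form M (axis j 1) v = (\<Sum>l\<in>UNIV. M $ j $ l * v $ l)"
proof -
  have "form M v (axis j 1) = form M (\<Sum>l\<in>UNIV. v $ l *\<^sub>R axis l 1) (axis j 1)" by (simp only: vec_expansion[symmetric])
  then show "form M v (axis j 1) = (\<Sum>l\<in>UNIV. v $ l * M $ l $ j)" by (simp only: form_sum form_simps form_axis)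
  have "form M (axis j 1) v = form M (axis j 1) (\<Sum>l\<in>UNIV. v $ l *\<^sub>R axis l 1)" by (simp only: vec_expansion[symmetric])
  then show "form M (axis j 1) v = (\<Sum>l\<in>UNIV. M $ j $ l * v $ l)" by (simp only: form_sum form_simps form_axis mult.commute)
qed

lemma linear_eq_0_on_axes:
  fixes f :: "real^'n::finite \<Rightarrow> 'b::real_vector"
  assumes "linear f" "\<And>i. f (axis i 1) = 0"
  shows "f v = 0"
proof -
  have "f v = f (\<Sum>l\<in>UNIV. v $ l *\<^sub>R axis l 1)" by (simp only: vec_expansion[symmetric])
  then show ?thesis using assms by (simp add: linear_sum linear_cmul)
qed

lemma lie_bilinear:
  assumes "H differentiable (at x)" "V differentiable (at x)"
  shows "bilinear (lie V H x)"
  using assms by (auto intro!: linearI simp: bilinear_def lie_def form_simps dd_direction_simps algebra_simps)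

lemma form_lie_deriv:
  assumes H: "H differentiable (at x)" and V: "V differentiable (at x)"
  shows "form (lie_deriv V H x) z w = lie V H x z w"
proof -
  have Hij: "(\<lambda>y. H y $ i $ j) differentiable (at x)" for i j
    by (intro differentiable_bounded_linear[OF bounded_linear_vec_nth] H)
  have "lie_deriv V H x $ i $ j = lie V H x (axis i 1) (axis j 1)" for i j
  proof -
    have 1: "form (dd (V x) H x) (axis i 1) (axis j 1) = (\<Sum>k\<in>UNIV. V x $ k * pd k (\<lambda>y. H y $ i $ j) x)"
      using dd_matrix_nth[OF H, of "V x" i j] dd_eq_sum_pd[OF Hij, of "V x" i j] by simp
    have 2: "form (H x) (dd (axis i 1) V x) (axis j 1) = (\<Sum>k\<in>UNIV. H x $ k $ j * pd i (\<lambda>y. V y $ k) x)"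
      "form (H x) (axis i 1) (dd (axis j 1) V x) = (\<Sum>k\<in>UNIV. H x $ i $ k * pd j (\<lambda>y. V y $ k) x)"
      by (simp_all add: form_row pd_eq_dd dd_vec_nth[OF V] mult.commute)
    show ?thesis by (simp add: lie_deriv_def lie_def 1 2 sum.distrib)
  qed
  then show ?thesis
    by (simp only: bilinear_expansion[OF bilinear_form, of _ z w] bilinear_expansion[OF lie_bilinear[OF H V], of z w] form_axis)
qed

lemma smooth_on_lie_deriv:
  assumes S: "open S" and H: "smooth_on S H" and V: "smooth_on S V"
  shows "smooth_on S (lie_deriv V H)"
  unfolding lie_deriv_def[abs_def] using assms
  by (intro smooth_on_vecI) (simp_all, intro smooth_on_sum smooth_on_add smooth_on_mult smooth_on_vec_nth smooth_on_pd, auto)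

lemma lie_deriv_transpose:
  assumes "\<And>z w. lie V H x z w = lie V H x w z" "H differentiable (at x)" "V differentiable (at x)"
  shows "transpose (lie_deriv V H x) = lie_deriv V H x"
  using form_lie_deriv[OF assms(2,3)] assms(1)
  by (simp add: Finite_Cartesian_Product.vec_eq_iff Finite_Cartesian_Product.transpose_def form_axis[symmetric])

lemma bracket_eq:
  assumes "V differentiable (at x)" "W differentiable (at x)"
  shows "bracket V W x = dd (V x) W x - dd (W x) V x"
  using assms
  by (simp add: bracket_def Finite_Cartesian_Product.vec_eq_iff dd_eq_sum_pd sum_subtractf pd_eq_dd dd_vec_nth)

section \<open>Index formulas translated into vector form\<close>

context metric_chart
begin

lemma christoffel_eq: "x \<in> S \<Longrightarrow> christoffel G x k i j = Gam x (axis i 1) (axis j 1) $ k"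
  by (simp add: christoffel_def Gam_def koszul_def matrix_vector_mult_def pd_eq_dd dd_matrix_nth[OF G_diff] sum_divide_distrib)

lemma Gam_axis: "x \<in> S \<Longrightarrow> Gam x (axis k 1) w = (\<Sum>m\<in>UNIV. w $ m *\<^sub>R Gam x (axis k 1) (axis m 1))"
proof -
  assume x: "x \<in> S"
  have lin: "linear (Gam x (axis k 1))" using Gam_bilinear[OF x] by (simp add: bilinear_def)
  have "Gam x (axis k 1) w = Gam x (axis k 1) (\<Sum>l\<in>UNIV. w $ l *\<^sub>R axis l 1)" by (simp only: vec_expansion[symmetric])
  then show ?thesis by (simp add: linear_sum[OF lin] linear_cmul[OF lin])
qed

lemma riemann_eq:
  assumes x: "x \<in> S"
  shows "riemann G x i j k l = Riem x (axis k 1) (axis l 1) (axis j 1) $ i"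
proof -
  have "pd k (\<lambda>y. christoffel G y i l j) x = dd (axis k 1) (\<lambda>y. Gam y (axis l 1) (axis j 1)) x $ i" for k l
    unfolding pd_eq_dd dd_vec_nth[OF Gam_diff[OF x], symmetric]
    by (rule dd_cong[OF S x]) (simp add: christoffel_eq)
  moreover have "(\<Sum>m\<in>UNIV. christoffel G x i k m * christoffel G x m l j) = Gam x (axis k 1) (Gam x (axis l 1) (axis j 1)) $ i" for k l
    by (subst Gam_axis[OF x, of k "Gam x (axis l 1) (axis j 1)"]) (simp add: christoffel_eq[OF x] mult.commute)
  ultimately show ?thesis by (simp add: riemann_def Riem_def sum_subtractf)
qed

lemma cov_deriv_eq:
  assumes x: "x \<in> S" and H: "H differentiable (at x)"
  shows "cov_deriv G H x i j k = form (dd (axis k 1) H x) (axis i 1) (axis j 1)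
     - form (H x) (Gam x (axis k 1) (axis i 1)) (axis j 1) - form (H x) (axis i 1) (Gam x (axis k 1) (axis j 1))"
  by (simp add: cov_deriv_def christoffel_eq[OF x] pd_eq_dd dd_matrix_nth[OF H] form_row Gam_sym[OF x, of "axis k 1"] mult.commute)

text \<open>The index equation says that a trilinear expression \<open>E\<close> vanishes on basis
  vectors. The closedness of the gradient is the symmetry of the second derivatives of
  \<open>\<phi>\<close>.\<close>

lemma solution_if_eisenhart:
  assumes H: "smooth_on S H" and sym: "\<And>x. x \<in> S \<Longrightarrow> transpose (H x) = H x" and phi: "smooth_on S \<phi>"
    and eis: "\<And>x i j k. x \<in> S \<Longrightarrow> cov_deriv G H x i j k =
      2 * G x $ i $ j * pd k \<phi> x + G x $ i $ k * pd j \<phi> x + G x $ j $ k * pd i \<phi> x"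
  shows "solution H (\<lambda>x. \<chi> i. pd i \<phi> x)"
proof -
  let ?p = "\<lambda>x. \<chi> i. pd i \<phi> x"
  have ps: "smooth_on S ?p" using S phi by (intro smooth_on_vecI) (auto intro: smooth_on_pd)
  have p: "?p y \<bullet> u = dd u \<phi> y" if "y \<in> S" for y u
    using dd_eq_sum_pd[OF smooth_on_differentiable[OF phi that], of u] by (simp add: inner_vec_def mult.commute)
  have closed: "dd u ?p x \<bullet> v = dd v ?p x \<bullet> u" if x: "x \<in> S" for x u v
  proof -
    have "dd u ?p x \<bullet> v = dd u (dd v \<phi>) x" for u v
    proof -
      have "dd u ?p x \<bullet> v = dd u (\<lambda>y. ?p y \<bullet> v) x"
        by (rule dd_bounded_linear[OF bounded_linear_inner_left smooth_on_differentiable[OF ps x], symmetric])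
      also have "\<dots> = dd u (dd v \<phi>) x" by (rule dd_cong[OF S x p])
      finally show ?thesis .
    qed
    then show ?thesis using dd_dd_commute[OF S x phi] by simp
  qed
  have eq: "form (dd u H x) z w = form (H x) (Gam x u z) w + form (H x) z (Gam x u w)
        + 2 * (?p x \<bullet> u) * form (G x) z w + (?p x \<bullet> z) * form (G x) u w + (?p x \<bullet> w) * form (G x) u z" if x: "x \<in> S" for x u z w
  proof -
    have Hd: "H differentiable (at x)" using H x smooth_on_differentiable by blast
    define E where "E u z w = form (dd u H x) z w - form (H x) (Gam x u z) w - form (H x) z (Gam x u w)
        - 2 * (?p x \<bullet> u) * form (G x) z w - (?p x \<bullet> z) * form (G x) u w - (?p x \<bullet> w) * form (G x) u z" for u z w
    have lin: "linear (E u z)" "linear (\<lambda>z. E u z w)" "linear (\<lambda>u. E u z w)" for u z w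
      unfolding E_def by (auto intro!: linearI simp: form_simps dd_direction_simps[OF Hd] Gam_simps[OF x] inner_simps algebra_simps)
    have e0: "E (axis k 1) (axis i 1) (axis j 1) = 0" for i j k
      using eis[OF x, of i j k] g_sym[OF x, of "axis k 1" "axis i 1"] g_sym[OF x, of "axis k 1" "axis j 1"]
      by (simp add: cov_deriv_eq[OF x Hd] E_def form_axis inner_axis algebra_simps)
    have e1: "E (axis k 1) (axis i 1) w = 0" for i k w
      by (rule linear_eq_0_on_axes[of "E (axis k 1) (axis i 1)", OF lin(1) e0])
    have e2: "E (axis k 1) z w = 0" for k z w
      by (rule linear_eq_0_on_axes[of "\<lambda>z. E (axis k 1) z w", OF lin(2) e1])
    have "E u z w = 0"
      by (rule linear_eq_0_on_axes[of "\<lambda>u. E u z w", OF lin(3) e2])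
    then show ?thesis by (simp add: E_def)
  qed
  show ?thesis using H sym ps closed eq by (simp add: solution_def)
qed

lemma divergence_smooth: "smooth_on S V \<Longrightarrow> smooth_on S (divergence G V)"
proof (rule smooth_on_cong[OF S])
  assume V: "smooth_on S V"
  show "smooth_on S (\<lambda>x. \<Sum>i\<in>UNIV. pd i (\<lambda>y. V y $ i) x + (\<Sum>k\<in>UNIV. Gam x (axis i 1) (axis k 1) $ i * V x $ k))"
    using S V by (intro smooth_on_sum smooth_on_add smooth_on_pd smooth_on_mult smooth_on_vec_nth Gam_smooth smooth_on_const)
qed (simp add: divergence_def christoffel_eq)

lemma lie_G_sym: "x \<in> S \<Longrightarrow> lie V G x z w = lie V G x w z"
  using g_sym[of x] dG_sym[of x "V x" z w] by (simp add: lie_def)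

lemma riemann_if_constant_type:
  assumes "x \<in> S" "constant_type x K"
  shows "riemann G x i j k l = K * ((if i = k then 1 else 0) * G x $ j $ l - (if i = l then 1 else 0) * G x $ j $ k)"
  using assms(2) g_sym[OF assms(1), of "axis l 1" "axis j 1"] g_sym[OF assms(1), of "axis k 1" "axis j 1"]
  by (simp add: riemann_eq[OF assms(1)] constant_type_def form_axis) (simp add: axis_def)

text \<open>It turns the claim that a solution equals \<open>c\<close> times the metric into the
  vanishing of a solution, to which \<open>solution_unique\<close> applies.\<close>

lemma solution_diff_metric:
  assumes "solution H p"
  shows "solution (\<lambda>x. H x - c *\<^sub>R G x) p"
proof -
  have H: "smooth_on S H" using assms by (simp add: solution_def)
  have d: "dd u (\<lambda>y. H y - c *\<^sub>R G y) x = dd u H x - c *\<^sub>R dd u G x" if "x \<in> S" for u x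
    using smooth_on_differentiable[OF H that] G_diff[OF that]
    by (simp add: dd_diff dd_bounded_linear[OF bounded_linear_scaleR_right] differentiable_bounded_linear[OF bounded_linear_scaleR_right])
  have "transpose (H x - c *\<^sub>R G x) = H x - c *\<^sub>R G x" if "x \<in> S" for x
    using assms G_sym[OF that] that
    by (auto simp: solution_def Finite_Cartesian_Product.vec_eq_iff Finite_Cartesian_Product.transpose_def)
  then show ?thesis
    using assms S G_smooth
    by (auto simp: solution_def d form_simps dG algebra_simps intro!: smooth_on_diff smooth_on_scaleR smooth_on_const)
qed

lemma metric_chart_subset: "open T \<Longrightarrow> T \<subseteq> S \<Longrightarrow> metric_chart T G"
  using G_smooth G_sym G_det smooth_on_subset by unfold_locales blast+

lemma solution_subset: "open T \<Longrightarrow> T \<subseteq> S \<Longrightarrow> solution H p \<Longrightarrow> metric_chart.solution T G H p"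
  unfolding metric_chart.solution_def[OF metric_chart_subset] solution_def
  by (auto intro: smooth_on_subset)

end

subsection \<open>Passing to the manifold\<close>

text \<open>A basis of \<open>H\<close> together with \<open>x\<close> is a basis of
  \<open>P\<close>. In particular \<open>r\<close> is positive, so the subtraction in
  \<open>r - 1\<close> is not truncated.\<close>

lemma has_dim_hyperplane:
  fixes P H :: "'v::real_vector set"
  assumes P: "has_dim P r" "subspace P" and H: "subspace H" "H \<subseteq> P"
    and x: "x \<in> P" "x \<notin> H" and span: "\<And>y. y \<in> P \<Longrightarrow> \<exists>c. y - c *\<^sub>R x \<in> H"
  shows "has_dim H (r - 1)"
proof -
  obtain B0 where B0: "finite B0" "independent B0" "span B0 = P" "card B0 = r"
    using P by (auto simp: has_dim_def)
  obtain B where B: "B \<subseteq> H" "independent B" "H \<subseteq> span B"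
    using maximal_independent_subset[of H] by blast
  have spB: "span B = H" using B H(1) by (meson span_minimal subset_antisym)
  have "x \<notin> span B" using x spB by simp
  then have ind: "independent (insert x B)" using B by (simp add: independent_insertI)
  have sub: "insert x B \<subseteq> span B0" using B H x B0 by auto
  have fin: "finite (insert x B)" and le: "card (insert x B) \<le> r"
    using independent_span_bound[OF B0(1) ind sub] B0 by auto
  have "B0 \<subseteq> span (insert x B)"
  proof
    fix y assume "y \<in> B0"
    then have "y \<in> P" using B0 span_superset by blast
    then obtain c where c: "y - c *\<^sub>R x \<in> H" using span by blast
    then show "y \<in> span (insert x B)"
      using spB by (auto simp: span_insert)
  qed
  then have "r \<le> card (insert x B)"
    using independent_span_bound[OF fin B0(2)] B0(4) by auto
  moreover have "x \<notin> B" using x B by blast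
  ultimately have "card B = r - 1" using le fin by simp
  then show ?thesis using B spB fin by (auto simp: has_dim_def)
qed

locale pseudo_riemannian_manifold =
  fixes C :: "('a::{t2_space, second_countable_topology}, 'n::finite) chart set"
    and g :: "('a, 'n) bilinears" and pos neg :: nat
  assumes atlas: "smooth_atlas C"
    and conn: "connected (UNIV :: 'a set)"
    and metric: "pseudo_riemannian C pos neg g"
    and card6: "CARD('n) = 6"
begin

lemma chart_open: "c \<in> C \<Longrightarrow> open (cdom c)" "c \<in> C \<Longrightarrow> open (cimg c)"
  "c \<in> C \<Longrightarrow> homeomorphism (cdom c) (cimg c) (cmap c) (cinv c)"
  using atlas by (auto simp: smooth_atlas_def)

lemma chart_cover: "\<exists>c\<in>C. q \<in> cdom c"
  using atlas by (auto simp: smooth_atlas_def)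

lemma cinv_cmap: "c \<in> C \<Longrightarrow> q \<in> cdom c \<Longrightarrow> cinv c (cmap c q) = q"
  using chart_open(3) homeomorphism_apply1 by blast

lemma cmap_in: "q \<in> cdom c \<Longrightarrow> cmap c q \<in> cimg c"
  by (simp add: cimg_def)

lemma cmap_cinv: "c \<in> C \<Longrightarrow> x \<in> cimg c \<Longrightarrow> cmap c (cinv c x) = x \<and> cinv c x \<in> cdom c"
  using chart_open(3)[of c] by (auto simp: homeomorphism_def)

lemma metric_chart:
  assumes c: "c \<in> C"
  shows "metric_chart (cimg c) (g c)"
proof
  show "open (cimg c)" by (rule chart_open(2)[OF c])
  show "smooth_on (cimg c) (g c)" "x \<in> cimg c \<Longrightarrow> transpose (g c x) = g c x" for x
    using metric c unfolding pseudo_riemannian_def symmetric_tensor_field_def by blast+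
  show "Determinants.det (g c x) \<noteq> 0" if "x \<in> cimg c" for x
  proof -
    have "has_signature (g c x) pos neg" using metric c that unfolding pseudo_riemannian_def by blast
    then show ?thesis by (rule det_nonzero_if_has_signature)
  qed
qed

lemma open_vimage_cmap:
  assumes "c \<in> C" "open N"
  shows "open (cdom c \<inter> cmap c -` N)"
  using chart_open(1)[OF assms(1)] homeomorphism_cont1[OF chart_open(3)[OF assms(1)]] assms(2)
  by (metis continuous_on_open_vimage Int_commute)

lemma open_image_cmap:
  assumes c: "c \<in> C" and T: "open T" "T \<subseteq> cdom c"
  shows "open (cmap c ` T)"
proof -
  have "openin (top_of_set (cdom c)) T" using T chart_open(1)[OF c] by (simp add: openin_open_eq)
  then have "openin (top_of_set (cimg c)) (cmap c ` T)"
    by (rule homeomorphism_imp_open_map[OF chart_open(3)[OF c]])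
  then show ?thesis using chart_open(2)[OF c] openin_open_eq by blast
qed

definition overlap :: "('a, 'n) chart \<Rightarrow> ('a, 'n) chart \<Rightarrow> (real^'n) set" where
  "overlap c d = cmap c ` (cdom c \<inter> cdom d)"

lemma overlap_open: "c \<in> C \<Longrightarrow> d \<in> C \<Longrightarrow> open (overlap c d)"
  unfolding overlap_def by (intro open_image_cmap) (auto intro: chart_open)

lemma overlap_subset: "overlap c d \<subseteq> cimg c"
  by (auto simp: overlap_def cimg_def)

lemma transition_smooth: "c \<in> C \<Longrightarrow> d \<in> C \<Longrightarrow> smooth_on (overlap c d) (transition c d)"
  using atlas by (simp add: smooth_atlas_def overlap_def)

lemma transition_cmap: "c \<in> C \<Longrightarrow> q \<in> cdom c \<Longrightarrow> transition c d (cmap c q) = cmap d q"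
  by (simp add: transition_def cinv_cmap)

lemma overlap_in:
  assumes "c \<in> C" "x \<in> overlap c d"
  shows "x \<in> cimg c" "transition c d x \<in> cimg d"
proof -
  obtain q where q: "q \<in> cdom c" "q \<in> cdom d" "x = cmap c q" using assms(2) by (auto simp: overlap_def)
  then show "x \<in> cimg c" "transition c d x \<in> cimg d"
    using assms(1) by (simp_all add: transition_cmap cmap_in)
qed

lemma transition_differentiable: "c \<in> C \<Longrightarrow> d \<in> C \<Longrightarrow> x \<in> overlap c d \<Longrightarrow> transition c d differentiable (at x)"
  using transition_smooth smooth_on_differentiable by blast

lemma jacobian_mult:
  assumes "c \<in> C" "d \<in> C" "x \<in> overlap c d"
  shows "jacobian c d x *v z = dd z (transition c d) x"
proof -
  have "linear (frechet_derivative (transition c d) (at x))"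
    using linear_dd[OF transition_differentiable[OF assms]] by (simp add: dd_def)
  then show ?thesis by (simp add: jacobian_def dd_def matrix_works)
qed

lemma vector_transition:
  assumes "vector_field C X" "c \<in> C" "d \<in> C" "x \<in> overlap c d"
  shows "X d (transition c d x) = dd (X c x) (transition c d) x"
proof -
  obtain q where q: "q \<in> cdom c \<inter> cdom d" "x = cmap c q" using assms(4) by (auto simp: overlap_def)
  have "X d (cmap d q) = jacobian c d (cmap c q) *v X c (cmap c q)"
    using assms(1) assms(2,3) q(1) unfolding vector_field_def by blast
  then show ?thesis using q assms by (simp add: transition_cmap jacobian_mult)
qed

lemma tensor_transition:
  assumes "symmetric_tensor_field C h" "c \<in> C" "d \<in> C" "x \<in> overlap c d"
  shows "form (h c x) z w = form (h d (transition c d x)) (dd z (transition c d) x) (dd w (transition c d) x)"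
proof -
  obtain q where q: "q \<in> cdom c \<inter> cdom d" "x = cmap c q" using assms(4) by (auto simp: overlap_def)
  have "h c (cmap c q) = transpose (jacobian c d (cmap c q)) ** h d (cmap d q) ** jacobian c d (cmap c q)"
    using assms(1) assms(2,3) q(1) unfolding symmetric_tensor_field_def by blast
  then have "h c x = transpose (jacobian c d x) ** h d (transition c d x) ** jacobian c d x"
    using q assms(2) by (simp add: transition_cmap)
  then have "form (h c x) z w = z \<bullet> (transpose (jacobian c d x) *v (h d (transition c d x) *v (jacobian c d x *v w)))"
    by (simp add: form_def matrix_vector_mul_assoc matrix_mul_assoc)
  also have "\<dots> = form (h d (transition c d x)) (jacobian c d x *v z) (jacobian c d x *v w)"
    unfolding form_def by (metis dot_lmul_matrix inner_commute transpose_matrix_vector)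
  finally show ?thesis by (simp add: jacobian_mult assms)
qed

lemma g_tensor: "symmetric_tensor_field C g"
  using metric by (simp add: pseudo_riemannian_def)

text \<open>The differential of a transition map pulls one nondegenerate metric back to another and
  is therefore injective; equality of dimensions does the rest, with no appeal to the inverse
  transition.\<close>

lemma dd_transition_surj:
  assumes "c \<in> C" "d \<in> C" "x \<in> overlap c d"
  shows "\<exists>z. dd z (transition c d) x = w"
proof -
  interpret c: metric_chart "cimg c" "g c" using metric_chart assms by blast
  have x: "x \<in> cimg c" using assms overlap_subset by blast
  have inj: "inj (\<lambda>z. dd z (transition c d) x)"
  proof (rule linear_injective_0[OF linear_dd[OF transition_differentiable[OF assms]], THEN iffD2, rule_format])
    fix z assume "dd z (transition c d) x = 0"
    then have "form (g c x) z w = 0" for w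
      by (simp add: tensor_transition[OF g_tensor assms] form_simps)
    then show "z = 0" by (rule c.form_nondeg[OF x])
  qed
  then have "surj (\<lambda>z. dd z (transition c d) x)"
    by (intro linear_injective_imp_surjective linear_dd transition_differentiable[OF assms]) auto
  then obtain z where "w = dd z (transition c d) x" by (rule surjE)
  then show ?thesis by blast
qed

lemma smooth_fields:
  assumes "c \<in> C"
  shows "smooth_on (cimg c) (g c)" "vector_field C X \<Longrightarrow> smooth_on (cimg c) (X c)"
    "symmetric_tensor_field C h \<Longrightarrow> smooth_on (cimg c) (h c)" "scalar_field C \<phi> \<Longrightarrow> smooth_on (cimg c) (\<phi> c)"
  using assms g_tensor by (auto simp: vector_field_def symmetric_tensor_field_def scalar_field_def)

lemma form_lie:
  assumes "vector_field C X" "c \<in> C" "x \<in> cimg c"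
  shows "form (lie_deriv (X c) (g c) x) z w = lie (X c) (g c) x z w"
  by (rule form_lie_deriv[OF smooth_on_differentiable[OF smooth_fields(1)[OF assms(2)] assms(3)]
      smooth_on_differentiable[OF smooth_fields(2)[OF assms(2,1)] assms(3)]])

text \<open>Both sides transform through the differential of the transition map, the Lie derivative
  by \<open>lie_pullback\<close>; the factor \<open>\<beta>\<close> is the same in every
  chart.\<close>

lemma homothety_at_transfer:
  assumes X: "vector_field C X" and c: "c \<in> C" and d: "d \<in> C" and q: "q \<in> cdom c" "q \<in> cdom d"
    and eq: "lie_deriv (X d) (g d) (cmap d q) = \<beta> *\<^sub>R g d (cmap d q)"
  shows "lie_deriv (X c) (g c) (cmap c q) = \<beta> *\<^sub>R g c (cmap c q)"
proof (rule form_ext)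
  fix i j
  let ?x = "cmap c q" and ?t = "transition c d"
  have x: "?x \<in> overlap c d" using q by (auto simp: overlap_def)
  have t: "?t ?x = cmap d q" using c q by (simp add: transition_cmap)
  have "lie (X c) (g c) ?x z w = lie (X d) (g d) (?t ?x) (dd z ?t ?x) (dd w ?t ?x)" for z w
  proof (rule lie_pullback[OF overlap_open[OF c d] x transition_smooth[OF c d]])
    show "?t ?x \<in> cimg d" using t q cmap_in by simp
    show "open (cimg d)" using chart_open d by blast
    show "smooth_on (overlap c d) (X c)" "smooth_on (overlap c d) (g c)"
      by (rule smooth_on_subset[OF smooth_fields(2)[OF c X] overlap_subset] smooth_on_subset[OF smooth_fields(1)[OF c] overlap_subset])+
    show "smooth_on (cimg d) (X d)" "smooth_on (cimg d) (g d)"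
      by (rule smooth_fields(2)[OF d X] smooth_fields(1)[OF d])+
    show "X d (?t y) = dd (X c y) ?t y" if "y \<in> overlap c d" for y
      by (rule vector_transition[OF X c d that])
    show "form (g c y) z w = form (g d (?t y)) (dd z ?t y) (dd w ?t y)" if "y \<in> overlap c d" for y z w
      by (rule tensor_transition[OF g_tensor c d that])
  qed
  then have "form (lie_deriv (X c) (g c) ?x) z w = form (lie_deriv (X d) (g d) (cmap d q)) (dd z ?t ?x) (dd w ?t ?x)" for z w
    using form_lie[OF X c cmap_in[OF q(1)]] form_lie[OF X d cmap_in[OF q(2)]] t by simp
  then show "form (lie_deriv (X c) (g c) ?x) (axis i 1) (axis j 1) = form (\<beta> *\<^sub>R g c ?x) (axis i 1) (axis j 1)"
    using tensor_transition[OF g_tensor c d x] by (simp add: eq form_simps t)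
qed

lemma lie_deriv_solution:
  assumes X: "inf_projective C g X" and c: "c \<in> C"
  shows "\<exists>p. metric_chart.solution (cimg c) (g c) (lie_deriv (X c) (g c)) p"
proof -
  interpret c: metric_chart "cimg c" "g c" using metric_chart c by blast
  have V: "vector_field C X" using X by (simp add: inf_projective_def)
  note sm = smooth_fields[OF c] 
  let ?phi = "\<lambda>x. divergence (g c) (X c) x / (real CARD('n) + 1)"
  have "c.solution (lie_deriv (X c) (g c)) (\<lambda>x. \<chi> i. pd i ?phi x)"
  proof (rule c.solution_if_eisenhart)
    show "smooth_on (cimg c) (lie_deriv (X c) (g c))"
      by (rule smooth_on_lie_deriv[OF c.S sm(1) sm(2)[OF V]])
    show "transpose (lie_deriv (X c) (g c) x) = lie_deriv (X c) (g c) x" if "x \<in> cimg c" for x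
      using that c.lie_G_sym sm(2)[OF V] by (intro lie_deriv_transpose c.G_diff) (auto intro: smooth_on_differentiable)
    show "smooth_on (cimg c) ?phi"
      using c.S c.divergence_smooth sm(2)[OF V] by (intro smooth_on_divide smooth_on_const) (auto simp: add_nonneg_eq_0_iff)
    show "cov_deriv (g c) (lie_deriv (X c) (g c)) x i j k =
      2 * g c x $ i $ j * pd k ?phi x + g c x $ i $ k * pd j ?phi x + g c x $ j $ k * pd i ?phi x"
      if "x \<in> cimg c" for x i j k
      using X c that by (simp add: inf_projective_def eisenhart_def)
  qed
  then show ?thesis by blast
qed

text \<open>A ball is used instead of the whole chart image because unique continuation runs along
  segments.\<close>

lemma homothety_on_ball:
  assumes X: "inf_projective C g X" and c: "c \<in> C" and B: "ball y r \<subseteq> cimg c"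
    and N: "open N" "x0 \<in> N" "N \<subseteq> ball y r" and eq: "\<And>x. x \<in> N \<Longrightarrow> lie_deriv (X c) (g c) x = \<beta> *\<^sub>R g c x"
    and x: "x \<in> ball y r"
  shows "lie_deriv (X c) (g c) x = \<beta> *\<^sub>R g c x"
proof -
  interpret c: metric_chart "cimg c" "g c" using metric_chart c by blast
  interpret b: metric_chart "ball y r" "g c" using c.metric_chart_subset[OF open_ball B] .
  obtain p where "c.solution (lie_deriv (X c) (g c)) p" using lie_deriv_solution[OF X c] by blast
  then have "c.solution (\<lambda>x. lie_deriv (X c) (g c) x - \<beta> *\<^sub>R g c x) p" by (rule c.solution_diff_metric)
  then have "b.solution (\<lambda>x. lie_deriv (X c) (g c) x - \<beta> *\<^sub>R g c x) p" by (rule c.solution_subset[OF open_ball B])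
  from b.solution_unique[OF this convex_ball _ N _ x] have "lie_deriv (X c) (g c) x - \<beta> *\<^sub>R g c x = 0"
    using eq card6 by auto
  then show ?thesis by simp
qed

text \<open>The points near which the equation holds form an open set by construction and a closed
  one by unique continuation; the manifold is connected.\<close>

lemma homothety_if_local:
  assumes X: "inf_projective C g X" and c0: "c0 \<in> C" and N0: "open N0" "x0 \<in> N0" "N0 \<subseteq> cimg c0"
    and eq0: "\<And>x. x \<in> N0 \<Longrightarrow> lie_deriv (X c0) (g c0) x = \<beta> *\<^sub>R g c0 x"
  shows "c \<in> C \<Longrightarrow> x \<in> cimg c \<Longrightarrow> lie_deriv (X c) (g c) x = \<beta> *\<^sub>R g c x"
proof -
  have V: "vector_field C X" using X by (simp add: inf_projective_def)
  define good where "good c N \<longleftrightarrow> open N \<and> N \<subseteq> cimg c \<and> (\<forall>x\<in>N. lie_deriv (X c) (g c) x = \<beta> *\<^sub>R g c x)" for c N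
  define Z where "Z = {q. \<exists>c\<in>C. q \<in> cdom c \<and> (\<exists>N. good c N \<and> cmap c q \<in> N)}"
  have "open Z"
  proof (rule Topological_Spaces.openI)
    fix q assume "q \<in> Z"
    then obtain c N where c: "c \<in> C" "q \<in> cdom c" "good c N" "cmap c q \<in> N" by (auto simp: Z_def)
    then show "\<exists>T. open T \<and> q \<in> T \<and> T \<subseteq> Z"
      using open_vimage_cmap[of c N] by (intro exI[of _ "cdom c \<inter> cmap c -` N"]) (auto simp: Z_def good_def)
  qed
  moreover have "open (- Z)"
  proof (rule Topological_Spaces.openI)
    fix q assume q: "q \<in> - Z"
    obtain c where c: "c \<in> C" "q \<in> cdom c" using chart_cover by blast
    obtain r where r: "r > 0" "ball (cmap c q) r \<subseteq> cimg c"
      using chart_open(2)[OF c(1)] cmap_in[OF c(2)] open_contains_ball by blast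
    let ?B = "ball (cmap c q) r"
    \<comment> \<open>If one point over the ball belonged to \<open>Z\<close>, the equation would
      hold on a small open set, spread over the whole ball, and so put the centre \<open>q\<close>
      into \<open>Z\<close>.\<close>
    have "q' \<notin> Z" if q': "q' \<in> cdom c" "cmap c q' \<in> ?B" for q'
    proof
      assume "q' \<in> Z"
      then obtain d N where d: "d \<in> C" "q' \<in> cdom d" "good d N" "cmap d q' \<in> N" by (auto simp: Z_def)
      define T where "T = (cdom c \<inter> cmap c -` ?B) \<inter> (cdom d \<inter> cmap d -` N)"
      have T: "open T" "q' \<in> T" "T \<subseteq> cdom c"
        using open_vimage_cmap[OF c(1) open_ball] open_vimage_cmap[OF d(1)] d q' by (auto simp: T_def good_def)
      have o: "open (cmap c ` T)" by (rule open_image_cmap[OF c(1) T(1,3)])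
      have eqT: "lie_deriv (X c) (g c) y = \<beta> *\<^sub>R g c y" if y: "y \<in> cmap c ` T" for y
      proof -
        obtain u where u: "y = cmap c u" "u \<in> T" using y by blast
        have "lie_deriv (X d) (g d) (cmap d u) = \<beta> *\<^sub>R g d (cmap d u)"
          using u d by (auto simp: T_def good_def)
        then show ?thesis using homothety_at_transfer[OF V c(1) d(1), of u] u by (auto simp: T_def)
      qed
      have "lie_deriv (X c) (g c) y = \<beta> *\<^sub>R g c y" if "y \<in> ?B" for y
        by (rule homothety_on_ball[OF X c(1) r(2) o _ _ eqT that, of "cmap c q'"]) (use T in \<open>auto simp: T_def\<close>)
      then have "good c ?B" using r by (auto simp: good_def)
      then have "q \<in> Z" using c r by (auto simp: Z_def intro!: bexI[of _ c] exI[of _ ?B])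
      then show False using q by blast
    qed
    then show "\<exists>T. open T \<and> q \<in> T \<and> T \<subseteq> - Z"
      using open_vimage_cmap[OF c(1) open_ball, of "cmap c q" r] c r
      by (intro exI[of _ "cdom c \<inter> cmap c -` ?B"]) auto
  qed
  moreover have "cinv c0 x0 \<in> Z"
  proof -
    have "x0 \<in> cimg c0" using N0 by blast
    note q = cmap_cinv[OF c0 this]
    have "good c0 N0" using N0 eq0 by (simp add: good_def)
    then have "\<exists>N. good c0 N \<and> cmap c0 (cinv c0 x0) \<in> N" using q N0(2) by auto
    then show ?thesis using c0 q unfolding Z_def by blast
  qed
  ultimately have "Z = UNIV"
    using conn unfolding connected_clopen by (auto simp: closed_def)
  show "lie_deriv (X c) (g c) x = \<beta> *\<^sub>R g c x" if c: "c \<in> C" and x: "x \<in> cimg c"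
  proof -
    let ?q = "cinv c x"
    have q: "?q \<in> cdom c" "cmap c ?q = x" using cmap_cinv[OF c x] by auto
    have "?q \<in> Z" using \<open>Z = UNIV\<close> by simp
    then obtain d N where d: "d \<in> C" "?q \<in> cdom d" "good d N" "cmap d ?q \<in> N" by (auto simp: Z_def)
    then have "lie_deriv (X d) (g d) (cmap d ?q) = \<beta> *\<^sub>R g d (cmap d ?q)" by (auto simp: good_def)
    from homothety_at_transfer[OF V c d(1) q(1) d(2) this] show ?thesis using q by simp
  qed
qed

end

section \<open>Rigid h-spaces\<close>

locale rigid_manifold = pseudo_riemannian_manifold C g pos neg
  for C :: "('a::{t2_space, second_countable_topology}, 'n::finite) chart set" and g pos neg +
  fixes h :: "('a, 'n) bilinears"
  assumes rigid: "rigid_h_space C g h"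
begin

lemma h_tensor: "symmetric_tensor_field C h"
  using rigid by (simp add: rigid_h_space_def h_space_def)

lemma h_cyclic: "c \<in> C \<Longrightarrow> x \<in> cimg c \<Longrightarrow> \<exists>e. cyclic_vector ((*v) (metric_chart.operator (g c) (h c) x)) e"
proof -
  assume c: "c \<in> C" "x \<in> cimg c"
  have "distinct_bases (matrix_inv (g c x) ** h c x)"
    using rigid c unfolding rigid_h_space_def by blast
  then show ?thesis
    unfolding metric_chart.operator_def[OF metric_chart[OF c(1)]] by (rule cyclic_vector_if_distinct_bases)
qed

text \<open>The gradients in all charts come from a single scalar potential. Their covector law is
  what the comparison of Hessians between two charts needs.\<close>

lemma h_solution:
  "\<exists>p. (\<forall>c\<in>C. metric_chart.solution (cimg c) (g c) (h c) (p c)) \<and>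
     (\<forall>c\<in>C. \<forall>d\<in>C. \<forall>x\<in>overlap c d. \<forall>z. p c x \<bullet> z = p d (transition c d x) \<bullet> dd z (transition c d) x)"
proof -
  obtain \<phi> where phi: "scalar_field C \<phi>" "eisenhart C g h \<phi>"
    using rigid by (auto simp: rigid_h_space_def h_space_def)
  define p where "p c x = (\<chi> i. pd i (\<phi> c) x)" for c x
  have pz: "p c x \<bullet> z = dd z (\<phi> c) x" if "c \<in> C" "x \<in> cimg c" for c x z
    using dd_eq_sum_pd[OF smooth_on_differentiable[OF smooth_fields(4)[OF that(1) phi(1)] that(2)], of z]
    by (simp add: p_def inner_vec_def mult.commute)
  have "metric_chart.solution (cimg c) (g c) (h c) (p c)" if c: "c \<in> C" for c
  proof -
    interpret c: metric_chart "cimg c" "g c" using metric_chart c by blast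
    show ?thesis unfolding p_def
    proof (rule c.solution_if_eisenhart)
      show "smooth_on (cimg c) (h c)" "smooth_on (cimg c) (\<phi> c)"
        by (rule smooth_fields(3)[OF c h_tensor] smooth_fields(4)[OF c phi(1)])+
    qed (use h_tensor phi c in \<open>auto simp: symmetric_tensor_field_def eisenhart_def\<close>)
  qed
  moreover have "p c x \<bullet> z = p d (transition c d x) \<bullet> dd z (transition c d) x"
    if c: "c \<in> C" and d: "d \<in> C" and x: "x \<in> overlap c d" for c d x z
  proof -
    note x' = overlap_in[OF c x]
    have "dd z (\<phi> c) x = dd z (\<lambda>y. \<phi> d (transition c d y)) x"
    proof (rule dd_cong[OF overlap_open[OF c d] x])
      show "\<phi> c y = \<phi> d (transition c d y)" if y: "y \<in> overlap c d" for y
      proof -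
        obtain q where q: "q \<in> cdom c \<inter> cdom d" "y = cmap c q" using y by (auto simp: overlap_def)
        have "\<phi> d (cmap d q) = \<phi> c (cmap c q)"
          using phi(1) c d q(1) unfolding scalar_field_def by blast
        then show ?thesis using q c by (simp add: transition_cmap)
      qed
    qed
    also have "\<dots> = dd (dd z (transition c d) x) (\<phi> d) (transition c d x)"
      using smooth_on_differentiable[OF smooth_fields(4)[OF d phi(1)] x'(2)]
      by (rule dd_comp[OF transition_differentiable[OF c d x]])
    finally show ?thesis using pz c d x' by simp
  qed
  ultimately show ?thesis by blast
qed

text \<open>The Hessian of the potential, being half the Lie derivative of the metric along the gradient, is
  a tensor; comparing it in two charts shows that the sectional curvature does not depend on the chart.\<close>

lemma scal_transition:
  assumes c: "c \<in> C" and d: "d \<in> C" and x: "x \<in> overlap c d"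
    and kc: "metric_chart.constant_type (g c) x k" and kd: "metric_chart.constant_type (g d) (transition c d x) k'"
  shows "k = k'"
proof -
  let ?t = "transition c d"
  interpret c: metric_chart "cimg c" "g c" using metric_chart c by blast
  interpret d: metric_chart "cimg d" "g d" using metric_chart d by blast
  have x': "y \<in> cimg c \<and> ?t y \<in> cimg d" if "y \<in> overlap c d" for y
    using overlap_in[OF c that] by blast
  obtain p where sol: "\<And>c. c \<in> C \<Longrightarrow> metric_chart.solution (cimg c) (g c) (h c) (p c)"
    and p: "\<And>c d x z. c \<in> C \<Longrightarrow> d \<in> C \<Longrightarrow> x \<in> overlap c d \<Longrightarrow> p c x \<bullet> z = p d (transition c d x) \<bullet> dd z (transition c d) x"
    using h_solution by blast
  have ps: "smooth_on (cimg c) (p c)" "smooth_on (cimg d) (p d)"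
    using sol[OF c] sol[OF d] by (simp_all add: c.solution_def d.solution_def)
  let ?V = "\<lambda>y. matrix_inv (g c y) *v p c y" and ?V' = "\<lambda>y. matrix_inv (g d y) *v p d y"
  have lie: "lie ?V (g c) x z w = lie ?V' (g d) (?t x) (dd z ?t x) (dd w ?t x)" for z w
  proof (rule lie_pullback[OF overlap_open[OF c d] x transition_smooth[OF c d]])
    show "?t x \<in> cimg d" "open (cimg d)" using x' x d.S by auto
    have "smooth_on (cimg c) ?V" using c.S c.inv_smooth ps by (intro smooth_on_matrix_vector)
    then show "smooth_on (overlap c d) ?V" by (rule smooth_on_subset[OF _ overlap_subset])
    show "smooth_on (overlap c d) (g c)" by (rule smooth_on_subset[OF c.G_smooth overlap_subset])
    show "smooth_on (cimg d) ?V'" using d.S d.inv_smooth ps by (intro smooth_on_matrix_vector)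
    show "smooth_on (cimg d) (g d)" by (rule d.G_smooth)
    show "form (g c y) z w = form (g d (?t y)) (dd z ?t y) (dd w ?t y)" if "y \<in> overlap c d" for y z w
      by (rule tensor_transition[OF g_tensor c d that])
    \<comment> \<open>Gradient fields correspond under the transition: both sides are paired with an
      arbitrary \<open>w\<close>, which is the image of some \<open>z\<close>, and reduce to the
      covector law.\<close>
    show "?V' (?t y) = dd (?V y) ?t y" if y: "y \<in> overlap c d" for y
    proof (rule d.form_eqI[of "?t y"])
      show "?t y \<in> cimg d" using x' y by blast
      fix w
      obtain z where z: "dd z ?t y = w" using dd_transition_surj[OF c d y] by blast
      have "form (g d (?t y)) (?V' (?t y)) w = p d (?t y) \<bullet> w"
        using d.g_sym[of "?t y" "?V' (?t y)" w] x'[OF y] by (simp add: form_def d.G_inv inner_commute)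
      also have "\<dots> = p c y \<bullet> z" using p[OF c d y, of z] z by simp
      also have "\<dots> = form (g c y) (?V y) z"
        using c.g_sym[of y "?V y" z] x'[OF y] by (simp add: form_def c.G_inv inner_commute)
      also have "\<dots> = form (g d (?t y)) (dd (?V y) ?t y) w"
        using tensor_transition[OF g_tensor c d y, of "?V y" z] z by simp
      finally show "form (g d (?t y)) (?V' (?t y)) w = form (g d (?t y)) (dd (?V y) ?t y) w" .
    qed
  qed
  have xc: "x \<in> cimg c" "?t x \<in> cimg d" using x' x by auto
  have hess: "c.hess (p c) x z w = d.hess (p d) (?t x) (dd z ?t x) (dd w ?t x)" for z w
    using lie[of z w] c.lie_grad[OF ps(1) xc(1), of z w] d.lie_grad[OF ps(2) xc(2), of "dd z ?t x" "dd w ?t x"]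
      c.hess_sym[OF sol[OF c] xc(1), of z w] d.hess_sym[OF sol[OF d] xc(2), of "dd z ?t x" "dd w ?t x"] by simp
  obtain m where m: "c.hess (p c) x z w = m * form (g c x) z w - k * form (h c x) z w" for z w
    using c.constant_type_hess[OF xc(1) kc sol[OF c]] by blast
  obtain m' where m': "d.hess (p d) (?t x) z w = m' * form (g d (?t x)) z w - k' * form (h d (?t x)) z w" for z w
    using d.constant_type_hess[OF xc(2) kd sol[OF d]] by blast
  \<comment> \<open>Each chart writes the same Hessian as a pencil of the same two tensors. For
    \<open>k \<noteq> k'\<close> the difference would make \<open>h\<close> proportional to
    \<open>g\<close>.\<close>
  have eq: "(k - k') * form (h c x) z w = (m - m') * form (g c x) z w" for z w
    using hess[of z w] unfolding m m' tensor_transition[OF g_tensor c d x, symmetric] tensor_transition[OF h_tensor c d x, symmetric]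
    by (simp add: algebra_simps)
  show ?thesis
  proof (rule ccontr)
    assume ne: "k \<noteq> k'"
    have "h c x = ((m - m') / (k - k')) *\<^sub>R g c x"
      by (rule form_ext) (use eq ne in \<open>simp add: form_simps field_simps\<close>)
    then show False using c.not_proportional[OF card6 xc(1) h_cyclic[OF c xc(1)]] by blast
  qed
qed

lemma ex_not_constant_type:
  assumes "\<not> constant_curvature C g"
  shows "\<exists>c\<in>C. \<exists>x\<in>cimg c. \<nexists>k. metric_chart.constant_type (g c) x k"
proof (rule ccontr)
  assume "\<not> ?thesis"
  then have ct: "\<exists>k. metric_chart.constant_type (g c) x k" if "c \<in> C" "x \<in> cimg c" for c x using that by blast
  define ch where "ch q = (SOME c. c \<in> C \<and> q \<in> cdom c)" for q
  have ch: "ch q \<in> C \<and> q \<in> cdom (ch q)" for q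
  proof -
    have "\<exists>c. c \<in> C \<and> q \<in> cdom c" using chart_cover[of q] by blast
    then show ?thesis unfolding ch_def by (rule someI_ex)
  qed
  \<comment> \<open>The sectional curvature at \<open>q\<close>, read off in an arbitrarily chosen
    chart; \<open>scal_transition\<close> makes the choice immaterial.\<close>
  define K where "K q = metric_chart.scal (g (ch q)) (cmap (ch q) q) / 30" for q
  have kc: "metric_chart.constant_type (g c) x (metric_chart.scal (g c) x / 30)" if c: "c \<in> C" and x: "x \<in> cimg c" for c x
  proof -
    interpret c: metric_chart "cimg c" "g c" using metric_chart c by blast
    obtain k where k: "c.constant_type x k" using ct c x by blast
    then have e: "k = c.scal x / 30" using c.constant_type_scal[OF x k] card6 by simp
    show ?thesis using k by (simp only: e)
  qed
  have K: "K q = metric_chart.scal (g c) (cmap c q) / 30" if c: "c \<in> C" and q: "q \<in> cdom c" for c q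
    unfolding K_def
  proof (rule scal_transition[of "ch q" c "cmap (ch q) q"])
    show "metric_chart.constant_type (g (ch q)) (cmap (ch q) q) (metric_chart.scal (g (ch q)) (cmap (ch q) q) / 30)"
      using ch[of q] by (intro kc cmap_in) auto
    have "transition (ch q) c (cmap (ch q) q) = cmap c q" using ch by (simp add: transition_cmap)
    then show "metric_chart.constant_type (g c) (transition (ch q) c (cmap (ch q) q)) (metric_chart.scal (g c) (cmap c q) / 30)"
      using kc[OF c cmap_in[OF q]] by simp
  qed (use ch c q in \<open>auto simp: overlap_def\<close>)
  have "K constant_on UNIV"
  proof (rule locally_constant_imp_constant[OF conn])
    fix q :: 'a
    obtain c where c: "c \<in> C" "q \<in> cdom c" using chart_cover by blast
    interpret c: metric_chart "cimg c" "g c" using metric_chart c by blast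
    obtain p where sol: "c.solution (h c) p" using h_solution c(1) by blast
    obtain r where r: "r > 0" "ball (cmap c q) r \<subseteq> cimg c"
      using chart_open(2)[OF c(1)] cmap_in[OF c(2)] open_contains_ball by blast
    let ?B = "ball (cmap c q) r"
    have "(c.scal has_derivative (\<lambda>h. 0)) (at y within ?B)" if "y \<in> ?B" for y
    proof -
      have y: "y \<in> cimg c" using that r by blast
      have "dd v c.scal y = 0" for v
        using c.schur[OF card6 sol h_cyclic[OF c(1)] ct[OF c(1)] y] .
      then show ?thesis
        using has_derivative_dd[OF smooth_on_differentiable[OF c.scal_smooth y]] has_derivative_at_withinI by auto
    qed
    then obtain s where s: "\<And>y. y \<in> ?B \<Longrightarrow> c.scal y = s"
      using has_derivative_zero_constant[OF convex_ball, of "cmap c q" r c.scal] by auto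
    define T where "T = cdom c \<inter> cmap c -` ?B"
    have oT: "open T" unfolding T_def by (rule open_vimage_cmap[OF c(1) open_ball])
    have qT: "q \<in> T" using c(2) r(1) by (simp add: T_def)
    have KT: "K q' = K q" if "q' \<in> T" for q'
    proof -
      have "K q' = s / 30" using that K[OF c(1), of q'] s[of "cmap c q'"] by (simp add: T_def)
      moreover have "K q = s / 30" using K[OF c] s[of "cmap c q"] r(1) by simp
      ultimately show ?thesis by simp
    qed
    show "\<exists>T. openin (top_of_set UNIV) T \<and> q \<in> T \<and> (\<forall>x\<in>T. K x = K q)"
      using oT by (intro exI[of _ T] conjI ballI KT qT) simp_all
  qed
  then obtain k where k: "\<And>q. K q = k" by (auto simp: constant_on_def)
  have "metric_chart.constant_type (g c) x k" if c: "c \<in> C" and x: "x \<in> cimg c" for c x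
  proof -
    have e: "metric_chart.scal (g c) x / 30 = k"
      using K[OF c, of "cinv c x"] cmap_cinv[OF c x] k by simp
    show ?thesis using kc[OF c x] by (simp only: e)
  qed
  then have "constant_curvature C g"
    unfolding constant_curvature_def using metric_chart.riemann_if_constant_type[OF metric_chart] by blast
  then show False using assms by simp
qed

lemma pencil_on_ball:
  assumes "\<not> constant_curvature C g"
  shows "\<exists>c\<in>C. \<exists>x0 r. r > 0 \<and> ball x0 r \<subseteq> cimg c \<and>
    (\<forall>X. inf_projective C g X \<longrightarrow> (\<exists>a b. \<forall>x\<in>ball x0 r. lie_deriv (X c) (g c) x = a *\<^sub>R g c x + b *\<^sub>R h c x))"
proof -
  obtain c x0 where c: "c \<in> C" "x0 \<in> cimg c" "\<nexists>k. metric_chart.constant_type (g c) x0 k"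
    using ex_not_constant_type[OF assms] by blast
  interpret c: metric_chart "cimg c" "g c" using metric_chart c by blast
  obtain p where sol: "c.solution (h c) p" using h_solution c(1) by blast
  obtain N where N: "open N" "x0 \<in> N" "N \<subseteq> cimg c" "\<And>y. y \<in> N \<Longrightarrow> \<nexists>k. c.constant_type y k"
    using c.not_constant_type_open[OF c(2,3)] card6 by auto
  have cyc: "\<exists>e. cyclic_vector ((*v) (c.operator (h c) x)) e" if "x \<in> N" for x
    using h_cyclic[OF c(1)] N(3) that by blast
  obtain r where r: "r > 0" "ball x0 r \<subseteq> N"
    and pencil: "\<forall>H' p'. c.solution H' p' \<longrightarrow> (\<forall>x\<in>N. \<exists>a b. H' x = a *\<^sub>R g c x + b *\<^sub>R h c x) \<longrightarrow>
       (\<exists>a b. \<forall>x\<in>ball x0 r. H' x = a *\<^sub>R g c x + b *\<^sub>R h c x)"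
    using c.pencil_coefficients_constant[OF card6 sol N(1,3,2)] cyc by blast
  show ?thesis
  proof (rule bexI[OF _ c(1)], rule exI[of _ x0], rule exI[of _ r], intro conjI r(1) allI impI)
    show "ball x0 r \<subseteq> cimg c" using r N by blast
    fix X assume X: "inf_projective C g X"
    obtain p' where sol': "c.solution (lie_deriv (X c) (g c)) p'" using lie_deriv_solution[OF X c(1)] by blast
    have "\<exists>a b. lie_deriv (X c) (g c) x = a *\<^sub>R g c x + b *\<^sub>R h c x" if x: "x \<in> N" for x
    proof -
      obtain e where "cyclic_vector ((*v) (c.operator (h c) x)) e" using cyc[OF x] by blast
      from c.constant_type_or_pencil_at[OF card6 _ sol sol' this] show ?thesis using N x by blast
    qed
    then show "\<exists>a b. \<forall>x\<in>ball x0 r. lie_deriv (X c) (g c) x = a *\<^sub>R g c x + b *\<^sub>R h c x" by (rule pencil[rule_format, OF sol'])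
  qed
qed

lemma homothetic_subalgebra:
  assumes nc: "\<not> constant_curvature C g" and P: "lie_algebra C P" "has_dim P r"
    and proj: "\<forall>X\<in>P. inf_projective C g X" and non: "\<exists>X\<in>P. \<not> inf_homothety C g X"
  shows "\<exists>H\<subseteq>P. lie_algebra C H \<and> has_dim H (r - 1) \<and> (\<forall>X\<in>H. inf_homothety C g X)"
proof -
  obtain c x0 \<rho> where c: "c \<in> C" and \<rho>: "\<rho> > 0" "ball x0 \<rho> \<subseteq> cimg c"
    and pencil: "\<And>X. inf_projective C g X \<Longrightarrow> \<exists>a b. \<forall>x\<in>ball x0 \<rho>. lie_deriv (X c) (g c) x = a *\<^sub>R g c x + b *\<^sub>R h c x"
    using pencil_on_ball[OF nc] by blast
  interpret c: metric_chart "cimg c" "g c" using metric_chart c by blast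
  let ?B = "ball x0 \<rho>"
  have x0: "x0 \<in> ?B" "x0 \<in> cimg c" using \<rho> by auto
  have VP: "vector_field C X" if "X \<in> P" for X using P(1) that by (simp add: lie_algebra_def)
  have subP: "subspace P" using P(1) by (simp add: lie_algebra_def)
  have Xs: "smooth_on (cimg c) (X c)" if "X \<in> P" for X using smooth_fields(2)[OF c VP[OF that]] .
  obtain a b where ab: "\<And>X x. X \<in> P \<Longrightarrow> x \<in> ?B \<Longrightarrow> lie_deriv (X c) (g c) x = a X *\<^sub>R g c x + b X *\<^sub>R h c x"
    using pencil proj by metis
  \<comment> \<open>The functions \<open>a\<close> and \<open>b\<close> come from arbitrary choices.
    As \<open>h\<close> is not proportional to \<open>g\<close> at \<open>x0\<close>, the value of
    the Lie derivative at this one point determines \<open>b\<close>; this yields linearity and the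
    value on brackets.\<close>
  have uniq: "b X = t" if X: "X \<in> P" and eq: "lie_deriv (X c) (g c) x0 = s *\<^sub>R g c x0 + t *\<^sub>R h c x0" for X s t
  proof (rule ccontr)
    assume ne: "b X \<noteq> t"
    have "(t - b X) *\<^sub>R h c x0 = (a X - s) *\<^sub>R g c x0"
      using eq ab[OF X x0(1)] by (simp add: algebra_simps)
    then have "(1 / (t - b X)) *\<^sub>R (t - b X) *\<^sub>R h c x0 = (1 / (t - b X)) *\<^sub>R (a X - s) *\<^sub>R g c x0" by simp
    then have "h c x0 = ((a X - s) / (t - b X)) *\<^sub>R g c x0" using ne by simp
    then show False using c.not_proportional[OF card6 x0(2) h_cyclic[OF c x0(2)]] by blast
  qed
  have lin: "lie_deriv ((s *\<^sub>R X + t *\<^sub>R Y) c) (g c) x = s *\<^sub>R lie_deriv (X c) (g c) x + t *\<^sub>R lie_deriv (Y c) (g c) x"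
    if "X \<in> P" "Y \<in> P" "x \<in> cimg c" for X Y x s t
  proof (rule form_ext)
    fix i j
    have XY: "s *\<^sub>R X + t *\<^sub>R Y \<in> P" using subP that by (simp add: subspace_add subspace_scale)
    have d: "X c differentiable (at x)" "Y c differentiable (at x)"
      using Xs that smooth_on_differentiable by blast+
    have e: "(s *\<^sub>R X + t *\<^sub>R Y) c = (\<lambda>y. s *\<^sub>R X c y + t *\<^sub>R Y c y)" by (simp add: fun_eq_iff scaleR_fun_def)
    have "dd v (\<lambda>y. s *\<^sub>R X c y + t *\<^sub>R Y c y) x = s *\<^sub>R dd v (X c) x + t *\<^sub>R dd v (Y c) x" for v
      using d by (simp add: dd_add dd_bounded_linear[OF bounded_linear_scaleR_right] differentiable_bounded_linear[OF bounded_linear_scaleR_right])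
    then have "lie ((s *\<^sub>R X + t *\<^sub>R Y) c) (g c) x z w = s * lie (X c) (g c) x z w + t * lie (Y c) (g c) x z w" for z w
      unfolding e by (simp add: lie_def form_simps dd_direction_simps c.G_diff that algebra_simps)
    then show "form (lie_deriv ((s *\<^sub>R X + t *\<^sub>R Y) c) (g c) x) (axis i 1) (axis j 1) =
      form (s *\<^sub>R lie_deriv (X c) (g c) x + t *\<^sub>R lie_deriv (Y c) (g c) x) (axis i 1) (axis j 1)"
      by (simp only: form_lie[OF VP[OF XY] c that(3)] form_lie[OF VP[OF that(1)] c that(3)]
          form_lie[OF VP[OF that(2)] c that(3)] form_simps)
  qed
  have blin: "b (s *\<^sub>R X + t *\<^sub>R Y) = s * b X + t * b Y" if "X \<in> P" "Y \<in> P" for X Y s t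
  proof (rule uniq)
    show "s *\<^sub>R X + t *\<^sub>R Y \<in> P" using subP that by (simp add: subspace_add subspace_scale)
    show "lie_deriv ((s *\<^sub>R X + t *\<^sub>R Y) c) (g c) x0 = (s * a X + t * a Y) *\<^sub>R g c x0 + (s * b X + t * b Y) *\<^sub>R h c x0"
      unfolding lin[OF that x0(2)] ab[OF that(1) x0(1)] ab[OF that(2) x0(1)]
      by (simp add: scaleR_add_left scaleR_add_right)
  qed
  define H where "H = {X \<in> P. b X = 0}"
  have homothety: "lie_deriv (X d) (g d) x = a X *\<^sub>R g d x" if X: "X \<in> H" and d: "d \<in> C" "x \<in> cimg d" for X d x
  proof (rule homothety_if_local[OF _ c open_ball x0(1) \<rho>(2) _ d])
    show "inf_projective C g X" using proj X by (simp add: H_def)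
    show "lie_deriv (X c) (g c) y = a X *\<^sub>R g c y" if "y \<in> ?B" for y
      using ab[of X y] X that by (simp add: H_def)
  qed
  have hom: "inf_homothety C g X" if "X \<in> H" for X
    using homothety[OF that] VP that by (auto simp: inf_homothety_def H_def)
  have sub: "subspace H"
  proof (rule subspaceI)
    have "(0 :: ('a, 'n) vectors) \<in> P" using subP by (rule subspace_0)
    then show "0 \<in> H" using blin[of 0 0 0 0] by (simp add: H_def)
    show "X + Y \<in> H" if "X \<in> H" "Y \<in> H" for X Y
      using that blin[of X Y 1 1] subP by (simp add: H_def subspace_add)
    show "s *\<^sub>R X \<in> H" if "X \<in> H" for X s
      using that blin[of X X s 0] subP by (simp add: H_def subspace_scale)
  qed
  \<comment> \<open>The Lie derivative of the metric along a bracket of two homotheties vanishes, so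
    \<open>uniq\<close> with both coefficients zero puts the bracket into the kernel
    \<open>H\<close>.\<close>
  have bracket: "(\<lambda>d. bracket (X d) (Y d)) \<in> H" if X: "X \<in> H" and Y: "Y \<in> H" for X Y
  proof -
    let ?Z = "\<lambda>d. bracket (X d) (Y d)"
    have XY: "X \<in> P" "Y \<in> P" using X Y by (auto simp: H_def)
    then have Z: "?Z \<in> P" using P(1) by (simp add: lie_algebra_def)
    have br: "bracket (X c) (Y c) y = dd (X c y) (Y c) y - dd (Y c y) (X c) y" if "y \<in> cimg c" for y
      using Xs XY that by (intro bracket_eq smooth_on_differentiable)
    have liebr: "lie (\<lambda>y. dd (X c y) (Y c) y - dd (Y c y) (X c) y) (g c) x0 z w = 0" for z w
    proof (rule lie_bracket_homothetic[OF c.S x0(2) c.G_smooth Xs[OF XY(1)] Xs[OF XY(2)]])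
      show "lie (X c) (g c) y z w = a X * form (g c y) z w" if "y \<in> cimg c" for y z w
        using form_lie[OF VP[OF XY(1)] c that] homothety[OF X c that] by (simp add: form_simps)
      show "lie (Y c) (g c) y z w = a Y * form (g c y) z w" if "y \<in> cimg c" for y z w
        using form_lie[OF VP[OF XY(2)] c that] homothety[OF Y c that] by (simp add: form_simps)
    qed
    have "lie (bracket (X c) (Y c)) (g c) x0 z w = 0" for z w
    proof -
      have "dd v (bracket (X c) (Y c)) x0 = dd v (\<lambda>y. dd (X c y) (Y c) y - dd (Y c y) (X c) y) x0" for v
        by (rule dd_cong[OF c.S x0(2) br])
      then show ?thesis using liebr[of z w] br[OF x0(2)] by (simp add: lie_def)
    qed
    then have "form (lie_deriv (?Z c) (g c) x0) (axis i 1) (axis j 1) = form 0 (axis i 1) (axis j 1)" for i j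
      using form_lie[OF VP[OF Z] c x0(2)] by (simp add: form_simps)
    then have "lie_deriv (?Z c) (g c) x0 = 0" by (rule form_ext)
    then have "b ?Z = 0" using uniq[OF Z, of 0 0] by simp
    then show ?thesis using Z by (simp add: H_def)
  qed
  have alg: "lie_algebra C H"
    using sub bracket VP by (auto simp: lie_algebra_def H_def)
  obtain X0 where X0: "X0 \<in> P" "\<not> inf_homothety C g X0" using non by blast
  then have X0H: "X0 \<notin> H" using hom by blast
  have "has_dim H (r - 1)"
  proof (rule has_dim_hyperplane[OF P(2) subP sub _ X0(1) X0H])
    show "H \<subseteq> P" by (auto simp: H_def)
    fix Y assume Y: "Y \<in> P"
    \<comment> \<open>Fields in the kernel of \<open>b\<close> are homotheties, so the nonhomothetic
      \<open>X0\<close> has \<open>b X0 \<noteq> 0\<close>. Subtracting \<open>b Y / b X0\<close>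
      times \<open>X0\<close> moves \<open>Y\<close> into the kernel.\<close>
    have b0: "b X0 \<noteq> 0" using X0 X0H by (simp add: H_def)
    have "b (1 *\<^sub>R Y + (- (b Y / b X0)) *\<^sub>R X0) = 0"
      using blin[OF Y X0(1), of 1 "- (b Y / b X0)"] b0 by simp
    moreover have "Y - (b Y / b X0) *\<^sub>R X0 \<in> P" using Y X0 subP by (simp add: subspace_diff subspace_scale)
    ultimately show "\<exists>s. Y - s *\<^sub>R X0 \<in> H" by (intro exI[of _ "b Y / b X0"]) (simp add: H_def)
  qed
  then show ?thesis using alg hom by (intro exI[of _ H]) (auto simp: H_def)
qed

end

theorem theorem5:
  fixes C :: "('a::{t2_space, second_countable_topology}, 6) chart set"
    and g h :: "('a, 6) bilinears"
    and P :: "('a, 6) vectors set"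
    and r :: nat
  assumes "smooth_atlas C"
    and "connected (UNIV :: 'a set)"
    and "pseudo_riemannian C 2 4 g"
    and "rigid_h_space C g h"
    and "\<not> constant_curvature C g"
    and "lie_algebra C P"
    and "has_dim P r"
    and "\<forall>X\<in>P. inf_projective C g X"
    and "\<exists>X\<in>P. \<not> inf_homothety C g X"
  shows "\<exists>H\<subseteq>P. lie_algebra C H \<and> has_dim H (r - 1) \<and> (\<forall>X\<in>H. inf_homothety C g X)"
proof -
  interpret rigid_manifold C g 2 4 h
    by unfold_locales (use assms in simp_all)
  show ?thesis using assms by (intro homothetic_subalgebra)
qed

end
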